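(* Let $\psi \in L^1(\mathbb{T})$ and let $P_+\psi$ denote its Riesz projection. Then \[\exp\left(\int_0^{2\pi} \log|P_+ \psi(e^{i\theta})|\,\frac{d\theta}{2\pi}\right) \leq \|\psi\|_{L^1(\mathbb{T})}.\] Moreover, for a nontrivial $\psi \in L^1(\mathbb{T})$, equality holds if and only if $\overline{I}\,\psi \geq 0$ almost everywhere on $\mathbb{T}$, where $I$ denotes the inner factor of $P_+\psi$.
   Context: $\mathbb{T}$ is the unit circle with normalized arc length measure $d\theta/2\pi$. For $0<p<\infty$, $H^p$ is the Hardy space of analytic functions $\varphi$ on the unit disc with $\sup_{0<r<1}\int_0^{2\pi}|\varphi(re^{i\theta})|^p\,\frac{d\theta}{2\pi}<\infty$, identified with its boundary values on $\mathbb{T}$. The Riesz projection of $\psi\in L^1(\mathbb{T})$ is $P_+\psi(e^{i\theta})=\sum_{n\ge 0}\widehat{\psi}(n)e^{in\theta}$; for $\psi\in L^1$, $P_+\psi$ belongs to $H^p$ for every $0<p<1$ and thus (when nontrivial) has a canonical inner-outer factorization $P_+\psi = I\Phi$ with $I$ inner and $\Phi$ outer. *)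

theory Defs
  imports "HOL-Analysis.Analysis"
begin

text \<open>The unit circle is parametrised by theta in [0, 2 pi]; functions on the circle are
  functions real => complex, and the normalised measure is Lebesgue measure on [0, 2 pi]
  divided by 2 pi.\<close>

definition circle_L1_norm :: "(real \<Rightarrow> complex) \<Rightarrow> real" where
  "circle_L1_norm f = (1 / (2*pi)) * (LINT \<theta>:{0..2*pi}|lebesgue. cmod (f \<theta>))"

definition fourier_coeff :: "(real \<Rightarrow> complex) \<Rightarrow> int \<Rightarrow> complex" where
  "fourier_coeff f n =
     complex_of_real (1 / (2*pi)) * (LINT \<theta>:{0..2*pi}|lebesgue. f \<theta> * cis (- of_int n * \<theta>))"

definition riesz_disc :: "(real \<Rightarrow> complex) \<Rightarrow> complex \<Rightarrow> complex" where
  "riesz_disc f z = (\<Sum>n. fourier_coeff f (int n) * z ^ n)"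

definition radial_limit :: "(complex \<Rightarrow> complex) \<Rightarrow> real \<Rightarrow> complex" where
  "radial_limit F \<theta> = Lim (at_left 1) (\<lambda>r. F (complex_of_real r * cis \<theta>))"

definition riesz_boundary :: "(real \<Rightarrow> complex) \<Rightarrow> real \<Rightarrow> complex" where
  "riesz_boundary f = radial_limit (riesz_disc f)"

text \<open>exp of the normalised integral of log|f| over the circle, with the conventions
  exp(-\<infinity>) = 0 (e.g. when f vanishes on a set of positive measure) and exp(+\<infinity>) = \<infinity>.\<close>
definition log_pos_int :: "(real \<Rightarrow> complex) \<Rightarrow> ennreal" where
  "log_pos_int f = (\<integral>\<^sup>+ \<theta>. indicator {0..2*pi} \<theta> *
        ennreal (max 0 (ln (cmod (f \<theta>)))) \<partial>lebesgue)"

definition log_neg_int :: "(real \<Rightarrow> complex) \<Rightarrow> ennreal" where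
  "log_neg_int f = (\<integral>\<^sup>+ \<theta>. indicator {0..2*pi} \<theta> *
        (if f \<theta> = 0 then \<infinity> else ennreal (max 0 (- ln (cmod (f \<theta>))))) \<partial>lebesgue)"

definition circle_geom_mean :: "(real \<Rightarrow> complex) \<Rightarrow> ereal" where
  "circle_geom_mean f =
     (if log_pos_int f = \<infinity> then \<infinity>
      else if log_neg_int f = \<infinity> then 0
      else ereal (exp ((enn2real (log_pos_int f) - enn2real (log_neg_int f)) / (2*pi))))"

definition inner_fun :: "(complex \<Rightarrow> complex) \<Rightarrow> bool" where
  "inner_fun I \<longleftrightarrow> I holomorphic_on ball 0 1 \<and> (\<forall>z\<in>ball 0 1. cmod (I z) \<le> 1) \<and>
     (AE \<theta> in lebesgue. \<theta> \<in> {0..2*pi} \<longrightarrow>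
        (\<exists>u. cmod u = 1 \<and> ((\<lambda>r. I (complex_of_real r * cis \<theta>)) \<longlongrightarrow> u) (at_left 1)))"

text \<open>Outer functions: c * exp(Herglotz integral of an integrable real w = log k), |c| = 1.\<close>
definition outer_fun :: "(complex \<Rightarrow> complex) \<Rightarrow> bool" where
  "outer_fun \<Phi> \<longleftrightarrow> (\<exists>c w. cmod c = 1 \<and> set_integrable lebesgue {0..2*pi} (w :: real \<Rightarrow> real) \<and>
     (\<forall>z\<in>ball 0 1. \<Phi> z = c * exp (complex_of_real (1 / (2*pi)) *
        (LINT t:{0..2*pi}|lebesgue. (cis t + z) / (cis t - z) * complex_of_real (w t)))))"

end

theory Submission
  imports Defs "HOL-Complex_Analysis.Complex_Analysis"
begin

text \<open>
  Let \<open>f = I \<Phi>\<close> be the inner-outer factorisation of the Riesz projection. The geometric mean of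
  \<open>\<bar>f\<bar>\<close> is \<open>\<bar>\<Phi>(0)\<bar>\<close>, and everything follows from the identity that \<open>\<Phi>(0)\<close> is the mean of
  \<open>\<psi> cnj I\<close>. Formally \<open>\<psi> - f\<close> and hence \<open>(\<psi> - f) cnj I\<close> are anti-analytic without constant
  term, but \<open>f\<close> need not be integrable. Write \<open>f = \<Sum>j<4. i^j F\<^sub>j\<close> with \<open>F\<^sub>j\<close> the
  Cauchy integral of a nonnegative function, so that \<open>Re F\<^sub>j \<ge> 0\<close>, and test against \<open>I k\<close> with
  \<open>k = \<Prod>j<4. 1 / (1 + \<epsilon> F\<^sub>j)\<close>. Then \<open>f k\<close> and \<open>\<Phi> k\<close> are bounded, so the mean of
  \<open>\<psi> cnj (I k)\<close> is that of \<open>\<Phi> cnj k\<close>, while the mean of \<open>\<Phi> k\<close> is \<open>\<Phi>(0) k(0)\<close>. The two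
  differ by \<open>O(\<Sum>j<4. \<epsilon> \<integral>\<bar>F\<^sub>j\<bar>\<^sup>2 / \<bar>1 + \<epsilon> F\<^sub>j\<bar>\<^sup>2)\<close>, which tends to \<open>0\<close> with \<open>\<epsilon>\<close>.
\<close>

section \<open>The normalised circle and the Poisson formula\<close>

text \<open>The splitting into four parts is forced: a nonnegative density has a Cauchy integral in
  the right half-plane, where \<open>1 + \<epsilon> F\<close> stays away from 0, whereas
  \<open>1 + \<epsilon> f\<close> may vanish. Damping \<open>f\<close> therefore takes one factor
  for each part. The error term sits at a borderline. The usual weak-type bound O(1/\<lambda>) would
  only keep it bounded. It tends to 0 because the measure \<open>\<psi> dt\<close> has no singular
  part, which enters as \<open>Re (bdry F) = (m + u) / 2\<close> almost everywhere: the two terms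
  into which the error splits then have the same limit \<open>m\<close>. All radial limits come from
  one source, Fatou's theorem for bounded analytic functions. Functions with nonnegative real part
  are brought under it by \<open>exp (- herglotz u)\<close> or \<open>1 / (1 + F)\<close>. Once the
  mean identity is known, both claims are about a single function: \<open>\<psi> cnj I\<close> has
  modulus \<open>cmod \<psi>\<close>, and a function whose mean is real and equal to the mean of its
  modulus is nonnegative almost everywhere.\<close>

definition circ :: "real measure" where
  "circ = density (restrict_space lebesgue {0..2*pi}) (\<lambda>_. ennreal (1 / (2*pi)))"

lemma space_circ [simp]: "space circ = {0..2*pi}"
  by (simp add: circ_def space_restrict_space)

lemma sets_circ: "sets circ = sets (restrict_space lebesgue {0..2*pi})"
  by (simp add: circ_def)

lemma measurable_circ_iff: "f \<in> borel_measurable circ \<longleftrightarrow> f \<in> borel_measurable (restrict_space lebesgue {0..2*pi})"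
  by (simp add: circ_def)

lemma measurable_circ_continuous_on:
  fixes f :: "real \<Rightarrow> 'a::euclidean_space"
  shows "continuous_on {0..2*pi} f \<Longrightarrow> f \<in> borel_measurable circ"
  unfolding measurable_circ_iff by (rule continuous_imp_measurable_on_sets_lebesgue) auto

lemma measurable_circ_cis [measurable]: "cis \<in> borel_measurable circ"
  by (intro measurable_circ_continuous_on continuous_intros)

lemma measurable_circ_cnj_cis [measurable]: "(\<lambda>t. cnj (cis t)) \<in> borel_measurable circ"
  by (intro measurable_circ_continuous_on continuous_intros)

lemma AE_circ_iff: "(AE t in circ. P t) \<longleftrightarrow> (AE t in lebesgue. t \<in> {0..2*pi} \<longrightarrow> P t)"
  unfolding circ_def by (subst AE_density) (auto simp: AE_restrict_space_iff)

lemma integrable_circ_iff: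
  fixes f :: "real \<Rightarrow> 'a::{banach, second_countable_topology}"
  shows "integrable circ f \<longleftrightarrow> set_integrable lebesgue {0..2*pi} f"
proof -
  let ?R = "restrict_space lebesgue {0..2*pi}"
  have "integrable circ f \<longleftrightarrow> integrable ?R f"
  proof (cases "f \<in> borel_measurable ?R")
    case True
    then show ?thesis
      unfolding circ_def
      by (subst integrable_density)
(use integrable_scaleR_right[of "2*pi" ?R "\<lambda>x. (1/(2*pi)) *\<^sub>R f x"] in auto)
  next
    case False
    then show ?thesis by (auto simp: integrable_iff_bounded measurable_circ_iff)
  qed
  then show ?thesis
    by (simp add: set_integrable_def integrable_restrict_space)
qed

text \<open>Holds for every \<open>f\<close>: outside the integrable case both integrals take the
  default value 0.\<close>

lemma integral_circ:
  fixes f :: "real \<Rightarrow> 'a::{banach, second_countable_topology}"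
  shows "integral\<^sup>L circ f = (1 / (2*pi)) *\<^sub>R (LINT t:{0..2*pi}|lebesgue. f t)"
proof (cases "integrable circ f")
  case True
  then have "f \<in> borel_measurable (restrict_space lebesgue {0..2*pi})"
    by (auto simp: measurable_circ_iff[symmetric])
  then show ?thesis
    unfolding circ_def
    by (subst integral_density) (auto simp: integral_restrict_space set_lebesgue_integral_def)
next
  case False
  then have "\<not> set_integrable lebesgue {0..2*pi} f" by (simp add: integrable_circ_iff)
  then show ?thesis using False
    by (simp add: not_integrable_integral_eq set_lebesgue_integral_def set_integrable_def)
qed

lemma measure_circ_UNIV [simp]: "measure circ {0..2*pi} = 1" "emeasure circ {0..2*pi} = 1"
proof -
  have *: "emeasure circ {0..2*pi} = ennreal (1/(2*pi)) * emeasure (restrict_space lebesgue {0..2*pi}) {0..2*pi}"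
    unfolding circ_def
    by (subst emeasure_density) (auto simp: sets_restrict_space_iff nn_integral_cmult_indicator)
  also have "\<dots> = ennreal (1/(2*pi)) * ennreal (2*pi)"
    by (subst emeasure_restrict_space) auto
  also have "\<dots> = ennreal (1/(2*pi) * (2*pi))" by (rule ennreal_mult[symmetric]) auto
  also have "\<dots> = 1" by simp
  finally show "emeasure circ {0..2*pi} = 1" .
  then show "measure circ {0..2*pi} = 1" by (simp add: measure_def)
qed

interpretation circ: finite_measure circ
  by standard simp

lemma continuous_circ:
  fixes f :: "real \<Rightarrow> 'a::euclidean_space"
  assumes "continuous_on {0..2*pi} f"
  shows "integrable circ f" "integral\<^sup>L circ f = (1/(2*pi)) *\<^sub>R integral {0..2*pi} f"
proof -
  have *: "set_integrable lebesgue {0..2*pi} f"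
    using absolutely_integrable_continuous[of 0 "2*pi" f] assms by (simp add: cbox_interval)
  then show "integrable circ f" by (simp add: integrable_circ_iff)
  show "integral\<^sup>L circ f = (1/(2*pi)) *\<^sub>R integral {0..2*pi} f"
    using set_lebesgue_integral_eq_integral(2)[OF *] by (simp add: integral_circ)
qed

lemma integrable_circ_bounded:
  fixes f :: "real \<Rightarrow> 'a::{banach, second_countable_topology}"
  assumes "f \<in> borel_measurable circ" "AE t in circ. norm (f t) \<le> B"
  shows "integrable circ f"
  by (rule circ.integrable_const_bound[of _ B]) (use assms in auto)

lemma integrable_circ_mult_bounded:
  fixes f :: "real \<Rightarrow> 'a::{real_normed_field, banach, second_countable_topology}"
  assumes f: "integrable circ f" and "g \<in> borel_measurable circ" "AE t in circ. norm (g t) \<le> B"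
  shows "integrable circ (\<lambda>t. f t * g t)"
proof (rule Bochner_Integration.integrable_bound)
  show "integrable circ (\<lambda>t. B * norm (f t))" using f by auto
  show "(\<lambda>t. f t * g t) \<in> borel_measurable circ" using assms by auto
  show "AE t in circ. norm (f t * g t) \<le> norm (B * norm (f t))"
    using assms(3)
  proof eventually_elim
    case (elim t)
    have "norm (f t) * norm (g t) \<le> norm (f t) * B" using elim by (intro mult_left_mono) auto
    also have "\<dots> \<le> \<bar>B * norm (f t)\<bar>" by (simp add: mult.commute)
    finally show ?case by (simp add: norm_mult)
  qed
qed

text \<open>Dominated convergence and Fatou's lemma work along sequences, so the approach to the
  circle is along these radii. The double successor makes the first radius 1/2 instead of 0, so that
  one can divide by \<open>rseq n\<close>.\<close>

definition rseq :: "nat \<Rightarrow> real" where "rseq n = 1 - inverse (real (Suc (Suc n)))"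

lemma rseq: "0 < rseq n" "rseq n < 1" "rseq n \<le> 1" "0 \<le> rseq n"
proof -
  have "inverse (real (Suc (Suc n))) \<le> 1/2" "0 < inverse (real (Suc (Suc n)))"
    by (auto simp: field_simps)
  then show "0 < rseq n" "rseq n < 1" "rseq n \<le> 1" "0 \<le> rseq n" unfolding rseq_def by linarith+
qed

lemma rseq_LIMSEQ: "rseq \<longlonglongrightarrow> 1"
proof -
  have "(\<lambda>n. 1 - inverse (real (Suc (Suc n)))) \<longlonglongrightarrow> 1 - 0"
    by (intro tendsto_diff tendsto_const LIMSEQ_Suc[OF LIMSEQ_inverse_real_of_nat])
  then show ?thesis by (simp add: rseq_def[abs_def])
qed

lemma rseq_mono: "m \<le> n \<Longrightarrow> rseq m \<le> rseq n"
  by (auto simp: rseq_def intro!: le_imp_inverse_le)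

lemma rseq_at_left: "filterlim rseq (at_left 1) sequentially"
  by (rule tendsto_imp_filterlim_at_left) (use rseq_LIMSEQ rseq in auto)

lemma tendsto_rseq:
  assumes "(f \<longlongrightarrow> l) (at_left (1::real))"
  shows "(\<lambda>n. f (rseq n)) \<longlonglongrightarrow> l"
  using filterlim_compose[OF assms rseq_at_left] .

abbreviation polar :: "real \<Rightarrow> real \<Rightarrow> complex" where
  "polar r t \<equiv> complex_of_real r * cis t"

lemma tendsto_at_left_1_cong:
  assumes "(g \<longlongrightarrow> l) (at_left (1::real))" "\<And>r. 0 < r \<Longrightarrow> r < 1 \<Longrightarrow> g r = h r"
  shows "(h \<longlongrightarrow> l) (at_left 1)"
proof (rule Lim_transform_eventually[OF assms(1)])
  show "eventually (\<lambda>r. g r = h r) (at_left 1)"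
    unfolding eventually_at_left_field by (intro exI[of _ 0] conjI allI impI) (auto simp: assms(2))
qed

lemma mult_cis_in_ball: "0 \<le> r \<Longrightarrow> r < 1 \<Longrightarrow> polar r t \<in> ball 0 1"
  by (simp add: norm_mult)

section \<open>The Poisson kernel and dilations of analytic functions\<close>

definition poisson :: "complex \<Rightarrow> real \<Rightarrow> real" where
  "poisson z t = (1 - (cmod z)\<^sup>2) / (cmod (cis t - z))\<^sup>2"

text \<open>Cauchy's formula at \<open>z\<close> for \<open>q w * (1 - \<bar>z\<bar>\<^sup>2) / (1 - cnj z * w)\<close>, whose value at \<open>z\<close> is \<open>q z\<close>.\<close>

lemma poisson_formula:
  assumes "q holomorphic_on S" "open S" "cball 0 1 \<subseteq> S" "cmod z < 1"
  shows "q z = (LINT t|circ. of_real (poisson z t) * q (cis t))"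
proof -
  define g where "g = (\<lambda>w. q w * (1 - z * cnj z) / (1 - cnj z * w))"
  have nz: "1 - cnj z * w \<noteq> 0" if "cmod w \<le> 1" for w
  proof
    assume "1 - cnj z * w = 0"
    then have "cmod (cnj z * w) = 1" by simp
    moreover have "cmod (cnj z * w) \<le> cmod z * 1" unfolding norm_mult using that
      by (intro mult_mono) auto
    ultimately show False using assms by linarith
  qed
  have g: "g holomorphic_on cball 0 1" unfolding g_def
    by (intro holomorphic_intros holomorphic_on_subset[OF assms(1)]) (use nz assms in auto)
  have "((\<lambda>u. g u/(u - z)) has_contour_integral (2 * of_real pi * \<i> * g z)) (circlepath 0 1)"
    using assms g by (intro Cauchy_integral_circlepath_simple) auto
  then have "((\<lambda>t. g (cis t) / (cis t - z) * (\<i> * cis t)) has_integral (2 * of_real pi * \<i> * g z)) {0..2*pi}"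
    unfolding circlepath_def by (subst (asm) has_contour_integral_part_circlepath_iff) (auto simp: mult.assoc)
  then have I: "integral {0..2*pi} (\<lambda>t. g (cis t) / (cis t - z) * (\<i> * cis t)) = 2 * of_real pi * \<i> * g z"
    by (rule integral_unique)
  have gz: "g z = q z" using nz[of z] assms by (simp add: g_def mult.commute)
  \<comment> \<open>On the circle \<open>1 - cnj z * w\<close> equals
    \<open>w * cnj (w - z)\<close>. Together with the Cauchy denominator \<open>w - z\<close> this
    produces the squared modulus in the Poisson kernel.\<close>
  have eq: "g (cis t) / (cis t - z) * (\<i> * cis t) = \<i> * (of_real (poisson z t) * q (cis t))" for t
  proof -
    have nz2: "cis t - z \<noteq> 0" using assms(4) by (metis eq_iff_diff_eq_0 less_irrefl norm_cis)
    have a: "1 - cnj z * cis t = cis t * cnj (cis t - z)"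
      by (simp add: algebra_simps cis_cnj cis_mult)
    have c: "complex_of_real ((cmod (cis t - z))\<^sup>2) = (cis t - z) * cnj (cis t - z)"
      by (rule complex_norm_square)
    have d: "complex_of_real (1 - (cmod z)\<^sup>2) = 1 - z * cnj z"
      by (simp only: of_real_diff complex_norm_square of_real_1)
    have "cnj (cis t - z) \<noteq> 0" using nz2 by (metis complex_cnj_zero_iff)
    have "g (cis t) / (cis t - z) * (\<i> * cis t)
        = q (cis t) * (1 - z * cnj z) * \<i> * cis t / (cis t * ((cis t - z) * cnj (cis t - z)))"
      unfolding g_def a by (simp add: ac_simps)
    also have "\<dots> = \<i> * (((1 - z * cnj z) / ((cis t - z) * cnj (cis t - z))) * q (cis t))"
      by simp
    finally show ?thesis
      unfolding poisson_def of_real_divide c d .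
  qed
  have cont: "continuous_on {0..2*pi} (\<lambda>t. of_real (poisson z t) * q (cis t))"
  proof -
    have "continuous_on S q" using assms holomorphic_on_imp_continuous_on by blast
    then have "continuous_on {0..2*pi} (\<lambda>t. q (cis t))"
      by (rule continuous_on_compose2) (use assms in \<open>auto intro!: continuous_intros\<close>)
    moreover have "cis t \<noteq> z" for t using assms(4) by (metis less_irrefl norm_cis)
    ultimately show ?thesis unfolding poisson_def by (intro continuous_intros) auto
  qed
  have "2 * of_real pi * \<i> * q z = \<i> * integral {0..2*pi} (\<lambda>t. of_real (poisson z t) * q (cis t))"
    using I unfolding eq gz by (simp add: integral_mult_right)
  then have "q z = integral {0..2*pi} (\<lambda>t. of_real (poisson z t) * q (cis t)) / (2 * of_real pi)"
    by (simp add: field_simps)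
  then show ?thesis
    unfolding continuous_circ(2)[OF cont] scaleR_conv_of_real by simp
qed

lemma cis_neq_interior: "cmod z < 1 \<Longrightarrow> cis t \<noteq> z" "cmod z < 1 \<Longrightarrow> cis t - z \<noteq> 0"
  by (metis less_irrefl norm_cis, metis eq_iff_diff_eq_0 less_irrefl norm_cis)

lemma continuous_poisson [continuous_intros]: "cmod z < 1 \<Longrightarrow> continuous_on A (poisson z)"
  unfolding poisson_def[abs_def] using cis_neq_interior by (intro continuous_intros) auto

lemma measurable_poisson: "cmod z < 1 \<Longrightarrow> poisson z \<in> borel_measurable circ"
  by (rule measurable_circ_continuous_on[OF continuous_poisson])

text \<open>Harnack's bounds, from
  \<open>1 - cmod z \<le> cmod (cis t - z) \<le> 1 + cmod z\<close>. The lower bound later turns a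
  weighted integral at one point into an unweighted one.\<close>

lemma poisson_bounds:
  assumes "cmod z < 1"
  shows "0 < poisson z t" "(1 - cmod z) / (1 + cmod z) \<le> poisson z t"
    "poisson z t \<le> (1 + cmod z) / (1 - cmod z)"
proof -
  have 1: "1 - cmod z \<le> cmod (cis t - z)" using norm_triangle_ineq2[of "cis t" z] by simp
  have 2: "cmod (cis t - z) \<le> 1 + cmod z" using norm_triangle_ineq4[of "cis t" z] by simp
  have e: "1 - (cmod z)\<^sup>2 = (1 - cmod z) * (1 + cmod z)" by (simp add: power2_eq_square algebra_simps)
  have p: "0 < 1 - (cmod z)\<^sup>2" unfolding e using assms by (auto intro!: mult_pos_pos add_pos_nonneg)
  have q: "0 < (cmod (cis t - z))\<^sup>2" using 1 assms by (intro zero_less_power) linarith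
  show "0 < poisson z t" unfolding poisson_def using p q by simp
  have "(1 - (cmod z)\<^sup>2) / (1 + cmod z)\<^sup>2 \<le> poisson z t"
    unfolding poisson_def using p q 2 by (intro divide_left_mono power_mono mult_pos_pos) auto
  moreover have "(1 - (cmod z)\<^sup>2) / (1 + cmod z)\<^sup>2 = (1 - cmod z) / (1 + cmod z)"
  proof -
    have "1 + cmod z \<noteq> 0" by (smt (verit) norm_ge_zero)
    then show ?thesis unfolding e unfolding power2_eq_square by simp
  qed
  ultimately show "(1 - cmod z) / (1 + cmod z) \<le> poisson z t" by simp
  have "poisson z t \<le> (1 - (cmod z)\<^sup>2) / (1 - cmod z)\<^sup>2"
    unfolding poisson_def using p q 1 assms by (intro divide_left_mono power_mono mult_pos_pos) auto
  also have "\<dots> = (1 + cmod z) / (1 - cmod z)"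
    unfolding e unfolding power2_eq_square using assms by simp
  finally show "poisson z t \<le> (1 + cmod z) / (1 - cmod z)" .
qed

lemma poisson_0 [simp]: "poisson 0 t = 1" by (simp add: poisson_def)

lemma integrable_poisson_mult:
  assumes "integrable circ u" "cmod z < 1"
  shows "integrable circ (\<lambda>t. poisson z t * u t)"
  using integrable_circ_mult_bounded[OF assms(1) measurable_poisson[OF assms(2)], of "(1 + cmod z) / (1 - cmod z)"]
    poisson_bounds[OF assms(2)] by (auto simp: mult.commute abs_of_pos)

abbreviation poisson_int :: "(real \<Rightarrow> real) \<Rightarrow> complex \<Rightarrow> real" where
  "poisson_int u z \<equiv> (LINT t|circ. poisson z t * u t)"

lemma integral_poisson: "cmod z < 1 \<Longrightarrow> (LINT t|circ. poisson z t) = 1"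
proof -
  assume z: "cmod z < 1"
  have "(1::complex) = (LINT t|circ. complex_of_real (poisson z t) * 1)"
    by (rule poisson_formula[of "\<lambda>_. 1" UNIV z]) (use z in auto)
  then have "complex_of_real (LINT t|circ. poisson z t) = 1" by simp
  then show ?thesis by (simp only: of_real_eq_1_iff)
qed

text \<open>A function on the open disc need not extend to the circle, but its dilate lives on the
  disc of radius \<open>1 / r > 1\<close>, where Cauchy's formula applies. The radius 0 is separate
  because \<open>1 / 0 = 0\<close>.\<close>

lemma holomorphic_dilate:
  assumes "b holomorphic_on ball 0 1" "0 \<le> r" "r < 1"
  obtains S where "(\<lambda>z. b (complex_of_real r * z)) holomorphic_on S" "open S" "cball 0 1 \<subseteq> S"
proof (cases "r = 0")
  case True
  then show ?thesis using that[of UNIV] by auto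
next
  case False
  have sub: "(*) (complex_of_real r) ` ball 0 (1/r) \<subseteq> ball 0 1"
    using assms False by (auto simp: norm_mult field_simps)
  have "(b \<circ> (\<lambda>z. of_real r * z)) holomorphic_on ball 0 (1/r)"
    using sub by (intro holomorphic_on_compose_gen[OF _ assms(1)] holomorphic_intros) auto
  moreover have "cball 0 1 \<subseteq> ball (0::complex) (1/r)" using assms False
    by (subst cball_subset_ball_iff) auto
  ultimately show ?thesis using that[of "ball 0 (1/r)"] by (auto simp: o_def)
qed

lemma poisson_formula_dilate:
  assumes "b holomorphic_on ball 0 1" "0 \<le> r" "r < 1" "cmod z < 1"
  shows "b (of_real r * z) = (LINT t|circ. complex_of_real (poisson z t) * b (polar r t))"
proof -
  obtain S where S: "(\<lambda>z. b (complex_of_real r * z)) holomorphic_on S" "open S" "cball 0 1 \<subseteq> S"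
    using holomorphic_dilate[OF assms(1-3)] .
  show ?thesis using poisson_formula[OF S assms(4)] .
qed

lemma mean_value_dilate:
  assumes "b holomorphic_on ball 0 1" "0 \<le> r" "r < 1"
  shows "b 0 = (LINT t|circ. b (polar r t))"
  using poisson_formula_dilate[OF assms, of 0] by simp

lemma continuous_on_dilate:
  assumes "b holomorphic_on ball 0 1" "0 \<le> r" "r < 1"
  shows "continuous_on A (\<lambda>t. b (polar r t))"
proof -
  have "continuous_on (ball 0 1) b" using assms holomorphic_on_imp_continuous_on by blast
  then show ?thesis
    by (rule continuous_on_compose2) (use assms in \<open>auto intro!: continuous_intros simp: norm_mult\<close>)
qed

section \<open>Fourier coefficients and Cauchy integrals\<close>

text \<open>The series is dominated by \<open>cmod (x t)\<close> times the sum of the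
  \<open>cmod (c n)\<close>. The uses take for \<open>u\<close> either \<open>cis\<close> or its
  conjugate.\<close>

lemma termwise_integral:
  fixes x u :: "real \<Rightarrow> complex"
  assumes x: "integrable circ x" and u [measurable]: "u \<in> borel_measurable circ"
    and 1: "\<And>t. cmod (u t) = 1" and c: "summable (\<lambda>n. cmod (c n))"
  shows "(\<lambda>n. c n * (LINT t|circ. x t * u t ^ n)) sums (LINT t|circ. x t * (\<Sum>n. c n * u t ^ n))"
proof -
  let ?f = "\<lambda>n t. x t * (c n * u t ^ n)"
  have n: "cmod (?f n t) = cmod (x t) * cmod (c n)" for n t
    by (simp add: norm_mult norm_power 1)
  have i: "integrable circ (?f n)" for n
    by (rule integrable_circ_mult_bounded[OF x, of _ "cmod (c n)"]) (auto simp: norm_mult norm_power 1)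
  have "(\<lambda>n. integral\<^sup>L circ (?f n)) sums (LINT t|circ. (\<Sum>n. ?f n t))"
  proof (rule sums_integral[OF i])
    show "AE t in circ. summable (\<lambda>i. norm (?f i t))"
      unfolding n by (intro AE_I2 summable_mult c)
    show "summable (\<lambda>i. LINT t|circ. norm (?f i t))"
      unfolding n using c by (simp add: summable_mult)
  qed
  moreover have "integral\<^sup>L circ (?f n) = c n * (LINT t|circ. x t * u t ^ n)" for n
    by (subst integral_mult_right_zero[symmetric]) (simp add: ac_simps)
  moreover have "(\<Sum>n. ?f n t) = x t * (\<Sum>n. c n * u t ^ n)" for t
    by (rule suminf_mult, rule summable_norm_cancel) (simp add: norm_mult norm_power 1 c)
  ultimately show ?thesis by simp
qed

text \<open>Cancelling common factors leaves a pure power or its conjugate, and the mean of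
  \<open>w ^ k\<close> is its value at the origin.\<close>

lemma integral_cis_power:
  "(LINT t|circ. cis t ^ n * cnj (cis t) ^ m) = (if n = m then 1 else 0)"
proof -
  have c1: "cis t * cnj (cis t) = 1" for t by (simp add: cis_cnj cis_mult)
  have z: "(LINT t|circ. cis t ^ k) = (if k = 0 then 1 else 0)" for k
  proof -
    have "(0::complex) ^ k = (LINT t|circ. complex_of_real (poisson 0 t) * cis t ^ k)"
      by (rule poisson_formula[of _ UNIV]) (auto intro!: holomorphic_intros)
    then show ?thesis by (cases k) auto
  qed
  consider d where "n = m + d" | d where "m = n + d" using le_Suc_ex nle_le by metis
  then show ?thesis
  proof cases
    case 1
    have "cis t ^ n * cnj (cis t) ^ m = cis t ^ d * (cis t * cnj (cis t)) ^ m" for t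
      unfolding 1 by (simp add: power_add power_mult_distrib ac_simps)
    then show ?thesis using z[of d] unfolding c1 by (simp add: 1)
  next
    case 2
    have "cis t ^ n * cnj (cis t) ^ m = cnj (cis t ^ d) * (cis t * cnj (cis t)) ^ n" for t
      unfolding 2 by (simp add: power_add power_mult_distrib ac_simps)
    then have "(LINT t|circ. cis t ^ n * cnj (cis t) ^ m) = cnj (LINT t|circ. cis t ^ d)"
      unfolding c1 by (simp del: complex_cnj_power)
    then show ?thesis using z[of d] by (simp add: 2)
  qed
qed

definition has_coeffs :: "(complex \<Rightarrow> complex) \<Rightarrow> (nat \<Rightarrow> complex) \<Rightarrow> bool" where
  "has_coeffs f a \<longleftrightarrow> (\<forall>z. cmod z < 1 \<longrightarrow> (\<lambda>n. a n * z ^ n) sums f z)"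

lemma has_coeffs_ex:
  assumes "f holomorphic_on ball 0 1"
  obtains a where "has_coeffs f a"
  using holomorphic_power_series[OF assms] that[of "\<lambda>n. (deriv ^^ n) f 0 / fact n"]
  by (auto simp: has_coeffs_def)

lemma has_coeffs_holomorphic: "has_coeffs f a \<Longrightarrow> f holomorphic_on ball 0 1"
  by (rule power_series_holomorphic[of _ _ a]) (auto simp: has_coeffs_def)

lemma has_coeffs_summable:
  assumes "has_coeffs f a" "0 \<le> r" "r < 1"
  shows "summable (\<lambda>n. cmod (a n * complex_of_real r ^ n))"
proof -
  obtain s where s: "r < s" "s < 1" using dense assms by blast
  have "cmod (of_real s) < 1" using assms s by simp
  then have "(\<lambda>n. a n * complex_of_real s ^ n) sums f (of_real s)"
    using assms(1) unfolding has_coeffs_def by (elim allE impE)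
  then have "summable (\<lambda>n. a n * complex_of_real s ^ n)" by (rule sums_summable)
  then show ?thesis by (rule powser_insidea) (use assms s in auto)
qed

lemma has_coeffs_eq:
  assumes "has_coeffs f a" "0 \<le> r" "r < 1"
  shows "f (polar r t) = (\<Sum>n. (a n * of_real r ^ n) * cis t ^ n)"
proof (rule sums_unique)
  have "cmod (polar r t) < 1" using assms by (simp add: norm_mult)
  then have "(\<lambda>n. a n * (polar r t) ^ n) sums f (polar r t)"
    using assms(1) by (auto simp: has_coeffs_def)
  then show "(\<lambda>n. (a n * of_real r ^ n) * cis t ^ n) sums f (polar r t)"
    by (simp add: power_mult_distrib mult.assoc)
qed

lemma coeff_integral:
  assumes f: "has_coeffs f a" and r: "0 \<le> r" "r < 1"
  shows "(LINT t|circ. cnj (cis t) ^ n * f (polar r t)) = a n * of_real r ^ n"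
proof -
  have "(\<lambda>k. (a k * of_real r ^ k) * (LINT t|circ. cnj (cis t) ^ n * cis t ^ k)) sums
     (LINT t|circ. cnj (cis t) ^ n * (\<Sum>k. (a k * of_real r ^ k) * cis t ^ k))"
    by (rule termwise_integral[OF _ _ _ has_coeffs_summable[OF f r]])
      (auto intro!: integrable_circ_bounded[of _ 1] simp: norm_power)
  moreover have "(a k * of_real r ^ k) * (LINT t|circ. cnj (cis t) ^ n * cis t ^ k) = (if k = n then a n * of_real r ^ n else 0)" for k
    using integral_cis_power[of k n] by (auto simp: mult.commute)
  ultimately have "(\<lambda>k. if k = n then a n * of_real r ^ n else 0) sums (LINT t|circ. cnj (cis t) ^ n * f (polar r t))"
    unfolding has_coeffs_eq[OF f r] by (simp only:)
  then show ?thesis by (rule sums_unique2) (rule sums_single[of n "\<lambda>k. a n * of_real r ^ n"])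
qed

lemma integrable_dilate:
  assumes "f holomorphic_on ball 0 1" "0 \<le> r" "r < 1"
  shows "integrable circ (\<lambda>t. f (polar r t))"
  using continuous_circ(1)[OF continuous_on_dilate[OF assms]] .

lemma measurable_dilate:
  assumes "f holomorphic_on ball 0 1" "0 \<le> r" "r < 1"
  shows "(\<lambda>t. f (polar r t)) \<in> borel_measurable circ"
  using integrable_dilate[OF assms] by auto

text \<open>Parseval's identity in polarised form. Each function contributes a factor
  \<open>r ^ n\<close> to the coefficient of index \<open>n\<close>, hence
  \<open>r\<^sup>2\<close>.\<close>

lemma pairing_integral:
  assumes f: "has_coeffs f a" and h: "has_coeffs h b" and r: "0 \<le> r" "r < 1"
  shows "(\<lambda>n. a n * cnj (b n) * of_real (r\<^sup>2) ^ n) sums (LINT t|circ. f (polar r t) * cnj (h (polar r t)))"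
proof -
  have i: "integrable circ (\<lambda>t. cnj (h (polar r t)))"
    using integrable_dilate[OF has_coeffs_holomorphic[OF h] r] by (simp only: complex_integrable_cnj)
  have S: "(\<lambda>k. (a k * of_real r ^ k) * (LINT t|circ. cnj (h (polar r t)) * cis t ^ k)) sums
     (LINT t|circ. cnj (h (polar r t)) * (\<Sum>k. (a k * of_real r ^ k) * cis t ^ k))"
    by (rule termwise_integral[OF i measurable_circ_cis norm_cis has_coeffs_summable[OF f r]])
  have c: "(LINT t|circ. cnj (h (polar r t)) * cis t ^ k) = cnj (b k * of_real r ^ k)" for k
  proof -
    have "(LINT t|circ. cnj (h (polar r t)) * cis t ^ k) = (LINT t|circ. cnj (cnj (cis t) ^ k * h (polar r t)))"
      by (rule arg_cong[where f = "integral\<^sup>L circ"]) (simp add: fun_eq_iff mult.commute)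
    also have "\<dots> = cnj (b k * of_real r ^ k)"
      unfolding coeff_integral[OF h r, symmetric] by (rule Bochner_Integration.integral_cnj)
    finally show ?thesis .
  qed
  have e: "(a k * of_real r ^ k) * cnj (b k * of_real r ^ k) = a k * cnj (b k) * of_real (r\<^sup>2) ^ k" for k
    by (simp add: power2_eq_square power_mult_distrib)
  have e': "cnj (h (polar r t)) * (\<Sum>k. (a k * of_real r ^ k) * cis t ^ k) = f (polar r t) * cnj (h (polar r t))" for t
    unfolding has_coeffs_eq[OF f r, of t] by (rule mult.commute)
  show ?thesis using S unfolding c e e' .
qed

definition coeff_nat :: "(real \<Rightarrow> complex) \<Rightarrow> nat \<Rightarrow> complex" where
  "coeff_nat x n = fourier_coeff x (int n)"

lemma coeff_nat_eq: "coeff_nat x n = (LINT t|circ. x t * cnj (cis t) ^ n)"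
proof -
  have "cis (- (real n * t)) = cnj (cis t) ^ n" for t
    by (simp add: cis_cnj Complex.DeMoivre)
  then show ?thesis by (simp add: coeff_nat_def fourier_coeff_def integral_circ scaleR_conv_of_real)
qed

lemma coeff_nat_bound: "integrable circ x \<Longrightarrow> cmod (coeff_nat x n) \<le> (LINT t|circ. cmod (x t))"
  unfolding coeff_nat_eq using integral_norm_bound[of circ "\<lambda>t. x t * cnj (cis t) ^ n"]
  by (simp add: norm_mult norm_power)

lemma riesz_disc_coeffs:
  assumes "integrable circ x"
  shows "has_coeffs (riesz_disc x) (coeff_nat x)"
  unfolding has_coeffs_def
proof safe
  fix z :: complex assume z: "cmod z < 1"
  have "summable (\<lambda>n. coeff_nat x n * z ^ n)"
  proof (rule summable_norm_cancel, rule summable_comparison_test)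
    show "summable (\<lambda>n. (LINT t|circ. cmod (x t)) * cmod z ^ n)"
      using z by (intro summable_mult summable_geometric) auto
    show "\<exists>N. \<forall>n\<ge>N. norm (norm (coeff_nat x n * z ^ n)) \<le> (LINT t|circ. cmod (x t)) * cmod z ^ n"
      by (auto simp: norm_mult norm_power intro!: mult_right_mono coeff_nat_bound assms)
  qed
  then show "(\<lambda>n. coeff_nat x n * z ^ n) sums riesz_disc x z"
    unfolding riesz_disc_def coeff_nat_def[symmetric] by (rule summable_sums)
qed

lemmas riesz_disc_holomorphic = has_coeffs_holomorphic[OF riesz_disc_coeffs]

text \<open>Exchanging sum and integral leaves a geometric series under the integral, so the Riesz
  projection is a Cauchy integral.\<close>

lemma riesz_disc_eq:
  assumes x: "integrable circ x" and z: "cmod z < 1"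
  shows "riesz_disc x z = (LINT t|circ. x t / (1 - z * cnj (cis t)))"
proof -
  have "(\<lambda>n. z ^ n * (LINT t|circ. x t * cnj (cis t) ^ n)) sums (LINT t|circ. x t * (\<Sum>n. z ^ n * cnj (cis t) ^ n))"
    by (rule termwise_integral[OF x]) (use z in \<open>auto simp: norm_power intro!: summable_geometric\<close>)
  moreover have "(\<Sum>n. z ^ n * cnj (cis t) ^ n) = 1 / (1 - z * cnj (cis t))" for t
    unfolding power_mult_distrib[symmetric] using z by (intro suminf_geometric) (auto simp: norm_mult)
  ultimately have "(\<lambda>n. coeff_nat x n * z ^ n) sums (LINT t|circ. x t / (1 - z * cnj (cis t)))"
    unfolding coeff_nat_eq by (simp add: mult.commute)
  then show ?thesis
    using riesz_disc_coeffs[OF x] z unfolding has_coeffs_def by (elim allE[of _ z]) (auto intro: sums_unique2)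
qed

text \<open>An analytic \<open>h\<close> sees only the Fourier coefficients of nonnegative index,
  and there \<open>x\<close> and its projection agree. The dilation by \<open>r\<^sup>2\<close> on
  the left is shared out on the right as one factor \<open>r\<close> for each function, so that both
  are evaluated inside the disc.\<close>

lemma riesz_pairing:
  assumes x: "integrable circ x" and h: "h holomorphic_on ball 0 1" and r: "0 \<le> r" "r < 1"
  shows "(LINT t|circ. x t * cnj (h (polar (r\<^sup>2) t))) =
     (LINT t|circ. riesz_disc x (polar r t) * cnj (h (polar r t)))"
proof -
  obtain b where b: "has_coeffs h b" using has_coeffs_ex[OF h] .
  have r2: "0 \<le> r\<^sup>2" "r\<^sup>2 < 1" using r by (auto simp: abs_square_less_1)
  have "(\<lambda>n. cnj (b n * of_real (r\<^sup>2) ^ n) * (LINT t|circ. x t * cnj (cis t) ^ n)) sums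
      (LINT t|circ. x t * (\<Sum>n. cnj (b n * of_real (r\<^sup>2) ^ n) * cnj (cis t) ^ n))"
    by (rule termwise_integral[OF x]) (use has_coeffs_summable[OF b r2] in \<open>auto simp: norm_mult norm_power\<close>)
  moreover have "(\<Sum>n. cnj (b n * of_real (r\<^sup>2) ^ n) * cnj (cis t) ^ n) = cnj (h (polar (r\<^sup>2) t))" for t
  proof -
    have "cmod (polar (r\<^sup>2) t) < 1" using r2 by (simp add: norm_mult del: of_real_power)
    then have "(\<lambda>n. b n * (polar (r\<^sup>2) t) ^ n) sums h (polar (r\<^sup>2) t)"
      using b unfolding has_coeffs_def by blast
    then have "(\<lambda>n. (b n * of_real (r\<^sup>2) ^ n) * cis t ^ n) sums h (polar (r\<^sup>2) t)"
      by (simp add: power_mult_distrib mult.assoc)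
    then have "(\<lambda>n. cnj ((b n * of_real (r\<^sup>2) ^ n) * cis t ^ n)) sums cnj (h (polar (r\<^sup>2) t))"
      by (simp only: sums_cnj)
    then show ?thesis by (simp add: sums_iff)
  qed
  ultimately have "(\<lambda>n. coeff_nat x n * cnj (b n) * of_real (r\<^sup>2) ^ n) sums (LINT t|circ. x t * cnj (h (polar (r\<^sup>2) t)))"
    by (simp add: coeff_nat_eq ac_simps)
  then show ?thesis
    using pairing_integral[OF riesz_disc_coeffs[OF x] b r] by (rule sums_unique2)
qed

lemma norm_one_minus_pos: "cmod z < 1 \<Longrightarrow> 1 - z * cnj (cis t) \<noteq> 0"
proof
  assume "cmod z < 1" "1 - z * cnj (cis t) = 0"
  then have "cmod (z * cnj (cis t)) = 1" by simp
  then show False using \<open>cmod z < 1\<close> by (simp add: norm_mult)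
qed

text \<open>With \<open>C\<close> for the Cauchy kernel, the Herglotz kernel is
  \<open>2 C - 1\<close> and its real part is the Poisson kernel. The first half makes Cauchy
  integrals of nonnegative functions have nonnegative real part; the second links them to
  \<open>outer_fun\<close>.\<close>

lemma cauchy_kernel:
  assumes "cmod z < 1"
  shows "Re (1 / (1 - z * cnj (cis t))) = (1 + poisson z t) / 2"
    and "(cis t + z) / (cis t - z) = 2 / (1 - z * cnj (cis t)) - 1"
proof -
  have a: "1 - z * cnj (cis t) = cnj (cis t) * (cis t - z)"
    by (simp add: algebra_simps cis_cnj cis_mult)
  have n: "cmod (1 - z * cnj (cis t)) = cmod (cis t - z)" unfolding a by (simp add: norm_mult)
  have nz: "1 - z * cnj (cis t) \<noteq> 0" using norm_one_minus_pos[OF assms] .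
  have c: "cis t * (1 - z * cnj (cis t)) = cis t - z" unfolding a
    by (simp add: cis_cnj cis_mult mult.assoc[symmetric])
  have "(cis t + z) / (cis t - z) = (cis t * (1 + z * cnj (cis t))) / (cis t * (1 - z * cnj (cis t)))"
    unfolding c by (simp add: algebra_simps cis_cnj cis_mult)
  also have "\<dots> = (1 + z * cnj (cis t)) / (1 - z * cnj (cis t))" by simp
  also have "\<dots> = 2 / (1 - z * cnj (cis t)) - 1" using nz by (simp add: field_simps)
  finally show "(cis t + z) / (cis t - z) = 2 / (1 - z * cnj (cis t)) - 1" .
  let ?w = "z * cnj (cis t)"
  have w: "(cmod ?w)\<^sup>2 = (cmod z)\<^sup>2" by (simp add: norm_mult)
  have q: "Re (1 - v) = ((cmod (1 - v))\<^sup>2 + (1 - (cmod v)\<^sup>2)) / 2" for v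
    unfolding cmod_power2 by (simp add: power2_eq_square algebra_simps)
  have "Re (1 / (1 - ?w)) = Re (1 - ?w) / (cmod (1 - ?w))\<^sup>2"
    unfolding Re_divide cmod_power2 by simp
  also have "\<dots> = ((cmod (1 - ?w))\<^sup>2 + (1 - (cmod ?w)\<^sup>2)) / 2 / (cmod (1 - ?w))\<^sup>2"
    unfolding q ..
  also have "\<dots> = (1 + poisson z t) / 2"
    unfolding poisson_def w n using cis_neq_interior[OF assms] by (simp add: field_simps)
  finally show "Re (1 / (1 - ?w)) = (1 + poisson z t) / 2" .
qed

lemma measurable_cauchy_kernel:
  assumes "cmod z < 1"
  shows "(\<lambda>t. 1 / (1 - z * cnj (cis t))) \<in> borel_measurable circ"
  by measurable

lemma integrable_cauchy_kernel:
  assumes x: "integrable circ x" and z: "cmod z < 1"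
  shows "integrable circ (\<lambda>t. x t / (1 - z * cnj (cis t)))"
proof -
  have "cmod (1 / (1 - z * cnj (cis t))) \<le> 1 / (1 - cmod z)" for t
  proof -
    have "1 - cmod z \<le> cmod (1 - z * cnj (cis t))"
      using norm_triangle_ineq2[of 1 "z * cnj (cis t)"] by (simp add: norm_mult)
    then show ?thesis using z by (simp add: norm_divide divide_left_mono frac_le)
  qed
  then have "integrable circ (\<lambda>t. x t * (1 / (1 - z * cnj (cis t))))"
    by (intro integrable_circ_mult_bounded[OF x measurable_cauchy_kernel[OF z]]) auto
  then show ?thesis by simp
qed

lemma Re_riesz_disc:
  fixes u :: "real \<Rightarrow> real"
  assumes u: "integrable circ u" and z: "cmod z < 1"
  shows "Re (riesz_disc (\<lambda>t. complex_of_real (u t)) z) = ((LINT t|circ. u t) + poisson_int u z) / 2"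
proof -
  have i: "integrable circ (\<lambda>t. complex_of_real (u t))" using u by simp
  have e: "Re (complex_of_real (u t) / (1 - z * cnj (cis t))) = (u t + poisson z t * u t) / 2" for t
  proof -
    have "Re (complex_of_real (u t) / w) = u t * Re (1 / w)" for w by (simp add: Re_divide)
    from this[of "1 - z * cnj (cis t)"] show ?thesis
      unfolding cauchy_kernel(1)[OF z, of t] by (simp add: algebra_simps)
  qed
  have "Re (riesz_disc (\<lambda>t. complex_of_real (u t)) z) = (LINT t|circ. Re (complex_of_real (u t) / (1 - z * cnj (cis t))))"
    unfolding riesz_disc_eq[OF i z] using integrable_cauchy_kernel[OF i z] by simp
  also have "\<dots> = ((LINT t|circ. u t) + poisson_int u z) / 2"
    unfolding e using u integrable_poisson_mult[OF u z] by simp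
  finally show ?thesis .
qed

section \<open>A maximal inequality for Poisson integrals\<close>

lemma integral_periodic_shift_aux:
  fixes g :: "real \<Rightarrow> real"
  assumes c: "continuous_on UNIV g" and p: "\<And>t. g (t + 2*pi) = g t" and a: "-(2*pi) \<le> a" "a \<le> 0"
  shows "integral {a..a+2*pi} g = integral {0..2*pi} g"
proof -
  have i: "g integrable_on {x..y}" for x y
    by (intro integrable_continuous_interval continuous_on_subset[OF c]) auto
  have "integral {a..a+2*pi} g = integral {a..0} g + integral {0..a+2*pi} g"
    using Henstock_Kurzweil_Integration.integral_combine[of a 0 "a+2*pi" g] a i by simp
  also have "integral {a..0} g = integral {a..0} (g \<circ> (\<lambda>x. x + 2*pi))"
    by (simp add: o_def p)
  also have "\<dots> = integral {a+2*pi..0+2*pi} g"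
    by (rule Henstock_Kurzweil_Integration.integral_shift) (rule continuous_on_subset[OF c], simp)
  also have "\<dots> + integral {0..a+2*pi} g = integral {0..2*pi} g"
    using Henstock_Kurzweil_Integration.integral_combine[of 0 "a+2*pi" "2*pi" g] a i by simp
  finally show ?thesis .
qed

lemma integral_periodic_shift:
  fixes g :: "real \<Rightarrow> real"
  assumes c: "continuous_on UNIV g" and p: "\<And>t. g (t + 2*pi) = g t" and a: "-(2*pi) \<le> a" "a \<le> 2*pi"
  shows "integral {a..a+2*pi} g = integral {0..2*pi} g"
proof (cases "a \<le> 0")
  case True
  then show ?thesis using integral_periodic_shift_aux[OF c p a(1)] by simp
next
  case False
  have "integral {a..a+2*pi} g = integral {a - 2*pi..a} (g \<circ> (\<lambda>x. x + 2*pi))"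
    by (subst Henstock_Kurzweil_Integration.integral_shift) (auto intro: continuous_on_subset[OF c])
  also have "\<dots> = integral {a - 2*pi..(a - 2*pi) + 2*pi} g" by (simp add: o_def p)
  also have "\<dots> = integral {0..2*pi} g"
    by (rule integral_periodic_shift_aux[OF c p]) (use False a in auto)
  finally show ?thesis .
qed

lemma integral_symmetric_interval:
  fixes g :: "real \<Rightarrow> real"
  assumes c: "continuous_on UNIV g" and t: "0 \<le> t"
  shows "integral {\<theta> - t..\<theta> + t} g = integral {0..t} (\<lambda>s. g (\<theta> + s) + g (\<theta> - s))"
proof -
  have cg: "continuous_on A (\<lambda>x. g (f x))" if "continuous_on A f" for A :: "real set" and f
    by (rule continuous_on_compose2[OF c that]) auto
  have ig: "g integrable_on {x..y}" for x y
    by (intro integrable_continuous_interval continuous_on_subset[OF c]) auto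
  have "integral {\<theta> - t..\<theta> + t} g = integral {\<theta> - t..\<theta>} g + integral {\<theta>..\<theta> + t} g"
    using Henstock_Kurzweil_Integration.integral_combine[of "\<theta> - t" \<theta> "\<theta>+t" g] ig t by simp
  also have "integral {\<theta>..\<theta>+t} g = integral {0..t} (g \<circ> (\<lambda>x. x + \<theta>))"
    by (subst Henstock_Kurzweil_Integration.integral_shift) (auto intro: continuous_on_subset[OF c] simp: add.commute)
  also have "integral {\<theta> - t..\<theta>} g = integral {-t..-0} (g \<circ> (\<lambda>x. x + \<theta>))"
    by (subst Henstock_Kurzweil_Integration.integral_shift) (auto intro: continuous_on_subset[OF c] simp: add.commute)
  also have "\<dots> = integral {0..t} (\<lambda>s. g (\<theta> - s))"
    using Henstock_Kurzweil_Integration.integral_reflect_real[of t 0 "\<lambda>s. g (\<theta> - s)"] by (simp add: o_def add.commute)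
  also have "\<dots> + integral {0..t} (g \<circ> (\<lambda>x. x + \<theta>)) = integral {0..t} (\<lambda>s. g (\<theta> - s) + g (s + \<theta>))"
    unfolding o_def by (intro integral_add[symmetric] integrable_continuous_interval cg continuous_intros)
  finally show ?thesis by (simp add: add.commute)
qed

text \<open>The Poisson kernel in terms of the radius and the difference of angles. In this form it
  can be differentiated in the angle, which is how its monotonicity on \<open>{0..pi}\<close> is
  exploited.\<close>

definition pkernel :: "real \<Rightarrow> real \<Rightarrow> real" where
  "pkernel r s = (1 - r\<^sup>2) / (1 - 2 * r * cos s + r\<^sup>2)"

lemma poisson_eq_kernel: "poisson (polar r \<theta>) t = pkernel r (t - \<theta>)"
proof -
  have "(cmod (cis t - polar r \<theta>))\<^sup>2 = 1 - 2 * r * (cos t * cos \<theta> + sin t * sin \<theta>) + r\<^sup>2"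
    unfolding cmod_power2 by (simp add: algebra_simps power2_diff power_mult_distrib sin_squared_eq)
  also have "\<dots> = 1 - 2 * r * cos (t - \<theta>) + r\<^sup>2" by (simp only: cos_diff)
  finally have "(cmod (cis t - polar r \<theta>))\<^sup>2 = 1 - 2 * r * cos (t - \<theta>) + r\<^sup>2" .
  then show ?thesis by (simp add: poisson_def pkernel_def norm_mult)
qed

lemma pkernel_denom_pos: "0 \<le> r \<Longrightarrow> r < 1 \<Longrightarrow> 0 < 1 - 2 * r * cos s + r\<^sup>2" for r s :: real
proof -
  assume r: "0 \<le> r" "r < 1"
  have "r * cos s \<le> r * 1" using r by (intro mult_left_mono) auto
  moreover have "0 < (1 - r)\<^sup>2" using r by auto
  ultimately show ?thesis unfolding power2_eq_square by argo
qed

lemma pkernel_pos: "0 \<le> r \<Longrightarrow> r < 1 \<Longrightarrow> 0 < pkernel r s"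
  unfolding pkernel_def using pkernel_denom_pos[of r s] by (auto simp: abs_square_less_1 intro!: divide_pos_pos)

lemma continuous_pkernel:
  fixes A :: "real set" assumes "0 \<le> r" "r < 1" "continuous_on A f" shows "continuous_on A (\<lambda>x. pkernel r (f x))"
proof -
  have "1 - 2 * r * cos (f s) + r\<^sup>2 \<noteq> 0" for s using pkernel_denom_pos[OF assms(1,2), of "f s"] by linarith
  then show ?thesis unfolding pkernel_def by (intro continuous_intros assms) auto
qed

text \<open>By periodicity the window of integration can be centred at \<open>\<theta>\<close>; the
  kernel is even there, so the two halves fold together.\<close>

lemma poisson_symmetric:
  fixes g :: "real \<Rightarrow> real"
  assumes c: "continuous_on UNIV g" and p: "\<And>t. g (t + 2*pi) = g t" and r: "0 \<le> r" "r < 1" and \<theta>: "\<theta> \<in> {0..2*pi}"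
  shows "2 * pi * poisson_int g (polar r \<theta>) = integral {0..pi} (\<lambda>s. pkernel r s * (g (\<theta> + s) + g (\<theta> - s)))"
proof -
  define G where "G = (\<lambda>t. pkernel r (t - \<theta>) * g t)"
  have cG: "continuous_on A G" for A unfolding G_def
    by (intro continuous_intros continuous_pkernel r continuous_on_subset[OF c]) auto
  have pG: "G (t + 2*pi) = G t" for t
    using p by (simp add: G_def pkernel_def cos_diff)
  have ev: "pkernel r (-s) = pkernel r s" for s by (simp add: pkernel_def)
  have "2 * pi * poisson_int g (polar r \<theta>) = integral {0..2*pi} G"
    unfolding poisson_eq_kernel G_def[symmetric] by (subst continuous_circ(2)) (auto intro: cG[unfolded G_def] simp: G_def)
  also have "\<dots> = integral {\<theta> - pi..\<theta> - pi + 2*pi} G"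
    by (rule integral_periodic_shift[symmetric]) (use \<theta> cG pG in auto)
  also have "\<dots> = integral {0..pi} (\<lambda>s. G (\<theta> + s) + G (\<theta> - s))"
    using integral_symmetric_interval[OF cG, of pi \<theta>] by (simp add: add.commute)
  also have "\<dots> = integral {0..pi} (\<lambda>s. pkernel r s * (g (\<theta> + s) + g (\<theta> - s)))"
    by (intro integral_cong) (simp add: G_def ev algebra_simps)
  finally show ?thesis .
qed

text \<open>The kernel decreases on \<open>[0, pi]\<close>, so D below has derivative at most
  \<open>pkernel r t * (2 * lam - g (\<theta> + t) - g (\<theta> - t))\<close>; integrate over \<open>[0, pi]\<close>.\<close>

lemma poisson_le_averages:
  fixes g :: "real \<Rightarrow> real"
  assumes c: "continuous_on UNIV g" and p: "\<And>t. g (t + 2*pi) = g t" and r: "0 \<le> r" "r < 1" and \<theta>: "\<theta> \<in> {0..2*pi}"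
    and avg: "\<And>t. 0 < t \<Longrightarrow> t \<le> pi \<Longrightarrow> integral {\<theta> - t..\<theta> + t} g \<le> 2 * lam * t"
  shows "poisson_int g (polar r \<theta>) \<le> lam"
proof -
  define h where "h = (\<lambda>s. g (\<theta> + s) + g (\<theta> - s))"
  have cg: "continuous_on A (\<lambda>x. g (f x))" if "continuous_on A f" for A :: "real set" and f
    by (rule continuous_on_compose2[OF c that]) auto
  have ch: "continuous_on A h" for A unfolding h_def by (intro continuous_intros cg)
  have Ah: "integral {0..t} h = integral {\<theta> - t..\<theta> + t} g" if "0 \<le> t" for t
    unfolding h_def by (rule integral_symmetric_interval[OF c that, symmetric])
  define dn where "dn = (\<lambda>s. 1 - 2 * r * cos s + r\<^sup>2)"
  have dn: "0 < dn s" for s unfolding dn_def by (rule pkernel_denom_pos[OF r])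
  define pk' where "pk' = (\<lambda>t. - (1 - r\<^sup>2) * (2 * r * sin t) / (dn t)\<^sup>2)"
  have dpk: "(pkernel r has_real_derivative pk' t) (at t within A)" for t A
  proof -
    have d: "(dn has_real_derivative 2 * r * sin t) (at t within A)"
      unfolding dn_def by (auto intro!: derivative_eq_intros)
    have "((\<lambda>t. (1 - r\<^sup>2) / dn t) has_real_derivative (0 * dn t - (1 - r\<^sup>2) * (2 * r * sin t)) / (dn t * dn t)) (at t within A)"
      using dn[of t] by (intro DERIV_divide[OF DERIV_const d]) auto
    moreover have "pkernel r = (\<lambda>t. (1 - r\<^sup>2) / dn t)" by (simp add: pkernel_def fun_eq_iff dn_def)
    moreover have "(0 * dn t - (1 - r\<^sup>2) * (2 * r * sin t)) / (dn t * dn t) = pk' t"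
      unfolding pk'_def power2_eq_square[of "dn t"] by (simp only: mult_zero_left diff_0 minus_mult_left)
    ultimately show ?thesis by simp
  qed
  define D where "D = (\<lambda>t. pkernel r t * (2 * lam * t - integral {0..t} h))"
  define D' where "D' = (\<lambda>t. pk' t * (2 * lam * t - integral {0..t} h) + pkernel r t * (2 * lam - h t))"
  have dD: "(D has_real_derivative D' t) (at t within {0..pi})" if "t \<in> {0..pi}" for t
  proof -
    have "((\<lambda>x. integral {0..x} h) has_real_derivative h t) (at t within {0..pi})"
      by (rule integral_has_real_derivative[OF ch that])
    then have "((\<lambda>t. 2 * lam * t - integral {0..t} h) has_real_derivative (2 * lam - h t)) (at t within {0..pi})"
      by (auto intro!: derivative_eq_intros)
    from DERIV_mult[OF dpk this] show ?thesis unfolding D_def D'_def by (simp add: algebra_simps)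
  qed
  have "(D' has_integral (D pi - D 0)) {0..pi}"
    using dD by (intro fundamental_theorem_of_calculus) (auto simp: has_real_derivative_iff_has_vector_derivative)
  moreover have "((\<lambda>t. pkernel r t * (2 * lam - h t)) has_integral integral {0..pi} (\<lambda>t. pkernel r t * (2 * lam - h t))) {0..pi}"
    by (intro integrable_integral integrable_continuous_interval continuous_intros ch continuous_pkernel r)
  moreover have "D' t \<le> pkernel r t * (2 * lam - h t)" if t: "t \<in> {0..pi}" for t
  proof -
    have "0 \<le> 2 * lam * t - integral {0..t} h" using avg[of t] t Ah[of t] by (cases "t = 0") auto
    moreover have "pk' t \<le> 0"
    proof -
      have "0 \<le> (1 - r\<^sup>2) * (2 * r * sin t) / (dn t)\<^sup>2"
        using r t sin_ge_zero[of t] by (intro divide_nonneg_nonneg mult_nonneg_nonneg) (auto simp: abs_square_le_1)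
      then show ?thesis unfolding pk'_def by (simp only: mult_minus_left minus_divide_left[symmetric] neg_le_0_iff_le)
    qed
    ultimately show ?thesis unfolding D'_def by (simp add: mult_nonpos_nonneg)
  qed
  ultimately have "D pi - D 0 \<le> integral {0..pi} (\<lambda>t. pkernel r t * (2 * lam - h t))"
    by (rule has_integral_le)
  \<comment> \<open>The hypothesis at the largest radius \<open>pi\<close>, that is, on the average
    over the full circle.\<close>
  moreover have "0 \<le> D pi" unfolding D_def using pkernel_pos[OF r, of pi] avg[of pi] Ah[of pi] by auto
  moreover have "D 0 = 0" by (simp add: D_def)
  ultimately have "0 \<le> integral {0..pi} (\<lambda>t. lam * (pkernel r t * (1 + 1)) - pkernel r t * h t)"
    by (simp add: algebra_simps)
  also have "\<dots> = lam * integral {0..pi} (\<lambda>t. pkernel r t * (1 + 1)) - integral {0..pi} (\<lambda>t. pkernel r t * h t)"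
    by (subst integral_diff) (auto intro!: integrable_continuous_interval continuous_intros ch continuous_pkernel r)
  \<comment> \<open>Obtained by folding the Poisson integral of the constant 1, whose value is
    1.\<close>
  also have "integral {0..pi} (\<lambda>t. pkernel r t * (1 + 1)) = 2 * pi"
    using poisson_symmetric[OF _ _ r \<theta>, of "\<lambda>_. 1"] integral_poisson[of "polar r \<theta>"] r by (simp add: norm_mult)
  also have "integral {0..pi} (\<lambda>t. pkernel r t * h t) = 2 * pi * poisson_int g (polar r \<theta>)"
    unfolding h_def by (rule poisson_symmetric[OF c p r \<theta>, symmetric])
  finally have "2 * pi * poisson_int g (polar r \<theta>) \<le> 2 * pi * lam" by (simp add: algebra_simps)
  then show ?thesis by simp
qed

text \<open>Weak-type estimate for the radial maximal function. A Poisson integral above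
  \<open>lam\<close> forces, by \<open>poisson_le_averages\<close>, an average above
  \<open>lam\<close> on some interval of radius \<open>\<tau>\<close> at most \<open>pi\<close>, and
  Vitali's lemma selects disjoint ones whose fivefold enlargements cover. An enlarged interval has
  length \<open>10 * \<tau>\<close>, at most \<open>5 / lam\<close> times the integral over the
  original. The originals lie in \<open>{-pi..3*pi}\<close>, two periods with integral
  \<open>4 * pi\<close> times the mean; this makes \<open>20 * pi\<close>. The cover
  \<open>T\<close> is returned since it is visibly measurable.\<close>

lemma maximal_inequality:
  fixes g :: "real \<Rightarrow> real"
  assumes c: "continuous_on UNIV g" and p: "\<And>t. g (t + 2*pi) = g t" and g0: "\<And>t. 0 \<le> g t" and lam: "0 < lam"
  obtains T where "T \<in> lmeasurable" "measure lebesgue T \<le> 20 * pi * (LINT t|circ. g t) / lam"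
    "\<And>\<theta> r. \<theta> \<in> {0..2*pi} \<Longrightarrow> 0 \<le> r \<Longrightarrow> r < 1 \<Longrightarrow> lam < (poisson_int g (polar r \<theta>)) \<Longrightarrow> \<theta> \<in> T"
proof -
  define S where "S = {\<theta>. \<theta> \<in> {0..2*pi} \<and> (\<exists>r. 0 \<le> r \<and> r < 1 \<and> lam < (poisson_int g (polar r \<theta>)))}"
  have "\<exists>t. 0 < t \<and> t \<le> pi \<and> 2 * lam * t < integral {\<theta> - t..\<theta> + t} g" if "\<theta> \<in> S" for \<theta>
    using that poisson_le_averages[OF c p, of _ \<theta> lam] unfolding S_def by (fastforce simp: not_le[symmetric])
  then obtain \<tau> where \<tau>: "\<And>\<theta>. \<theta> \<in> S \<Longrightarrow> 0 < \<tau> \<theta> \<and> \<tau> \<theta> \<le> pi \<and> 2 * lam * \<tau> \<theta> < integral {\<theta> - \<tau> \<theta>..\<theta> + \<tau> \<theta>} g"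
    by metis
  obtain C where C: "countable C" "C \<subseteq> S" "pairwise (\<lambda>i j. disjnt (cball i (\<tau> i)) (cball j (\<tau> j))) C"
     "S \<subseteq> (\<Union>i\<in>C. cball i (5 * \<tau> i))"
    using Vitali_covering_lemma_cballs[where S = S and K = S and a = "\<lambda>x. x" and r = \<tau> and B = pi] \<tau>
    by (force intro: less_imp_le)
  define T where "T = (\<Union>i\<in>C. cball i (5 * \<tau> i))"
  have ig: "set_integrable lebesgue {x..y} g" for x y
    using absolutely_integrable_continuous[of x y g] continuous_on_subset[OF c] by (simp add: cbox_interval)
  have igS: "set_integrable lebesgue A g" if "A \<subseteq> {x..y}" "A \<in> sets lebesgue" for A x y
    using set_integrable_subset[OF ig that(2,1)] .
  define I where "I = (LINT t|circ. g t)"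
  have I2: "integral {0..2*pi} g = 2 * pi * I"
    unfolding I_def by (subst continuous_circ(2)) (auto intro: continuous_on_subset[OF c])
  have cig: "g integrable_on {x..y}" for x y
    by (intro integrable_continuous_interval continuous_on_subset[OF c]) auto
  have I4: "integral {-pi..3*pi} g = 4 * pi * I"
  proof -
    have "integral {-pi..pi} g + integral {pi..3*pi} g = integral {-pi..3*pi} g"
      by (rule Henstock_Kurzweil_Integration.integral_combine) (use cig in auto)
    then show ?thesis using integral_periodic_shift[OF c p, of "-pi"] integral_periodic_shift[OF c p, of "pi"] I2
      by (simp add: ac_simps)
  qed
  have fin: "measure lebesgue (\<Union>\<E>) \<le> 20 * pi * I / lam" if E: "\<E> \<subseteq> (\<lambda>i. cball i (5 * \<tau> i)) ` C" "finite \<E>" for \<E>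
  proof -
    obtain F where F: "F \<subseteq> C" "finite F" "\<E> = (\<lambda>i. cball i (5 * \<tau> i)) ` F"
      using finite_subset_image[OF E(2,1)] by blast
    have cb: "cball i (\<tau> i) = {i - \<tau> i..i + \<tau> i}" for i :: real by (rule cball_eq_atLeastAtMost)
    have sub: "(\<Union>i\<in>F. cball i (\<tau> i)) \<subseteq> {-pi..3*pi}"
    proof safe
      fix i x assume "i \<in> F" "x \<in> cball i (\<tau> i)"
      moreover from this have "i \<in> S" using F C by auto
      moreover from this have "i \<in> {0..2*pi}" by (simp add: S_def)
      ultimately show "x \<in> {-pi..3*pi}" using \<tau>[of i] unfolding cb by auto
    qed
    have d: "disjoint_family_on (\<lambda>i. cball i (\<tau> i)) F"
      using C(3) F(1) unfolding disjoint_family_on_def pairwise_def disjnt_def by blast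
    have "measure lebesgue (\<Union>\<E>) \<le> (\<Sum>i\<in>F. measure lebesgue (cball i (5 * \<tau> i)))"
      unfolding F(3) by (rule measure_UNION_le[OF F(2)]) auto
    also have "\<dots> = (\<Sum>i\<in>F. 10 * \<tau> i)"
    proof (rule sum.cong[OF refl])
      fix i assume "i \<in> F"
      then have "0 < \<tau> i" using F C \<tau> by auto
      then show "measure lebesgue (cball i (5 * \<tau> i)) = 10 * \<tau> i" by (simp add: cball_eq_atLeastAtMost)
    qed
    also have "\<dots> \<le> (\<Sum>i\<in>F. (5 / lam) * (LINT t:cball i (\<tau> i)|lebesgue. g t))"
    proof (rule sum_mono)
      fix i assume "i \<in> F"
      then have "2 * lam * \<tau> i < integral {i - \<tau> i..i + \<tau> i} g" using F C \<tau> by auto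
      also have "\<dots> = (LINT t:cball i (\<tau> i)|lebesgue. g t)"
        unfolding cb using set_lebesgue_integral_eq_integral(2)[OF ig] by simp
      finally show "10 * \<tau> i \<le> (5 / lam) * (LINT t:cball i (\<tau> i)|lebesgue. g t)"
        using lam by (simp add: field_simps)
    qed
    also have "\<dots> = (5 / lam) * (LINT t:(\<Union>i\<in>F. cball i (\<tau> i))|lebesgue. g t)"
      unfolding sum_distrib_left[symmetric]
      by (subst set_integral_finite_Union[OF F(2) d]) (auto simp: cb intro: ig)
    also have "\<dots> \<le> (5 / lam) * (LINT t:{-pi..3*pi}|lebesgue. g t)"
    proof (intro mult_left_mono)
      have m: "(\<Union>i\<in>F. cball i (\<tau> i)) \<in> sets lebesgue" using F(2) by (intro sets.finite_UN) auto
      show "(LINT t:(\<Union>i\<in>F. cball i (\<tau> i))|lebesgue. g t) \<le> (LINT t:{-pi..3*pi}|lebesgue. g t)"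
        unfolding set_lebesgue_integral_def
      proof (intro integral_mono)
        fix x
        show "indicator (\<Union>i\<in>F. cball i (\<tau> i)) x *\<^sub>R g x \<le> indicator {-pi..3*pi} x *\<^sub>R g x"
          using subsetD[OF sub, of x] g0[of x]
          by (cases "x \<in> (\<Union>i\<in>F. cball i (\<tau> i))"; cases "x \<in> {-pi..3*pi}") simp_all
      qed (use igS[OF sub m] ig[of "-pi" "3*pi"] in \<open>auto simp: set_integrable_def\<close>)
    qed (use lam in auto)
    also have "(LINT t:{-pi..3*pi}|lebesgue. g t) = 4 * pi * I"
      using set_lebesgue_integral_eq_integral(2)[OF ig] I4 by simp
    finally show ?thesis by (simp add: field_simps)
  qed
  have T1: "T \<in> lmeasurable" unfolding T_def
    by (rule fmeasurable_Union_bound[OF _ _ fin]) (use C in auto)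
  have T2: "measure lebesgue T \<le> 20 * pi * I / lam" unfolding T_def
    by (rule measure_Union_bound[OF _ _ fin]) (use C in auto)
  show ?thesis
  proof (rule that[OF T1 T2[unfolded I_def]])
    fix \<theta> r assume "\<theta> \<in> {0..2*pi}" "0 \<le> r" "r < 1" "lam < (poisson_int g (polar r \<theta>))"
    then have "\<theta> \<in> S" by (auto simp: S_def)
    then show "\<theta> \<in> T" using C(4) unfolding T_def by blast
  qed
qed

section \<open>Radial limits of bounded analytic functions\<close>

lemma mult_less_1: "0 \<le> \<rho> \<Longrightarrow> \<rho> \<le> 1 \<Longrightarrow> 0 \<le> x \<Longrightarrow> x < 1 \<Longrightarrow> \<rho> * x < (1::real)"
  by (rule le_less_trans[of _ x]) (auto intro: mult_left_le_one_le)

lemma holomorphic_radial_difference: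
  assumes b: "b holomorphic_on ball 0 1" and \<rho>: "0 \<le> \<rho>" "\<rho> \<le> 1"
  shows "(\<lambda>z. b z - b (of_real \<rho> * z)) holomorphic_on ball 0 1"
proof -
  have "(*) (complex_of_real \<rho>) ` ball 0 1 \<subseteq> ball 0 1"
    using \<rho> by (auto simp: norm_mult intro!: mult_less_1)
  then have "(b \<circ> (\<lambda>z. of_real \<rho> * z)) holomorphic_on ball 0 1"
    by (intro holomorphic_on_compose_gen[OF _ b] holomorphic_intros) auto
  then show ?thesis using b by (intro holomorphic_intros) (auto simp: o_def)
qed

text \<open>What matters is that one \<open>\<rho>\<close> serves all \<open>s\<close>. Boundary
  values are not yet available, so the square-summable Taylor coefficients stand in for them: the
  sum of \<open>(cmod (a n))\<^sup>2 * (1 - \<rho> ^ n)\<^sup>2\<close> tends to 0 as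
  \<open>\<rho>\<close> tends to 1, by Tannery's theorem.\<close>

lemma bounded_radial_difference_mean:
  assumes b: "b holomorphic_on ball 0 1" and B: "\<forall>z\<in>ball 0 1. cmod (b z) \<le> B" and e: "0 < e"
  obtains \<rho> where "0 < \<rho>" "\<rho> < 1"
    "\<And>s. 0 \<le> s \<Longrightarrow> s < 1 \<Longrightarrow> (LINT t|circ. cmod (b (polar s t) - b (of_real \<rho> * polar s t))) \<le> e"
proof -
  obtain a where a: "has_coeffs b a" using has_coeffs_ex[OF b] .
  have square: "x * cnj x = complex_of_real ((cmod x)\<^sup>2)" for x by (simp only: complex_norm_square)
  have par: "(\<lambda>n. (cmod (c n))\<^sup>2 * (s\<^sup>2) ^ n) sums (LINT t|circ. (cmod (f (polar s t)))\<^sup>2)"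
    if "has_coeffs f c" "0 \<le> s" "s < 1" for f c s
  proof -
    have "(\<lambda>n. complex_of_real ((cmod (c n))\<^sup>2 * (s\<^sup>2) ^ n)) sums complex_of_real (LINT t|circ. (cmod (f (polar s t)))\<^sup>2)"
      using pairing_integral[OF that(1,1,2,3)] unfolding square integral_complex_of_real by simp
    then show ?thesis by (simp only: sums_of_real_iff)
  qed
  have B0: "0 \<le> B" using bspec[OF B, of 0] norm_ge_zero[of "b 0"] by (simp del: norm_ge_zero)
  have intsq: "integrable circ (\<lambda>t. (cmod (f (polar s t)))\<^sup>2)"
    if "f holomorphic_on ball 0 1" "0 \<le> s" "s < 1" for f s
    by (intro continuous_circ continuous_intros continuous_on_dilate that)
  \<comment> \<open>Parseval at radius \<open>rseq k\<close> bounds a partial sum of the damped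
    series by \<open>B\<^sup>2\<close>; for a finite sum the radius can go to 1.\<close>
  have fin: "(\<Sum>n<N. (cmod (a n))\<^sup>2) \<le> B\<^sup>2" for N
  proof (rule LIMSEQ_le_const2)
    show "(\<lambda>k. \<Sum>n<N. (cmod (a n))\<^sup>2 * ((rseq k)\<^sup>2) ^ n) \<longlonglongrightarrow> (\<Sum>n<N. (cmod (a n))\<^sup>2)"
      by (rule tendsto_eq_intros rseq_LIMSEQ refl)+ simp
    have "(\<Sum>n<N. (cmod (a n))\<^sup>2 * ((rseq k)\<^sup>2) ^ n) \<le> B\<^sup>2" for k
    proof -
      have "(\<Sum>n<N. (cmod (a n))\<^sup>2 * ((rseq k)\<^sup>2) ^ n) \<le> (\<Sum>n. (cmod (a n))\<^sup>2 * ((rseq k)\<^sup>2) ^ n)"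
        by (intro sum_le_suminf sums_summable[OF par[OF a rseq(4,2)]]) auto
      also have "\<dots> = (LINT t|circ. (cmod (b (polar (rseq k) t)))\<^sup>2)"
        using par[OF a rseq(4,2)] by (simp add: sums_iff)
      also have "\<dots> \<le> (LINT t|circ. B\<^sup>2)"
        using B B0 rseq by (intro integral_mono intsq b power_mono) (auto simp: norm_mult)
      finally show ?thesis by simp
    qed
    then show "\<exists>K. \<forall>k\<ge>K. (\<Sum>n<N. (cmod (a n))\<^sup>2 * ((rseq k)\<^sup>2) ^ n) \<le> B\<^sup>2" by blast
  qed
  have sm: "summable (\<lambda>n. (cmod (a n))\<^sup>2)"
    by (rule summableI_nonneg_bounded[OF _ fin]) simp
  define \<eta> where "\<eta> = (\<lambda>\<rho>. \<Sum>n. (cmod (a n))\<^sup>2 * (1 - \<rho> ^ n)\<^sup>2)"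
  have le: "(1 - \<rho> ^ n)\<^sup>2 \<le> 1" if "0 \<le> \<rho>" "\<rho> \<le> 1" for \<rho> :: real and n
    using that by (simp add: abs_square_le_1 power_le_one)
  have "(\<lambda>k. \<eta> (rseq k)) \<longlonglongrightarrow> (\<Sum>n. 0)"
    unfolding \<eta>_def
  proof (rule tannerys_theorem[THEN conjunct2, THEN conjunct2])
    show "((\<lambda>k. (cmod (a n))\<^sup>2 * (1 - rseq k ^ n)\<^sup>2) \<longlongrightarrow> 0) sequentially" for n
      by (rule tendsto_eq_intros rseq_LIMSEQ refl)+ simp
    show "summable (\<lambda>n. (cmod (a n))\<^sup>2)" by (rule sm)
    show "\<forall>\<^sub>F (n, k) in at_top \<times>\<^sub>F sequentially. norm ((cmod (a n))\<^sup>2 * (1 - rseq k ^ n)\<^sup>2) \<le> (cmod (a n))\<^sup>2"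
      using le[OF rseq(4,3)] by (intro always_eventually) (auto simp: mult_left_le)
  qed simp
  then have "eventually (\<lambda>k. \<eta> (rseq k) < e\<^sup>2) sequentially"
    using e by (intro order_tendstoD) auto
  then obtain k where k: "\<eta> (rseq k) < e\<^sup>2" by (auto simp: eventually_sequentially)
  define \<rho> where "\<rho> = rseq k"
  have \<rho>: "0 < \<rho>" "\<rho> < 1" "0 \<le> \<rho>" "\<rho> \<le> 1" using rseq by (auto simp: \<rho>_def)
  define d where "d = (\<lambda>z. b z - b (of_real \<rho> * z))"
  have dh: "d holomorphic_on ball 0 1" unfolding d_def by (rule holomorphic_radial_difference) (use b \<rho> in auto)
  have dc: "has_coeffs d (\<lambda>n. a n * of_real (1 - \<rho> ^ n))"
    unfolding has_coeffs_def
  proof safe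
    fix z :: complex assume z: "cmod z < 1"
    have "cmod (of_real \<rho> * z) < 1" using z \<rho> by (auto simp: norm_mult intro!: mult_less_1)
    then have "(\<lambda>n. a n * z ^ n - a n * (of_real \<rho> * z) ^ n) sums d z"
      unfolding d_def using a z unfolding has_coeffs_def by (intro sums_diff) auto
    then show "(\<lambda>n. a n * of_real (1 - \<rho> ^ n) * z ^ n) sums d z"
      by (simp add: algebra_simps power_mult_distrib)
  qed
  have "(LINT t|circ. cmod (d (polar s t))) \<le> e" if s: "0 \<le> s" "s < 1" for s
  proof -
    let ?Q = "LINT t|circ. (cmod (d (polar s t)))\<^sup>2"
    have "?Q = (\<Sum>n. (cmod (a n))\<^sup>2 * (1 - \<rho> ^ n)\<^sup>2 * (s\<^sup>2) ^ n)"
      using par[OF dc s] by (simp add: sums_iff norm_mult power_mult_distrib flip: of_real_diff of_real_power)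
    also have "\<dots> \<le> \<eta> \<rho>" unfolding \<eta>_def
    proof (rule suminf_le)
      show "summable (\<lambda>n. (cmod (a n))\<^sup>2 * (1 - \<rho> ^ n)\<^sup>2 * (s\<^sup>2) ^ n)"
        using par[OF dc s] by (simp add: sums_iff norm_mult power_mult_distrib flip: of_real_diff of_real_power)
      show "summable (\<lambda>n. (cmod (a n))\<^sup>2 * (1 - \<rho> ^ n)\<^sup>2)"
        by (rule summable_comparison_test'[OF sm, of 0]) (use le[OF \<rho>(3,4)] in \<open>auto simp: mult_left_le\<close>)
      show "(cmod (a n))\<^sup>2 * (1 - \<rho> ^ n)\<^sup>2 * (s\<^sup>2) ^ n \<le> (cmod (a n))\<^sup>2 * (1 - \<rho> ^ n)\<^sup>2" for n
        using s by (intro mult_left_le) (auto simp: power_le_one abs_square_le_1)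
    qed
    finally have sq: "?Q \<le> e\<^sup>2" using k by (simp add: \<rho>_def)
    \<comment> \<open>The arithmetic-geometric mean inequality with weight \<open>e\<close>, used in
      place of Cauchy-Schwarz to pass from the mean square to the mean.\<close>
    have pt: "cmod w \<le> (e + (cmod w)\<^sup>2 / e) / 2" for w
    proof -
      have "0 \<le> (cmod w - e)\<^sup>2" by simp
      then have "2 * e * cmod w \<le> e\<^sup>2 + (cmod w)\<^sup>2" by (simp add: power2_eq_square algebra_simps)
      then show ?thesis using e by (simp add: field_simps power2_eq_square)
    qed
    have "(LINT t|circ. cmod (d (polar s t))) \<le> (LINT t|circ. (e + (cmod (d (polar s t)))\<^sup>2 / e) / 2)"
      by (rule integral_mono) (use pt integrable_dilate[OF dh s] intsq[OF dh s] in auto)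
    also have "\<dots> = (e + ?Q / e) / 2"
      using intsq[OF dh s] by simp
    also have "\<dots> \<le> (e + e\<^sup>2 / e) / 2" using sq e by (intro divide_right_mono add_left_mono) auto
    also have "\<dots> = e" using e by (simp add: power2_eq_square)
    finally show ?thesis .
  qed
  then show ?thesis using that[of \<rho>] \<rho> unfolding d_def by auto
qed

lemma bounded_radial_oscillation:
  assumes b: "b holomorphic_on ball 0 1" and B: "\<forall>z\<in>ball 0 1. cmod (b z) \<le> B"
    and e: "0 < e" and lam: "0 < lam"
  obtains \<rho> E where "0 < \<rho>" "\<rho> < 1" "E \<in> lmeasurable" "measure lebesgue E \<le> e"
    "\<And>\<theta> r. \<theta> \<in> {0..2*pi} - E \<Longrightarrow> 0 \<le> r \<Longrightarrow> r < 1 \<Longrightarrow> cmod (b (polar r \<theta>) - b (of_real \<rho> * polar r \<theta>)) \<le> lam"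
proof -
  \<comment> \<open>Chosen so that the bound of \<open>maximal_inequality\<close> at level
    \<open>lam\<close> becomes exactly \<open>e\<close>.\<close>
  define e' where "e' = e * lam / (20 * pi)"
  have e': "0 < e'" using e lam by (simp add: e'_def)
  obtain \<rho> where \<rho>: "0 < \<rho>" "\<rho> < 1" and
    m: "\<And>s. 0 \<le> s \<Longrightarrow> s < 1 \<Longrightarrow> (LINT t|circ. cmod (b (polar s t) - b (of_real \<rho> * polar s t))) \<le> e'"
    using bounded_radial_difference_mean[OF b B e'] by metis
  define d where "d = (\<lambda>z. b z - b (of_real \<rho> * z))"
  have dh: "d holomorphic_on ball 0 1" unfolding d_def by (rule holomorphic_radial_difference) (use b \<rho> in auto)
  \<comment> \<open>The maximal inequality takes a continuous function on the circle, hence the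
    dilation of \<open>d\<close> by \<open>rseq n\<close>. The sets increase with \<open>n\<close>,
    and they exhaust the exceptional set because each radius below 1 is eventually below
    \<open>rseq n\<close>.\<close>
  define F where "F = (\<lambda>n. {0..2*pi} \<inter> (\<Union>r\<in>{0..<1}. {\<theta>. lam < cmod (d (of_real (rseq n) * polar r \<theta>))}))"
  have cd: "continuous_on UNIV (\<lambda>\<theta>. cmod (d (polar s \<theta>)))" if "0 \<le> s" "s < 1" for s
    by (intro continuous_intros continuous_on_dilate[OF dh that])
  have rs: "0 \<le> rseq n * r" "rseq n * r < 1" if "r \<in> {0..<1}" for n r
    using that rseq[of n] by (auto intro!: mult_less_1)
  have Fm: "F n \<in> lmeasurable" for n
  proof -
    have "open (\<Union>r\<in>{0..<1}. {\<theta>. lam < cmod (d (of_real (rseq n) * polar r \<theta>))})"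
    proof (intro open_UN ballI)
      fix r :: real assume r: "r \<in> {0..<1}"
      have "open {\<theta>. lam < cmod (d (polar (rseq n * r) \<theta>))}"
        by (intro open_Collect_less cd rs r continuous_intros)
      then show "open {\<theta>. lam < cmod (d (of_real (rseq n) * polar r \<theta>))}"
        by (simp add: mult.assoc)
    qed
    then show ?thesis unfolding F_def
      by (intro fmeasurable_Int_fmeasurable lmeasurable_compact compact_Icc)
         (auto simp: borel_open)
  qed
  have Fb: "measure lebesgue (F n) \<le> e" for n
  proof -
    define s where "s = rseq n"
    have s: "0 \<le> s" "s < 1" using rseq[of n] by (auto simp: s_def)
    have p: "cmod (d (polar s (t + 2*pi))) = cmod (d (polar s t))" for t
      by (simp add: cis_mult[symmetric])
    obtain T where T: "T \<in> lmeasurable" "measure lebesgue T \<le> 20 * pi * (LINT t|circ. cmod (d (polar s t))) / lam"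
      "\<And>\<theta> r. \<theta> \<in> {0..2*pi} \<Longrightarrow> 0 \<le> r \<Longrightarrow> r < 1 \<Longrightarrow>
         lam < (LINT t|circ. poisson (polar r \<theta>) t * cmod (d (polar s t))) \<Longrightarrow> \<theta> \<in> T"
      by (rule maximal_inequality[OF cd[OF s] p norm_ge_zero lam]) (rule that)
    have "F n \<subseteq> T"
    proof
      fix \<theta> assume "\<theta> \<in> F n"
      then obtain r where r: "\<theta> \<in> {0..2*pi}" "0 \<le> r" "r < 1" "lam < cmod (d (of_real s * polar r \<theta>))"
        by (auto simp: F_def s_def)
      have z: "cmod (polar r \<theta>) < 1" using r by (simp add: norm_mult)
      have "d (of_real s * polar r \<theta>) = (LINT t|circ. complex_of_real (poisson (polar r \<theta>) t) * d (polar s t))"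
        by (rule poisson_formula_dilate[OF dh s z])
      also have "cmod \<dots> \<le> (LINT t|circ. norm (complex_of_real (poisson (polar r \<theta>) t) * d (polar s t)))"
        by (rule integral_norm_bound)
      also have "\<dots> = (LINT t|circ. poisson (polar r \<theta>) t * cmod (d (polar s t)))"
        using poisson_bounds(1)[OF z] by (simp add: norm_mult abs_of_pos)
      finally show "\<theta> \<in> T" using T(3)[OF r(1-3)] r(4) by linarith
    qed
    then have "measure lebesgue (F n) \<le> measure lebesgue T"
      by (intro measure_mono_fmeasurable T(1)) (use Fm in auto)
    also have "\<dots> \<le> 20 * pi * e' / lam"
    proof -
      have "(LINT t|circ. cmod (d (polar s t))) \<le> e'" using m[OF s] unfolding d_def .
      then have "20 * pi * (LINT t|circ. cmod (d (polar s t))) / lam \<le> 20 * pi * e' / lam"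
        using lam by (intro divide_right_mono mult_left_mono) auto
      then show ?thesis using T(2) by linarith
    qed
    also have "\<dots> = e" using lam by (simp add: e'_def)
    finally show ?thesis .
  qed
  have Fmono: "F m \<subseteq> F n" if "m \<le> n" for m n
  proof
    fix \<theta> assume "\<theta> \<in> F m"
    then obtain r where r: "\<theta> \<in> {0..2*pi}" "0 \<le> r" "r < 1" "lam < cmod (d (of_real (rseq m) * polar r \<theta>))"
      by (auto simp: F_def)
    \<comment> \<open>Rescaling the witness radius by this ratio gives the same point of the disc,
      now seen from the larger dilation.\<close>
    have q: "rseq m / rseq n \<le> 1" "0 \<le> rseq m / rseq n" using rseq_mono[OF that] rseq by (auto simp: divide_simps)
    have "of_real (rseq m) * polar r \<theta> = of_real (rseq n) * polar (rseq m / rseq n * r) \<theta>"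
      using rseq(1)[of n] by simp
    moreover have "rseq m / rseq n * r < 1" "0 \<le> rseq m / rseq n * r"
      using q r mult_left_le_one_le[of r "rseq m / rseq n"] by (auto simp del: mult_le_cancel_right1 times_divide_eq_left)
    ultimately have "rseq m / rseq n * r \<in> {0..<1}"
      "\<theta> \<in> {\<theta>. lam < cmod (d (of_real (rseq n) * polar (rseq m / rseq n * r) \<theta>))}"
      using r(4) by auto
    then show "\<theta> \<in> F n" unfolding F_def using r(1) by blast
  qed
  have U: "(\<Union>i\<le>n. F i) = F n" for n using Fmono by auto
  show ?thesis
  proof (rule that[OF \<rho>])
    show "(\<Union>n. F n) \<in> lmeasurable" by (rule fmeasurable_countable_Union[OF Fm]) (use U Fb in auto)
    show "measure lebesgue (\<Union>n. F n) \<le> e" by (rule measure_countable_Union_le[OF Fm]) (use U Fb in auto)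
    fix \<theta> r assume \<theta>: "\<theta> \<in> {0..2*pi} - (\<Union>n. F n)" and r: "0 \<le> r" "r < (1::real)"
    show "cmod (b (polar r \<theta>) - b (of_real \<rho> * polar r \<theta>)) \<le> lam"
    proof (rule ccontr)
      assume n: "\<not> ?thesis"
      have "eventually (\<lambda>n. r < rseq n) sequentially" using rseq_LIMSEQ r by (intro order_tendstoD)
      then obtain n where "r < rseq n" by (auto simp: eventually_sequentially)
      then have q: "r / rseq n \<in> {0..<1}" and e: "of_real (rseq n) * polar (r / rseq n) \<theta> = polar r \<theta>"
        using r rseq(1)[of n] by auto
      have "\<theta> \<in> {\<theta>. lam < cmod (d (of_real (rseq n) * polar (r / rseq n) \<theta>))}"
        unfolding mem_Collect_eq e d_def using n by simp
      then have "\<theta> \<in> F n" using \<theta> q unfolding F_def by blast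
      then show False using \<theta> by auto
    qed
  qed
qed

text \<open>Fatou's theorem. Outside a set of small measure \<open>b\<close> stays within
  \<open>lam\<close> of its dilate along the whole radius, and the dilate is continuous up to the
  circle; so \<open>b\<close> oscillates little near the end of the radius. Countably many
  \<open>lam\<close> give the Cauchy criterion almost everywhere.\<close>

lemma bounded_radial_limit:
  assumes b: "b holomorphic_on ball 0 1" and B: "\<forall>z\<in>ball 0 1. cmod (b z) \<le> B"
  shows "AE \<theta> in circ. \<exists>l. ((\<lambda>r. b (polar r \<theta>)) \<longlongrightarrow> l) (at_left 1)"
proof -
  \<comment> \<open>The factor 3: near the circle \<open>b\<close> is within
    \<open>lam + lam / 2\<close> of its value at \<open>polar \<rho> \<theta>\<close>, and two radii
    are compared.\<close>
  define Q where "Q = (\<lambda>lam \<theta>. \<exists>r0. r0 < 1 \<and> (\<forall>r\<in>{r0..<1}. \<forall>r'\<in>{r0..<1}. cmod (b (polar r \<theta>) - b (of_real r' * cis \<theta>)) \<le> 3 * lam))"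
  have "negligible {\<theta>\<in>{0..2*pi}. \<not> Q lam \<theta>}" if lam: "0 < lam" for lam
    unfolding negligible_outer_le
  proof safe
    fix e :: real assume "0 < e"
    obtain \<rho> E where E: "0 < \<rho>" "\<rho> < 1" "E \<in> lmeasurable" "measure lebesgue E \<le> e"
      "\<And>\<theta> r. \<theta> \<in> {0..2*pi} - E \<Longrightarrow> 0 \<le> r \<Longrightarrow> r < 1 \<Longrightarrow> cmod (b (polar r \<theta>) - b (of_real \<rho> * polar r \<theta>)) \<le> lam"
      using bounded_radial_oscillation[OF b B \<open>0 < e\<close> lam] by metis
    have "{\<theta>\<in>{0..2*pi}. \<not> Q lam \<theta>} \<subseteq> E"
    proof (safe, rule ccontr)
      fix \<theta> assume \<theta>: "\<theta> \<in> {0..2*pi}" "\<not> Q lam \<theta>" "\<theta> \<notin> E"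
      have "continuous_on (ball 0 1) b" using b by (rule holomorphic_on_imp_continuous_on)
      moreover have "polar \<rho> \<theta> \<in> ball 0 1" using E by (simp add: norm_mult)
      ultimately have "isCont b (polar \<rho> \<theta>)" by (simp add: continuous_on_eq_continuous_at)
      then obtain \<delta> where \<delta>: "0 < \<delta>" "\<And>z. dist z (polar \<rho> \<theta>) < \<delta> \<Longrightarrow> dist (b z) (b (polar \<rho> \<theta>)) < lam / 2"
        unfolding continuous_at_eps_delta using lam by (meson half_gt_zero)
      define r0 where "r0 = max 0 (1 - \<delta> / 2)"
      have r0: "r0 < 1" using \<delta> by (simp add: r0_def)
      have near: "cmod (b (polar r \<theta>) - b (polar \<rho> \<theta>)) \<le> 3/2 * lam" if r: "r \<in> {r0..<1}" for r
      proof -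
        have r': "0 \<le> r" "r < 1" "1 - r < \<delta>" using r \<delta>(1) by (auto simp: r0_def)
        have "of_real \<rho> * polar r \<theta> - polar \<rho> \<theta> = polar (\<rho> * (r - 1)) \<theta>"
          by (simp add: algebra_simps)
        then have "dist (of_real \<rho> * polar r \<theta>) (polar \<rho> \<theta>) = \<rho> * (1 - r)"
          using E r' by (simp only: dist_norm norm_mult norm_of_real norm_cis) (simp add: abs_mult)
        also have "\<dots> \<le> 1 - r" using E r' by (simp add: mult_left_le_one_le)
        finally have "dist (b (of_real \<rho> * polar r \<theta>)) (b (polar \<rho> \<theta>)) < lam / 2"
          using r' by (intro \<delta>(2)) linarith
        moreover have "dist (b (polar r \<theta>)) (b (of_real \<rho> * polar r \<theta>)) \<le> lam"
          unfolding dist_norm using E(5)[of \<theta> r] \<theta> r' by simp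
        ultimately show ?thesis using dist_triangle[of "b (polar r \<theta>)" "b (polar \<rho> \<theta>)" "b (of_real \<rho> * polar r \<theta>)"]
          unfolding dist_norm by linarith
      qed
      have "Q lam \<theta>" unfolding Q_def
      proof (intro exI[of _ r0] conjI r0 ballI)
        fix r r' assume "r \<in> {r0..<1}" "r' \<in> {r0..<1}"
        from near[OF this(1)] near[OF this(2)]
        show "cmod (b (polar r \<theta>) - b (of_real r' * cis \<theta>)) \<le> 3 * lam"
          using norm_triangle_ineq4[of "b (polar r \<theta>) - b (polar \<rho> \<theta>)" "b (of_real r' * cis \<theta>) - b (polar \<rho> \<theta>)"]
          by simp
      qed
      then show False using \<theta> by simp
    qed
    then show "\<exists>T. {\<theta>\<in>{0..2*pi}. \<not> Q lam \<theta>} \<subseteq> T \<and> T \<in> lmeasurable \<and> measure lebesgue T \<le> e" using E by blast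
  qed
  then have "AE \<theta> in circ. Q lam \<theta>" if "0 < lam" for lam
    unfolding AE_circ_iff using that
    by (auto simp: negligible_iff_null_sets intro!: AE_I'[of "{\<theta>\<in>{0..2*pi}. \<not> Q lam \<theta>}"])
  then have "AE \<theta> in circ. \<forall>n. Q (inverse (real (Suc n))) \<theta>"
    unfolding AE_all_countable by simp
  then show ?thesis
  proof eventually_elim
    case (elim \<theta>)
    let ?b = "\<lambda>r. b (polar r \<theta>)"
    have Q: "\<exists>r0<1. \<forall>r\<in>{r0..<1}. \<forall>r'\<in>{r0..<1}. cmod (?b r - ?b r') \<le> e" if "0 < e" for e
    proof -
      have "0 < e / 3" using that by simp
      then obtain n where n: "inverse (real (Suc n)) < e / 3" using reals_Archimedean by blast
      then have "3 * inverse (real (Suc n)) \<le> e" by linarith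
      moreover obtain r0 where r0: "r0 < 1" "\<forall>r\<in>{r0..<1}. \<forall>r'\<in>{r0..<1}. cmod (?b r - ?b r') \<le> 3 * inverse (real (Suc n))"
        using elim[rule_format, of n] unfolding Q_def by (elim exE conjE)
      ultimately show ?thesis by (intro exI[of _ r0] conjI) (auto intro: order_trans)
    qed
    have "cauchy_filter (filtermap ?b (at_left 1))"
      unfolding cauchy_filter_metric_filtermap
    proof safe
      fix e :: real assume "0 < e"
      then obtain r0 where r0: "r0 < 1" "\<forall>r\<in>{r0..<1}. \<forall>r'\<in>{r0..<1}. cmod (?b r - ?b r') \<le> e/2"
        using Q[of "e/2"] by auto
      have "dist (?b r) (?b r') < e" if "r \<in> {r0<..<1}" "r' \<in> {r0<..<1}" for r r'
        using r0(2)[rule_format, of r r'] that \<open>0 < e\<close> by (simp add: dist_norm)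
      then show "\<exists>P. eventually P (at_left 1) \<and> (\<forall>x y. P x \<and> P y \<longrightarrow> dist (?b x) (?b y) < e)"
        using eventually_at_left_real[OF r0(1)] by blast
    qed
    moreover have "filtermap ?b (at_left 1) \<noteq> bot" by (simp add: filtermap_bot_iff)
    ultimately show ?case
      using cauchy_filter_complete_converges[OF _ complete_UNIV, of "filtermap ?b (at_left 1)"]
      by (auto simp: filterlim_def)
  qed
qed

section \<open>Logarithms of boundary values\<close>

text \<open>The Poisson kernel is an approximate identity. Taking \<open>v\<close> on the sphere
  builds in the matching of the two ends of \<open>{0..2*pi}\<close>, so that compactness gives
  uniform continuity across that point too.\<close>

lemma poisson_uniform:
  fixes v :: "complex \<Rightarrow> real"
  assumes v: "continuous_on (sphere 0 1) v" and e: "0 < e"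
  shows "\<exists>r0<1. 0 \<le> r0 \<and> (\<forall>r\<in>{r0..<1}. \<forall>\<theta>. \<bar>(LINT t|circ. poisson (polar r \<theta>) t * v (cis t)) - v (cis \<theta>)\<bar> \<le> e)"
proof -
  have "uniformly_continuous_on (sphere 0 1) v"
    by (rule compact_uniformly_continuous[OF v]) simp
  then obtain \<delta> where \<delta>: "0 < \<delta>" "\<And>x y. x \<in> sphere 0 1 \<Longrightarrow> y \<in> sphere 0 1 \<Longrightarrow> dist x y < \<delta> \<Longrightarrow> dist (v x) (v y) < e / 2"
    unfolding uniformly_continuous_on_def using e by (meson half_gt_zero)
  have "bounded (v ` sphere 0 1)" by (intro compact_imp_bounded compact_continuous_image v) simp
  then obtain M where M: "0 < M" "\<And>x. x \<in> sphere 0 1 \<Longrightarrow> \<bar>v x\<bar> \<le> M"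
    unfolding bounded_pos by auto
  have vm: "continuous_on {0..2*pi} (\<lambda>t. v (cis t))"
    by (rule continuous_on_compose2[OF v]) (auto intro!: continuous_intros)
  \<comment> \<open>For \<open>cis t\<close> at distance at least \<open>\<delta>\<close> from
    \<open>cis \<theta>\<close>, the first bound gives
    \<open>cmod (cis t - z) \<ge> \<delta> / 2\<close>, so the kernel is at most
    \<open>8 * (1 - r) / \<delta>\<^sup>2\<close>. The second makes this at most
    \<open>e / (4 * M)\<close>, and against an oscillation of \<open>2 * M\<close> it costs
    \<open>e / 2\<close>.\<close>
  define r0 where "r0 = max 0 (max (1 - \<delta> / 2) (1 - e * \<delta>\<^sup>2 / (32 * M)))"
  have r0: "r0 < 1" "0 \<le> r0" using \<delta> e M by (auto simp: r0_def)
  have "\<bar>(LINT t|circ. poisson (polar r \<theta>) t * v (cis t)) - v (cis \<theta>)\<bar> \<le> e" if r: "r \<in> {r0..<1}" for r \<theta>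
  proof -
    let ?z = "polar r \<theta>"
    have r': "0 \<le> r" "r < 1" "1 - r \<le> \<delta> / 2" "1 - r \<le> e * \<delta>\<^sup>2 / (32 * M)" using r unfolding r0_def by auto
    have z: "cmod ?z < 1" using r' by (simp add: norm_mult)
    have pt: "poisson ?z t * \<bar>v (cis t) - v (cis \<theta>)\<bar> \<le> poisson ?z t * (e/2) + e/2" for t
    proof (cases "dist (cis t) (cis \<theta>) < \<delta>")
      case True
      then have "\<bar>v (cis t) - v (cis \<theta>)\<bar> \<le> e / 2" using \<delta>(2)[of "cis t" "cis \<theta>"] by (auto simp: dist_norm)
      then have "poisson ?z t * \<bar>v (cis t) - v (cis \<theta>)\<bar> \<le> poisson ?z t * (e/2)"
        by (rule mult_left_mono) (rule less_imp_le[OF poisson_bounds(1)[OF z]])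
      then show ?thesis using e by linarith
    next
      case False
      have "cis \<theta> - ?z = polar (1 - r) \<theta>" by (simp add: algebra_simps)
      then have "cmod (cis \<theta> - ?z) = 1 - r" using r' by (simp add: norm_mult flip: of_real_diff)
      moreover have "dist (cis t) (cis \<theta>) \<le> cmod (cis t - ?z) + cmod (cis \<theta> - ?z)"
        unfolding dist_norm using norm_triangle_ineq4[of "cis t - ?z" "cis \<theta> - ?z"] by simp
      ultimately have d: "\<delta> / 2 \<le> cmod (cis t - ?z)" using False r' by simp
      have "1 - r\<^sup>2 \<le> 2 * (1 - r)" using zero_le_power2[of "1 - r"] by (simp add: power2_eq_square algebra_simps)
      then have "poisson ?z t \<le> 2 * (1 - r) / (\<delta> / 2)\<^sup>2"
        unfolding poisson_def using d \<delta>(1) r' by (intro frac_le power_mono) (auto simp: norm_mult)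
      also have "\<dots> = 8 * (1 - r) / \<delta>\<^sup>2" by (simp add: power2_eq_square)
      also have "\<dots> \<le> 8 * (e * \<delta>\<^sup>2 / (32 * M)) / \<delta>\<^sup>2" using r' by (intro divide_right_mono mult_left_mono) auto
      also have "\<dots> = e / (4 * M)" using \<delta>(1) by simp
      finally have p: "poisson ?z t \<le> e / (4 * M)" .
      have "\<bar>v (cis t) - v (cis \<theta>)\<bar> \<le> 2 * M" using M(2)[of "cis t"] M(2)[of "cis \<theta>"] by auto
      then have "poisson ?z t * \<bar>v (cis t) - v (cis \<theta>)\<bar> \<le> e / (4 * M) * (2 * M)"
        using p e M(1) poisson_bounds(1)[OF z, of t] by (intro mult_mono) auto
      also have "\<dots> = e / 2" using M(1) by simp
      also have "\<dots> \<le> poisson ?z t * (e/2) + e/2" using poisson_bounds(1)[OF z, of t] e by simp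
      finally show ?thesis .
    qed
    have iv: "integrable circ (\<lambda>t. v (cis t))" by (rule continuous_circ(1)[OF vm])
    have ip: "integrable circ (\<lambda>t. poisson ?z t * c)" for c by (rule integrable_poisson_mult[OF _ z]) simp
    have id: "integrable circ (\<lambda>t. poisson ?z t * (v (cis t) - v (cis \<theta>)))"
      by (rule integrable_poisson_mult[OF _ z]) (use iv in simp)
    have "(LINT t|circ. poisson ?z t * v (cis t)) - v (cis \<theta>) = (LINT t|circ. poisson ?z t * v (cis t)) - (LINT t|circ. poisson ?z t * v (cis \<theta>))"
      using integral_poisson[OF z] by simp
    also have "\<dots> = (LINT t|circ. poisson ?z t * (v (cis t) - v (cis \<theta>)))"
      unfolding right_diff_distrib by (rule Bochner_Integration.integral_diff[symmetric]) (intro integrable_poisson_mult[OF iv z] ip)+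
    finally have "\<bar>(LINT t|circ. poisson ?z t * v (cis t)) - v (cis \<theta>)\<bar> \<le> (LINT t|circ. \<bar>poisson ?z t * (v (cis t) - v (cis \<theta>))\<bar>)"
      using integral_abs_bound by metis
    also have "\<dots> \<le> (LINT t|circ. poisson ?z t * (e/2) + e/2)"
    proof (rule integral_mono)
      show "integrable circ (\<lambda>t. \<bar>poisson ?z t * (v (cis t) - v (cis \<theta>))\<bar>)" using id by simp
      show "integrable circ (\<lambda>t. poisson ?z t * (e/2) + e/2)" using ip by simp
      show "\<bar>poisson ?z t * (v (cis t) - v (cis \<theta>))\<bar> \<le> poisson ?z t * (e/2) + e/2" for t
        using pt[of t] poisson_bounds(1)[OF z, of t] by (simp add: abs_mult)
    qed
    also have "\<dots> = (LINT t|circ. poisson ?z t * (e/2)) + e/2"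
      using ip by (subst Bochner_Integration.integral_add) auto
    also have "\<dots> = e" using integral_poisson[OF z] by simp
    finally show ?thesis .
  qed
  then show ?thesis using r0 by blast
qed

text \<open>The integral of \<open>u\<close> against \<open>(cis t + z) / (cis t - z)\<close>,
  written through the Cauchy kernel so that analyticity is inherited from the Riesz projection. Its
  real part is the Poisson integral.\<close>

definition herglotz :: "(real \<Rightarrow> real) \<Rightarrow> complex \<Rightarrow> complex" where
  "herglotz u z = 2 * riesz_disc (\<lambda>t. complex_of_real (u t)) z - complex_of_real (LINT t|circ. u t)"

lemma herglotz_holomorphic: "integrable circ u \<Longrightarrow> herglotz u holomorphic_on ball 0 1"
  unfolding herglotz_def[abs_def] by (intro holomorphic_intros riesz_disc_holomorphic) auto

lemma Re_herglotz: "integrable circ u \<Longrightarrow> cmod z < 1 \<Longrightarrow> Re (herglotz u z) = poisson_int u z"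
  unfolding herglotz_def by (simp add: Re_riesz_disc field_simps)

lemma rseq_mult_tendsto:
  assumes "b holomorphic_on ball 0 1" "cmod z < 1"
  shows "(\<lambda>n. b (of_real (rseq n) * z)) \<longlonglongrightarrow> b z"
proof -
  have "isCont b z" using holomorphic_on_imp_continuous_on[OF assms(1)] assms(2) by (simp add: continuous_on_eq_continuous_at)
  moreover have "(\<lambda>n. of_real (rseq n) * z) \<longlonglongrightarrow> z"
    using tendsto_mult[OF tendsto_of_real[OF rseq_LIMSEQ] tendsto_const, of z] by simp
  ultimately show ?thesis by (rule isCont_tendsto_compose)
qed

text \<open>As q may have zeros, the majorant is approximated on the circle by the real part of a function
  analytic across it, and the maximum principle is used.\<close>

lemma log_subharmonic_closed:
  assumes q: "q holomorphic_on S" "open S" "cball 0 1 \<subseteq> S" and \<delta>: "0 < \<delta>" and z: "cmod z < 1" and qz: "q z \<noteq> 0"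
  shows "ln (cmod (q z)) \<le> (LINT t|circ. poisson z t * ln (max (cmod (q (cis t))) \<delta>))"
proof (rule field_le_epsilon)
  fix e :: real assume e: "0 < e"
  \<comment> \<open>Truncation at \<open>\<delta>\<close> keeps the majorant continuous at zeros of
    \<open>q\<close> on the circle.\<close>
  define v where "v = (\<lambda>w. ln (max (cmod (q w)) \<delta>))"
  have cq: "continuous_on (cball 0 1) q"
    using holomorphic_on_imp_continuous_on[OF q(1)] q(3) continuous_on_subset by blast
  have pos: "0 < max (cmod (q w)) \<delta>" for w using \<delta> by (simp add: less_max_iff_disj)
  have cv: "continuous_on (sphere 0 1) v" unfolding v_def
    using pos by (intro continuous_intros continuous_on_subset[OF cq]) (auto simp: less_le)
  define u where "u = (\<lambda>t. v (cis t))"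
  have iu: "integrable circ u" unfolding u_def
    by (intro continuous_circ continuous_on_compose2[OF cv]) (auto intro!: continuous_intros)
  obtain r0 where r0: "r0 < 1" "0 \<le> r0" "\<And>r \<theta>. r \<in> {r0..<1} \<Longrightarrow>
      \<bar>(LINT t|circ. poisson (polar r \<theta>) t * v (cis t)) - v (cis \<theta>)\<bar> \<le> e"
    using poisson_uniform[OF cv e] by auto
  have main: "ln (cmod (q z)) \<le> Re (herglotz u (of_real r * z)) + e" if r: "r \<in> {r0..<1}" for r
  proof -
    have r': "0 \<le> r" "r < 1" using r r0 by auto
    obtain S' where S': "(\<lambda>z. herglotz u (of_real r * z)) holomorphic_on S'" "open S'" "cball 0 1 \<subseteq> S'"
      using holomorphic_dilate[OF herglotz_holomorphic[OF iu] r'] .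
    define f where "f = (\<lambda>w. q w * exp (- herglotz u (of_real r * w)))"
    have f: "f holomorphic_on cball 0 1" unfolding f_def
      by (intro holomorphic_intros holomorphic_on_subset[OF q(1)] holomorphic_on_subset[OF S'(1)] q S')
    have "cmod (f z) \<le> exp e"
    proof (rule maximum_modulus_frontier[of f "cball 0 1"])
      show "f holomorphic_on interior (cball 0 1)" using f holomorphic_on_subset by force
      show "continuous_on (closure (cball 0 1)) f" using f by (simp add: holomorphic_on_imp_continuous_on)
      fix w :: complex assume "w \<in> frontier (cball 0 1)"
      then have w1: "cmod w = 1" by simp
      define \<theta> where "\<theta> = Arg w"
      have \<theta>: "w = cis \<theta>" using rcis_cmod_Arg[of w] w1 by (simp add: rcis_def \<theta>_def)
      have "Re (herglotz u (of_real r * w)) = (LINT t|circ. poisson (polar r \<theta>) t * v (cis t))"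
        unfolding \<theta> using r' by (subst Re_herglotz[OF iu]) (auto simp: norm_mult u_def)
      then have "v w - e \<le> Re (herglotz u (of_real r * w))" using r0(3)[OF r, of \<theta>] unfolding \<theta> by linarith
      \<comment> \<open>On the circle the real part of the dilated Herglotz integral is uniformly
        within \<open>e\<close> of \<open>v\<close>, and \<open>exp (v w)\<close> dominates
        \<open>cmod (q w)\<close>.\<close>
      then have "cmod (q w) * exp (- Re (herglotz u (of_real r * w))) \<le> exp (v w) * exp (e - v w)"
        using pos[of w] by (intro mult_mono) (auto simp: v_def)
      then show "cmod (f w) \<le> exp e" unfolding f_def by (simp add: norm_mult exp_diff)
    qed (use z in auto)
    then have "cmod (q z) * exp (- Re (herglotz u (of_real r * z))) \<le> exp e" unfolding f_def by (simp add: norm_mult)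
    then have "cmod (q z) \<le> exp (Re (herglotz u (of_real r * z)) + e)"
      by (simp add: exp_minus exp_add field_simps)
    then have "ln (cmod (q z)) \<le> ln (exp (Re (herglotz u (of_real r * z)) + e))" using qz by (intro ln_mono) auto
    then show ?thesis by simp
  qed
  have "(\<lambda>n. Re (herglotz u (of_real (rseq n) * z)) + e) \<longlonglongrightarrow> Re (herglotz u z) + e"
    by (intro tendsto_intros rseq_mult_tendsto[OF herglotz_holomorphic[OF iu] z])
  moreover have "\<exists>N. \<forall>n\<ge>N. ln (cmod (q z)) \<le> Re (herglotz u (of_real (rseq n) * z)) + e"
  proof -
    have "eventually (\<lambda>n. r0 < rseq n) sequentially" using rseq_LIMSEQ r0 by (intro order_tendstoD)
    then obtain N where "\<forall>n\<ge>N. r0 < rseq n" unfolding eventually_sequentially ..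
    then show ?thesis using rseq(2) main by (intro exI[of _ N]) (auto intro: less_imp_le)
  qed
  ultimately have "ln (cmod (q z)) \<le> Re (herglotz u z) + e" by (rule LIMSEQ_le_const)
  then show "ln (cmod (q z)) \<le> (LINT t|circ. poisson z t * ln (max (cmod (q (cis t))) \<delta>)) + e"
    unfolding Re_herglotz[OF iu z] unfolding u_def v_def .
qed

text \<open>A limit along a fixed sequence, so that the boundary function is measurable on the whole
  circle whatever happens at points without a limit. The full radial limit is the separate predicate
  \<open>has_rlim\<close>.\<close>

definition bdry :: "(complex \<Rightarrow> complex) \<Rightarrow> real \<Rightarrow> complex" where
  "bdry F t = lim (\<lambda>n. F (polar (rseq n) t))"

definition has_rlim :: "(complex \<Rightarrow> complex) \<Rightarrow> real \<Rightarrow> bool" where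
  "has_rlim F t \<longleftrightarrow> ((\<lambda>r. F (polar r t)) \<longlongrightarrow> bdry F t) (at_left 1)"

lemma rlimI: "((\<lambda>r. F (polar r t)) \<longlongrightarrow> l) (at_left 1) \<Longrightarrow> bdry F t = l \<and> has_rlim F t"
proof -
  assume a: "((\<lambda>r. F (polar r t)) \<longlongrightarrow> l) (at_left 1)"
  then have "(\<lambda>n. F (polar (rseq n) t)) \<longlonglongrightarrow> l" by (rule tendsto_rseq)
  then have "bdry F t = l" unfolding bdry_def by (rule limI)
  then show ?thesis using a by (simp add: has_rlim_def)
qed

lemma rlim_seq: "has_rlim F t \<Longrightarrow> (\<lambda>n. F (polar (rseq n) t)) \<longlonglongrightarrow> bdry F t"
  unfolding has_rlim_def by (rule tendsto_rseq)

lemma rlim_radial_limit: "has_rlim F t \<Longrightarrow> radial_limit F t = bdry F t"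
  unfolding has_rlim_def radial_limit_def by (rule tendsto_Lim[rotated]) simp_all

lemma measurable_bdry: "F holomorphic_on ball 0 1 \<Longrightarrow> bdry F \<in> borel_measurable circ"
  unfolding bdry_def[abs_def] by (rule borel_measurable_lim_metric) (rule measurable_dilate, auto simp: rseq)

lemma bounded_rlim:
  assumes "b holomorphic_on ball 0 1" "\<forall>z\<in>ball 0 1. cmod (b z) \<le> B"
  shows "AE t in circ. has_rlim b t" "AE t in circ. cmod (bdry b t) \<le> B"
proof -
  show 1: "AE t in circ. has_rlim b t"
    using bounded_radial_limit[OF assms] by eventually_elim (blast dest: rlimI)
  show "AE t in circ. cmod (bdry b t) \<le> B"
    using 1
  proof eventually_elim
    case (elim t)
    show ?case
      by (rule LIMSEQ_le_const2[OF tendsto_norm[OF rlim_seq[OF elim]]]) (use assms(2) rseq in \<open>auto simp: norm_mult\<close>)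
  qed
qed

text \<open>Dilates of \<open>b\<close> are analytic across the circle, so
  \<open>log_subharmonic_closed\<close> applies to them. The truncation bounds the logarithms
  uniformly, which lets the radius tend to 1 under the integral.\<close>

lemma log_subharmonic_max:
  assumes b: "b holomorphic_on ball 0 1" and B: "\<forall>z\<in>ball 0 1. cmod (b z) \<le> B"
    and \<delta>: "0 < \<delta>" and z: "cmod z < 1" and bz: "b z \<noteq> 0"
  shows "ln (cmod (b z)) \<le> (LINT t|circ. poisson z t * ln (max (cmod (bdry b t)) \<delta>))"
proof -
  define K where "K = max \<bar>ln \<delta>\<bar> \<bar>ln (max B \<delta>)\<bar>"
  have K: "\<bar>ln (max x \<delta>)\<bar> \<le> K" if "x \<le> B" for x
  proof -
    have "ln \<delta> \<le> ln (max x \<delta>)" "ln (max x \<delta>) \<le> ln (max B \<delta>)" using \<delta> that by (auto simp: less_max_iff_disj)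
    then show ?thesis unfolding K_def by linarith
  qed
  have "(\<lambda>n. LINT t|circ. poisson z t * ln (max (cmod (b (polar (rseq n) t))) \<delta>)) \<longlonglongrightarrow> (LINT t|circ. poisson z t * ln (max (cmod (bdry b t)) \<delta>))"
  proof (rule integral_dominated_convergence[where w = "\<lambda>t. poisson z t * K"])
    show "AE t in circ. (\<lambda>n. poisson z t * ln (max (cmod (b (polar (rseq n) t))) \<delta>)) \<longlonglongrightarrow> poisson z t * ln (max (cmod (bdry b t)) \<delta>)"
      using bounded_rlim(1)[OF b B]
    proof eventually_elim
      case (elim t)
      have "max (cmod (bdry b t)) \<delta> \<noteq> 0" using \<delta> by linarith
      then show ?case using rlim_seq[OF elim] by (intro tendsto_intros)
    qed
    show "AE t in circ. norm (poisson z t * ln (max (cmod (b (polar (rseq n) t))) \<delta>)) \<le> poisson z t * K" for n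
    proof (intro AE_I2)
      fix t
      have "polar (rseq n) t \<in> ball 0 1" by (rule mult_cis_in_ball[OF rseq(4,2)])
      then have "\<bar>ln (max (cmod (b (polar (rseq n) t))) \<delta>)\<bar> \<le> K" using B by (intro K) blast
      then show "norm (poisson z t * ln (max (cmod (b (polar (rseq n) t))) \<delta>)) \<le> poisson z t * K"
        using poisson_bounds(1)[OF z, of t] by (simp add: abs_mult)
    qed
    show "integrable circ (\<lambda>t. poisson z t * K)" by (rule integrable_poisson_mult[OF _ z]) simp
    show "(\<lambda>t. poisson z t * ln (max (cmod (bdry b t)) \<delta>)) \<in> borel_measurable circ"
      using measurable_bdry[OF b] measurable_poisson[OF z] by measurable
    show "(\<lambda>t. poisson z t * ln (max (cmod (b (polar (rseq n) t))) \<delta>)) \<in> borel_measurable circ" for n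
      using measurable_dilate[OF b rseq(4,2)] measurable_poisson[OF z] by measurable
  qed
  moreover have bl: "(\<lambda>n. b (of_real (rseq n) * z)) \<longlonglongrightarrow> b z" by (rule rseq_mult_tendsto[OF b z])
  then have "(\<lambda>n. ln (cmod (b (of_real (rseq n) * z)))) \<longlonglongrightarrow> ln (cmod (b z))"
    using bz by (intro tendsto_intros) auto
  moreover have "eventually (\<lambda>n. b (of_real (rseq n) * z) \<noteq> 0) sequentially"
    using bl bz by (rule tendsto_imp_eventually_ne)
  then have "eventually (\<lambda>n. ln (cmod (b (of_real (rseq n) * z))) \<le> (LINT t|circ. poisson z t * ln (max (cmod (b (polar (rseq n) t))) \<delta>))) sequentially"
  proof eventually_elim
    case (elim n)
    obtain S where S: "(\<lambda>z. b (complex_of_real (rseq n) * z)) holomorphic_on S" "open S" "cball 0 1 \<subseteq> S"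
      using holomorphic_dilate[OF b rseq(4,2)] .
    show ?case by (rule log_subharmonic_closed[OF S \<delta> z elim])
  qed
  ultimately show ?thesis
    by (rule tendsto_le[OF sequentially_bot])
qed

text \<open>Removes the truncation. A single point \<open>z1\<close> with
  \<open>b z1 \<noteq> 0\<close> bounds the means of the nonnegative functions
  \<open>ln B' - L n\<close> uniformly. By Fatou's lemma the untruncated logarithm is then
  integrable, and the boundary values vanish only on a null set.\<close>

lemma log_subharmonic:
  assumes b: "b holomorphic_on ball 0 1" and B: "\<forall>z\<in>ball 0 1. cmod (b z) \<le> B"
    and z1: "cmod z1 < 1" "b z1 \<noteq> 0"
  shows "AE t in circ. bdry b t \<noteq> 0" "integrable circ (\<lambda>t. ln (cmod (bdry b t)))"
    "\<And>z. cmod z < 1 \<Longrightarrow> b z \<noteq> 0 \<Longrightarrow> ln (cmod (b z)) \<le> (LINT t|circ. poisson z t * ln (cmod (bdry b t)))"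
proof -
  \<comment> \<open>The maximum with 1 makes \<open>ln B'\<close> meaningful and keeps every
    truncation level \<open>\<delta> n \<le> 1\<close> below \<open>B'\<close>, so that
    \<open>u n\<close> is nonnegative.\<close>
  define B' where "B' = max B 1"
  define \<delta> where "\<delta> = (\<lambda>n::nat. inverse (real (Suc n)))"
  have \<delta>: "0 < \<delta> n" "\<delta> n \<le> 1" "\<delta> n \<le> B'" for n
  proof -
    show "0 < \<delta> n" "\<delta> n \<le> 1" by (auto simp: \<delta>_def field_simps)
    then show "\<delta> n \<le> B'" by (auto simp: B'_def)
  qed
  have \<delta>0: "\<delta> \<longlonglongrightarrow> 0" unfolding \<delta>_def by (rule LIMSEQ_inverse_real_of_nat)
  define L where "L = (\<lambda>n t. ln (max (cmod (bdry b t)) (\<delta> n)))"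
  define u where "u = (\<lambda>n t. ln B' - L n t)"
  have bB: "AE t in circ. cmod (bdry b t) \<le> B'"
    using bounded_rlim(2)[OF b B] by eventually_elim (auto simp: B'_def)
  have mx: "0 < max x (\<delta> n)" for x n using \<delta>(1)[of n] by linarith
  have u0: "0 \<le> u n t" if "cmod (bdry b t) \<le> B'" for n t
  proof -
    have "ln (max (cmod (bdry b t)) (\<delta> n)) \<le> ln B'" using that \<delta>(3)[of n] mx by (intro ln_mono) auto
    then show ?thesis by (simp add: u_def L_def)
  qed
  have Lm [measurable]: "L n \<in> borel_measurable circ" for n
    unfolding L_def using measurable_bdry[OF b] by measurable
  have um [measurable]: "u n \<in> borel_measurable circ" for n unfolding u_def by measurable
  have Lb: "AE t in circ. norm (L n t) \<le> \<bar>ln B'\<bar> + \<bar>ln (\<delta> n)\<bar>" for n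
    using bB
  proof eventually_elim
    case (elim t)
    have "ln (\<delta> n) \<le> L n t" unfolding L_def using \<delta>(1)[of n] mx by (simp add: ln_le_cancel_iff)
    then show ?case using u0[OF elim, of n] unfolding u_def by auto
  qed
  have Li: "integrable circ (L n)" for n by (rule integrable_circ_bounded[OF Lm Lb])
  have ui: "integrable circ (u n)" for n unfolding u_def using Li by simp
  \<comment> \<open>Harnack's lower bound for the kernel at \<open>z1\<close>: it passes from the
    Poisson integral, which \<open>log_subharmonic_max\<close> controls, to the plain mean.\<close>
  define c where "c = (1 - cmod z1) / (1 + cmod z1)"
  have c: "0 < c" using z1 by (auto simp: c_def intro!: divide_pos_pos add_pos_nonneg)
  define C where "C = (ln B' - ln (cmod (b z1))) / c"
  have iu: "(LINT t|circ. u n t) \<le> C" for n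
  proof -
    have "c * (LINT t|circ. u n t) = (LINT t|circ. c * u n t)" by simp
    also have "\<dots> \<le> (LINT t|circ. poisson z1 t * u n t)"
    proof (rule integral_mono_AE)
      show "AE t in circ. c * u n t \<le> poisson z1 t * u n t"
        using bB
      proof eventually_elim
        case (elim t)
        show ?case unfolding c_def by (rule mult_right_mono[OF poisson_bounds(2)[OF z1(1)] u0[OF elim]])
      qed
    qed (use ui integrable_poisson_mult[OF ui z1(1)] in auto)
    also have "\<dots> = (LINT t|circ. poisson z1 t * ln B') - (LINT t|circ. poisson z1 t * L n t)"
      unfolding u_def right_diff_distrib
      by (rule Bochner_Integration.integral_diff; rule integrable_poisson_mult[OF _ z1(1)]) (use Li in auto)
    also have "\<dots> \<le> ln B' - ln (cmod (b z1))"
      using log_subharmonic_max[OF b B \<delta>(1) z1, of n] integral_poisson[OF z1(1)] unfolding L_def by simp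
    finally show ?thesis using c unfolding C_def by (simp add: field_simps)
  qed
  \<comment> \<open>Where \<open>bdry b\<close> is 0 this is infinite, elsewhere it is
    \<open>ln B' - ln (cmod (bdry b t))\<close>. Finiteness of its integral thus yields both
    nonvanishing and integrability.\<close>
  define U where "U = (\<lambda>t. liminf (\<lambda>n. ennreal (u n t)))"
  have Um [measurable]: "U \<in> borel_measurable circ" unfolding U_def by measurable
  have "(\<integral>\<^sup>+t. U t \<partial>circ) \<le> liminf (\<lambda>n. \<integral>\<^sup>+t. ennreal (u n t) \<partial>circ)"
    unfolding U_def by (rule nn_integral_liminf) measurable
  also have "\<dots> \<le> liminf (\<lambda>n. ennreal C)"
  proof (intro Liminf_mono always_eventually allI)
    fix n
    have "(\<integral>\<^sup>+t. ennreal (u n t) \<partial>circ) = ennreal (LINT t|circ. u n t)"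
      by (rule nn_integral_eq_integral[OF ui]) (use bB u0 in auto)
    then show "(\<integral>\<^sup>+t. ennreal (u n t) \<partial>circ) \<le> ennreal C" using iu[of n] by (simp add: ennreal_leI)
  qed
  also have "\<dots> = ennreal C" by (rule Liminf_const) simp
  finally have Ufin: "(\<integral>\<^sup>+t. U t \<partial>circ) \<le> ennreal C" .
  then have "(\<integral>\<^sup>+t. U t \<partial>circ) \<noteq> \<infinity>" by (auto simp: top_unique)
  then have Uae: "AE t in circ. U t \<noteq> \<infinity>" by (rule nn_integral_PInf_AE[OF Um])
  have lim: "(\<lambda>n. L n t) \<longlonglongrightarrow> ln (cmod (bdry b t))" if "bdry b t \<noteq> 0" for t
  proof -
    have "(\<lambda>n. max (cmod (bdry b t)) (\<delta> n)) \<longlonglongrightarrow> max (cmod (bdry b t)) 0" by (intro tendsto_intros \<delta>0)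
    then show ?thesis unfolding L_def using that by (intro tendsto_intros) auto
  qed
  show nz: "AE t in circ. bdry b t \<noteq> 0"
    using Uae
  proof eventually_elim
    case (elim t)
    show ?case
    proof
      assume 0: "bdry b t = 0"
      have "u n t = ln B' + ln (real (Suc n))" for n
        unfolding u_def L_def 0 using \<delta>(1)[of n] by (simp add: \<delta>_def ln_inverse max_def)
      moreover have "filterlim (\<lambda>n. ln B' + ln (real (Suc n))) at_top sequentially"
        by (intro filterlim_tendsto_add_at_top[OF tendsto_const] filterlim_compose[OF ln_at_top]
            filterlim_compose[OF filterlim_real_sequentially filterlim_Suc])
      ultimately have "filterlim (\<lambda>n. u n t) at_top sequentially" by simp
      then have "(\<lambda>n. ennreal (u n t)) \<longlonglongrightarrow> \<infinity>" by (simp add: ennreal_tendsto_top_eq_at_top)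
      then have "U t = \<infinity>" unfolding U_def by (intro lim_imp_Liminf) auto
      then show False using elim by simp
    qed
  qed
  have Ueq: "U t = ennreal (ln B' - ln (cmod (bdry b t)))" if "bdry b t \<noteq> 0" for t
  proof -
    have "(\<lambda>n. ennreal (u n t)) \<longlonglongrightarrow> ennreal (ln B' - ln (cmod (bdry b t)))"
      unfolding u_def by (intro tendsto_intros lim that)
    then show ?thesis unfolding U_def by (intro lim_imp_Liminf) auto
  qed
  have lm [measurable]: "(\<lambda>t. ln (cmod (bdry b t))) \<in> borel_measurable circ"
    using measurable_bdry[OF b] by measurable
  have "integrable circ (\<lambda>t. ln B' - ln (cmod (bdry b t)))"
  proof (rule integrableI_nonneg)
    show "AE t in circ. 0 \<le> ln B' - ln (cmod (bdry b t))"
      using nz bB by eventually_elim (auto simp: ln_le_cancel_iff B'_def)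
    have "(\<integral>\<^sup>+t. ennreal (ln B' - ln (cmod (bdry b t))) \<partial>circ) = (\<integral>\<^sup>+t. U t \<partial>circ)"
      by (rule nn_integral_cong_AE) (use nz Ueq in auto)
    also have "\<dots> < \<infinity>" using Ufin by (simp add: le_less_trans less_top)
    finally show "(\<integral>\<^sup>+t. ennreal (ln B' - ln (cmod (bdry b t))) \<partial>circ) < \<infinity>" .
  qed measurable
  then have "integrable circ (\<lambda>t. ln B' - (ln B' - ln (cmod (bdry b t))))"
    by (rule Bochner_Integration.integrable_diff[rotated]) simp
  then show I: "integrable circ (\<lambda>t. ln (cmod (bdry b t)))" by (simp only: diff_diff_eq2 add_diff_cancel_left')
  fix z :: complex assume z: "cmod z < 1" "b z \<noteq> 0"
  have "(\<lambda>n. LINT t|circ. poisson z t * L n t) \<longlonglongrightarrow> (LINT t|circ. poisson z t * ln (cmod (bdry b t)))"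
  proof (rule integral_dominated_convergence[where w = "\<lambda>t. poisson z t * (2 * \<bar>ln B'\<bar> + \<bar>ln (cmod (bdry b t))\<bar>)"])
    show "integrable circ (\<lambda>t. poisson z t * (2 * \<bar>ln B'\<bar> + \<bar>ln (cmod (bdry b t))\<bar>))"
      using I by (intro integrable_poisson_mult[OF _ z(1)]) auto
    show "AE t in circ. (\<lambda>n. poisson z t * L n t) \<longlonglongrightarrow> poisson z t * ln (cmod (bdry b t))"
      using nz by eventually_elim (intro tendsto_intros lim)
    show "AE t in circ. norm (poisson z t * L n t) \<le> poisson z t * (2 * \<bar>ln B'\<bar> + \<bar>ln (cmod (bdry b t))\<bar>)" for n
      using nz bB
    proof eventually_elim
      case (elim t)
      have "ln (cmod (bdry b t)) \<le> L n t" unfolding L_def using elim mx by (simp add: ln_le_cancel_iff)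
      then have "\<bar>L n t\<bar> \<le> 2 * \<bar>ln B'\<bar> + \<bar>ln (cmod (bdry b t))\<bar>" using u0[OF elim(2), of n] unfolding u_def by linarith
      then show ?case using poisson_bounds(1)[OF z(1), of t] by (simp add: abs_mult)
    qed
  qed (use measurable_poisson[OF z(1)] in measurable)
  then show "ln (cmod (b z)) \<le> (LINT t|circ. poisson z t * ln (cmod (bdry b t)))"
    by (rule LIMSEQ_le_const) (use log_subharmonic_max[OF b B \<delta>(1) z] in \<open>auto simp: L_def\<close>)
qed

section \<open>Radial limits of Poisson integrals\<close>

text \<open>For \<open>u \<ge> 0\<close> the function \<open>exp (- herglotz u)\<close> is bounded
  by 1 and its modulus is \<open>exp\<close> of minus the Poisson integral. Its radial limits
  therefore give those of the Poisson integral, even for unbounded \<open>u\<close>, before they are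
  identified with \<open>u\<close>.\<close>

definition poisson_limit :: "(real \<Rightarrow> real) \<Rightarrow> real \<Rightarrow> real" where
  "poisson_limit u t = - ln (cmod (bdry (\<lambda>z. exp (- herglotz u z)) t))"

lemma poisson_integral_nonneg:
  assumes "\<And>t. 0 \<le> u t" "cmod z < 1"
  shows "0 \<le> poisson_int u z"
  by (intro Bochner_Integration.integral_nonneg mult_nonneg_nonneg less_imp_le[OF poisson_bounds(1)[OF assms(2)]] assms(1))

lemma poisson_limit_tendsto:
  assumes u: "integrable circ u" and u0: "\<And>t. 0 \<le> u t"
  shows "AE s in circ. ((\<lambda>r. poisson_int u (polar r s)) \<longlongrightarrow> poisson_limit u s) (at_left 1)"
    and "poisson_limit u \<in> borel_measurable circ"
proof -
  let ?E = "\<lambda>z. exp (- herglotz u z)"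
  have h: "?E holomorphic_on ball 0 1" by (intro holomorphic_intros herglotz_holomorphic u)
  have n: "cmod (?E z) = exp (- poisson_int u z)" if "cmod z < 1" for z
    using Re_herglotz[OF u that] by simp
  have B: "\<forall>z\<in>ball 0 1. cmod (?E z) \<le> 1"
    using n poisson_integral_nonneg[OF u0] by simp
  have nz: "AE t in circ. bdry ?E t \<noteq> 0"
    by (rule log_subharmonic(1)[OF h B, of 0]) auto
  show "AE s in circ. ((\<lambda>r. poisson_int u (polar r s)) \<longlongrightarrow> poisson_limit u s) (at_left 1)"
    using nz bounded_rlim(1)[OF h B]
  proof eventually_elim
    case (elim s)
    have "((\<lambda>r. - ln (cmod (?E (polar r s)))) \<longlongrightarrow> poisson_limit u s) (at_left 1)"
      unfolding poisson_limit_def using elim unfolding has_rlim_def by (intro tendsto_intros) auto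
    then show ?case
    proof (rule tendsto_at_left_1_cong)
      fix r :: real assume "0 < r" "r < 1"
      then have "cmod (polar r s) < 1" by (simp add: norm_mult)
      from n[OF this] show "- ln (cmod (?E (polar r s))) = poisson_int u (polar r s)" by simp
    qed
  qed
  show "poisson_limit u \<in> borel_measurable circ"
    unfolding poisson_limit_def[abs_def] using measurable_bdry[OF h] by measurable
qed

lemma poisson_integral_bounded:
  assumes u: "integrable circ u" and K: "\<And>t. \<bar>u t\<bar> \<le> K" and z: "cmod z < 1"
  shows "\<bar>poisson_int u z\<bar> \<le> K"
proof -
  have "\<bar>poisson_int u z\<bar> \<le> (LINT t|circ. \<bar>poisson z t * u t\<bar>)" by (rule integral_abs_bound)
  also have "\<dots> \<le> (LINT t|circ. poisson z t * K)"
    by (intro integral_mono integrable_abs integrable_poisson_mult[OF _ z] u)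
      (auto simp: abs_mult K poisson_bounds(1)[OF z] less_imp_le)
  also have "\<dots> = K" using integral_poisson[OF z] by simp
  finally show ?thesis .
qed

lemma poisson_limit_seq:
  assumes "integrable circ u" "\<And>t. 0 \<le> u t"
  shows "AE s in circ. (\<lambda>n. poisson_int u (polar (rseq n) s)) \<longlonglongrightarrow> poisson_limit u s"
  using poisson_limit_tendsto(1)[OF assms] by eventually_elim (rule tendsto_rseq)

lemma poisson_integral_mean:
  assumes u: "integrable circ u" and r: "0 \<le> r" "r < 1"
  shows "integrable circ (\<lambda>s. poisson_int u (polar r s))"
    and "(LINT s|circ. (poisson_int u (polar r s))) = (LINT t|circ. u t)"
proof -
  have e: "poisson_int u (polar r s) = Re (herglotz u (polar r s))" for s
    using Re_herglotz[OF u, of "polar r s"] r by (simp add: norm_mult)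
  have i: "integrable circ (\<lambda>s. herglotz u (polar r s))" by (rule integrable_dilate[OF herglotz_holomorphic[OF u] r])
  then show "integrable circ (\<lambda>s. poisson_int u (polar r s))" unfolding e by simp
  have "(LINT s|circ. Re (herglotz u (polar r s))) = Re (herglotz u 0)"
    unfolding mean_value_dilate[OF herglotz_holomorphic[OF u] r] using i by simp
  then show "(LINT s|circ. (poisson_int u (polar r s))) = (LINT t|circ. u t)"
    unfolding e using Re_herglotz[OF u, of 0] by simp
qed

text \<open>Up to the product of the means, both sides are twice the real part of a pairing of two
  Riesz projections, and exchanging the functions conjugates that pairing. The lemma moves the
  Poisson integral from a rough function onto a continuous test function.\<close>

lemma poisson_self_adjoint:
  assumes u: "integrable circ u" and v: "integrable circ v" and r: "0 \<le> r" "r < 1"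
  shows "(LINT s|circ. u s * poisson_int v (polar r s)) = (LINT s|circ. v s * poisson_int u (polar r s))"
proof -
  let ?R = "\<lambda>u. riesz_disc (\<lambda>t. complex_of_real (u t))"
  \<comment> \<open>\<open>riesz_pairing\<close> at radius \<open>q\<close> evaluates the test
    function at radius \<open>q\<^sup>2 = r\<close>.\<close>
  define q where "q = sqrt r"
  have q: "0 \<le> q" "q < 1" "q\<^sup>2 = r" using r by (auto simp: q_def)
  have cu: "integrable circ (\<lambda>t. complex_of_real (u t))" and cv: "integrable circ (\<lambda>t. complex_of_real (v t))" using u v by auto
  have bd: "\<exists>B. \<forall>t. cmod (h (polar r t)) \<le> B" if "h holomorphic_on ball 0 1" for h
  proof -
    have "compact (h ` cball 0 r)"
      by (intro compact_continuous_image holomorphic_on_imp_continuous_on holomorphic_on_subset[OF that]) (use r in auto)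
    then have "bounded (h ` cball 0 r)" by (rule compact_imp_bounded)
    then obtain B where "\<forall>x\<in>h ` cball 0 r. cmod x \<le> B"
      unfolding bounded_iff ..
    then have B: "cmod (h w) \<le> B" if "w \<in> cball 0 r" for w using that by blast
    have "cmod (h (polar r t)) \<le> B" for t
      by (rule B) (use r in \<open>simp add: norm_mult\<close>)
    then show ?thesis by blast
  qed
  have int: "integrable circ (\<lambda>t. x t * y t)" if "integrable circ x" "integrable circ y" "\<exists>B. \<forall>t. cmod (y t) \<le> B" for x y :: "real \<Rightarrow> complex"
    using that integrable_circ_mult_bounded[OF that(1), of y] by auto
  have *: "(LINT s|circ. u s * Re (?R v (polar r s))) = Re (LINT s|circ. complex_of_real (u s) * cnj (?R v (polar r s)))"
    if "integrable circ (\<lambda>t. complex_of_real (u t))" "integrable circ (\<lambda>t. complex_of_real (v t))" for u v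
  proof -
    have "integrable circ (\<lambda>s. complex_of_real (u s) * cnj (?R v (polar r s)))"
      using bd[OF riesz_disc_holomorphic[OF that(2)]] integrable_dilate[OF riesz_disc_holomorphic[OF that(2)] r]
      by (intro int[OF that(1)]) auto
    then have "Re (LINT s|circ. complex_of_real (u s) * cnj (?R v (polar r s))) = (LINT s|circ. Re (complex_of_real (u s) * cnj (?R v (polar r s))))"
      by (rule integral_Re[symmetric])
    then show ?thesis by simp
  qed
  have "(LINT s|circ. complex_of_real (u s) * cnj (?R v (polar r s))) = (LINT t|circ. ?R u (polar q t) * cnj (?R v (polar q t)))"
    using riesz_pairing[OF cu riesz_disc_holomorphic[OF cv] q(1,2)] unfolding q(3) .
  also have "\<dots> = (LINT t|circ. cnj (?R v (polar q t) * cnj (?R u (polar q t))))"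
    by (rule arg_cong[where f = "integral\<^sup>L circ"]) (simp add: fun_eq_iff mult.commute)
  also have "\<dots> = cnj (LINT t|circ. ?R v (polar q t) * cnj (?R u (polar q t)))" by (rule Bochner_Integration.integral_cnj)
  also have "\<dots> = cnj (LINT s|circ. complex_of_real (v s) * cnj (?R u (polar r s)))"
    using riesz_pairing[OF cv riesz_disc_holomorphic[OF cu] q(1,2)] unfolding q(3) by simp
  finally have main: "(LINT s|circ. u s * Re (?R v (polar r s))) = (LINT s|circ. v s * Re (?R u (polar r s)))"
    unfolding *[OF cu cv] *[OF cv cu] by simp
  have **: "(LINT s|circ. u s * poisson_int v (polar r s)) = 2 * (LINT s|circ. u s * Re (?R v (polar r s))) - (LINT s|circ. u s) * (LINT s|circ. v s)"
    if "integrable circ u" "integrable circ v" for u v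
  proof -
    have e: "poisson_int v (polar r s) = 2 * Re (?R v (polar r s)) - (LINT t|circ. v t)" for s
      using Re_riesz_disc[OF that(2), of "polar r s"] r by (simp add: norm_mult)
    have hv: "?R v holomorphic_on ball 0 1" using that by (intro riesz_disc_holomorphic) auto
    obtain B where B: "\<forall>t. cmod (?R v (polar r t)) \<le> B" using bd[OF hv] by auto
    have "integrable circ (\<lambda>s. u s * Re (?R v (polar r s)))"
      by (rule integrable_circ_mult_bounded[OF that(1), of _ B])
        (use B integrable_dilate[OF hv r] abs_Re_le_cmod order_trans in \<open>auto intro!: AE_I2, blast\<close>)
    then have "(LINT s|circ. 2 * (u s * Re (?R v (polar r s))) - u s * (LINT s|circ. v s))
        = 2 * (LINT s|circ. u s * Re (?R v (polar r s))) - (LINT s|circ. u s) * (LINT s|circ. v s)"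
      using that by (subst Bochner_Integration.integral_diff) auto
    then show ?thesis unfolding e by (simp only: right_diff_distrib mult.left_commute[of _ 2])
  qed
  show ?thesis unfolding **[OF u v] **[OF v u] main by (simp add: mult.commute)
qed

section \<open>Identifying the radial limits with the original function\<close>

lemma measurable_circ_indicator:
  "A \<in> sets lebesgue \<Longrightarrow> (indicator A :: real \<Rightarrow> real) \<in> borel_measurable circ"
  unfolding measurable_circ_iff by (intro measurable_restrict_space1 borel_measurable_indicator)

text \<open>Continuous functions on the circle approximate indicators of open subsets of the open
  parameter interval; outer regularity extends the vanishing of the integrals to all measurable
  sets, and \<open>x\<close> is a density whose integrals all vanish.\<close>

lemma circ_eq_0_if_orthogonal:
  assumes x [measurable]: "x \<in> borel_measurable circ" and xb: "AE t in circ. \<bar>x t\<bar> \<le> C" and C: "0 \<le> C"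
    and orth: "\<And>v :: complex \<Rightarrow> real. continuous_on UNIV v \<Longrightarrow> (LINT t|circ. x t * v (cis t)) = 0"
  shows "AE t in circ. x t = (0::real)"
proof -
  have ix: "integrable circ x" by (rule integrable_circ_bounded[OF x, of C]) (use xb in auto)
  have mx: "(\<lambda>t. x t * indicator A t) \<in> borel_measurable circ" if "A \<in> sets lebesgue" for A
    using measurable_circ_indicator[OF that] by measurable
  have opn: "(LINT t|circ. x t * indicator J t) = 0" if J: "open J" "J \<subseteq> {0<..<2*pi}" for J
  proof -
    \<comment> \<open>Since \<open>J\<close> avoids both endpoints, \<open>cis\<close> identifies no
      point of \<open>J\<close> with a point outside it. The indicator of \<open>J\<close> is thus
      the pointwise limit of \<open>min 1 (k * infdist w K)\<close> at
      \<open>w = cis t\<close>.\<close>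
    define K where "K = cis ` ({0..2*pi} - J)"
    have K: "compact K" "K \<noteq> {}"
      unfolding K_def using J by (auto intro!: compact_continuous_image compact_diff continuous_intros)
         (metis Diff_iff atLeastAtMost_iff greaterThanLessThan_iff less_irrefl order_refl pi_ge_zero subsetD zero_le_mult_iff zero_le_numeral)
    have inK: "cis t \<in> K \<longleftrightarrow> t \<notin> J" if t: "t \<in> {0..2*pi}" for t
    proof
      assume "cis t \<in> K"
      then obtain s where s: "cis t = cis s" "s \<in> {0..2*pi}" "s \<notin> J" by (auto simp: K_def)
      show "t \<notin> J"
      proof
        assume "t \<in> J"
        then have tt: "0 < t" "t < 2*pi" using J by auto
        have "sin t = sin s" "cos t = cos s" using s(1) by (simp_all add: cis.code)
        then obtain n where n: "t = s + 2 * pi * of_int n" using sin_cos_eq_iff[of t s] by auto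
        then have "\<bar>2 * pi * of_int n\<bar> < 2 * pi * 1" using tt s(2) by auto
        then have "\<bar>of_int n\<bar> < (1::real)" unfolding abs_mult using pi_gt_zero by (simp del: pi_gt_zero)
        then have "n = 0" by linarith
        then show False using n s \<open>t \<in> J\<close> by simp
      qed
    qed (use t in \<open>auto simp: K_def\<close>)
    define v where "v = (\<lambda>k w. min 1 (real k * infdist w K))"
    have cv: "continuous_on UNIV (v k)" for k unfolding v_def
      by (intro continuous_intros)
    have vb: "0 \<le> v k w" "v k w \<le> 1" for k w by (auto simp: v_def infdist_nonneg)
    have "(\<lambda>k. LINT t|circ. x t * v k (cis t)) \<longlonglongrightarrow> (LINT t|circ. x t * indicator J t)"
    proof (rule integral_dominated_convergence[where w = "\<lambda>t. \<bar>x t\<bar>"])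
      show "AE t in circ. (\<lambda>k. x t * v k (cis t)) \<longlonglongrightarrow> x t * indicator J t"
      proof (rule AE_I2)
        fix t assume "t \<in> space circ"
        then have t: "t \<in> {0..2*pi}" by simp
        show "(\<lambda>k. x t * v k (cis t)) \<longlonglongrightarrow> x t * indicator J t"
        proof (cases "t \<in> J")
          case True
          then have "cis t \<notin> K" using inK t by auto
          then have "0 < infdist (cis t) K" using K by (simp add: compact_imp_closed infdist_pos_not_in_closed)
          then have "eventually (\<lambda>k. 1 < real k * infdist (cis t) K) sequentially"
            using filterlim_tendsto_pos_mult_at_top[OF tendsto_const _ filterlim_real_sequentially, of "infdist (cis t) K"]
            unfolding filterlim_at_top_dense by (simp add: mult.commute)
          then have "eventually (\<lambda>k. x t * v k (cis t) = x t * indicator J t) sequentially"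
            by eventually_elim (use True in \<open>simp add: v_def\<close>)
          then show ?thesis by (rule tendsto_eventually)
        next
          case False
          then have "cis t \<in> K" using inK t by auto
          then show ?thesis using False by (simp add: v_def)
        qed
      qed
      show "AE t in circ. norm (x t * v k (cis t)) \<le> \<bar>x t\<bar>" for k
        using vb by (auto simp: abs_mult mult_left_le)
      show "(\<lambda>t. x t * v k (cis t)) \<in> borel_measurable circ" for k
      proof -
        have "(\<lambda>t. v k (cis t)) \<in> borel_measurable circ"
          by (intro measurable_circ_continuous_on continuous_on_compose2[OF cv]) (auto intro!: continuous_intros)
        then show ?thesis by measurable
      qed
      have "J \<in> sets lebesgue" using J(1) by auto
      then show "(\<lambda>t. x t * indicator J t) \<in> borel_measurable circ" by (rule mx)
    qed (use ix in auto)
    then show ?thesis unfolding orth[OF cv] by (simp add: LIMSEQ_const_iff)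
  qed
  have I0: "AE t in circ. t \<in> {0<..<2*pi}"
    unfolding AE_circ_iff by (rule AE_I'[of "{0, 2*pi}"]) (auto intro: negligible_iff_null_sets[THEN iffD1])
  have meas: "(LINT t|circ. x t * indicator A t) = 0" if A: "A \<in> sets lebesgue" for A
  proof -
    define A' where "A' = A \<inter> {0<..<2*pi}"
    have A': "A' \<in> sets lebesgue" using A by (auto simp: A'_def)
    have "\<bar>LINT t|circ. x t * indicator A' t\<bar> \<le> e" if e: "0 < e" for e
    proof -
      \<comment> \<open>\<open>C + 1\<close> instead of \<open>C\<close> covers
        \<open>C = 0\<close>; the factor \<open>2 * pi\<close> undoes the normalisation of
        \<open>circ\<close>.\<close>
      define e' where "e' = 2 * pi * e / (C + 1)"
      have e': "0 < e'" using e C by (simp add: e'_def)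
      obtain T where T: "open T" "A' \<subseteq> T" "T - A' \<in> lmeasurable" "emeasure lebesgue (T - A') < ennreal e'"
        using sets_lebesgue_outer_open[OF A' e'] .
      define J where "J = T \<inter> {0<..<2*pi}"
      have J: "open J" "J \<subseteq> {0<..<2*pi}" "A' \<subseteq> J" using T by (auto simp: J_def A'_def)
      have Jm: "J - A' \<in> sets lebesgue" "J \<in> sets lebesgue" using J(1) A' by auto
      have m: "measure lebesgue (J - A') \<le> e'"
      proof -
        have "measure lebesgue (J - A') \<le> measure lebesgue (T - A')"
          by (rule measure_mono_fmeasurable) (use T Jm in \<open>auto simp: J_def\<close>)
        also have "\<dots> \<le> e'" using T(4) e' by (simp add: emeasure_eq_measure2 T(3) ennreal_less_iff)
        finally show ?thesis .
      qed
      have ii: "integrable circ (\<lambda>t. x t * indicator B t)" if "B \<in> sets lebesgue" for B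
        by (rule Bochner_Integration.integrable_bound[OF ix mx[OF that]]) (auto simp: indicator_def)
      have "(LINT t|circ. x t * indicator J t) = (LINT t|circ. x t * indicator A' t + x t * indicator (J - A') t)"
        using J(3) by (intro Bochner_Integration.integral_cong) (auto simp: indicator_def)
      then have "(LINT t|circ. x t * indicator A' t) = - (LINT t|circ. x t * indicator (J - A') t)"
        using opn[OF J(1,2)] ii[OF A'] ii[OF Jm(1)] by simp
      then have "\<bar>LINT t|circ. x t * indicator A' t\<bar> \<le> (LINT t|circ. \<bar>x t * indicator (J - A') t\<bar>)"
        using integral_abs_bound[of circ "\<lambda>t. x t * indicator (J - A') t"] by simp
      also have "\<dots> \<le> (LINT t|circ. C * indicator (J - A') t)"
      proof (rule integral_mono_AE)
        show "integrable circ (\<lambda>t. C * indicator (J - A') t)"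
          by (intro Bochner_Integration.integrable_mult_right integrable_circ_bounded[of _ 1]) (auto simp: indicator_le_1 measurable_circ_indicator Jm)
        show "AE t in circ. \<bar>x t * indicator (J - A') t\<bar> \<le> C * indicator (J - A') t"
          using xb by eventually_elim (auto simp: indicator_def)
      qed (use ii[OF Jm(1)] in auto)
      also have "\<dots> = C * (measure lebesgue (J - A') / (2 * pi))"
      proof -
        have "(\<lambda>t. indicator {0..2*pi} t *\<^sub>R (indicator (J - A') t :: real)) = indicator (J - A')"
          using J(2) by (auto simp: indicator_def fun_eq_iff)
        then have "(LINT t|circ. (indicator (J - A') t :: real)) = measure lebesgue (J - A') / (2 * pi)"
          unfolding integral_circ set_lebesgue_integral_def using Jm by simp
        then show ?thesis by simp
      qed
      also have "\<dots> \<le> C * (e' / (2 * pi))" using m C by (intro mult_left_mono divide_right_mono) auto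
      also have "\<dots> = C / (C + 1) * e" by (simp add: e'_def)
      also have "\<dots> \<le> 1 * e" using C e by (intro mult_right_mono) auto
      finally show ?thesis by simp
    qed
    then have "(LINT t|circ. x t * indicator A' t) = 0"
      by (metis abs_le_zero_iff field_le_epsilon add_0)
    moreover have "(LINT t|circ. x t * indicator A t) = (LINT t|circ. x t * indicator A' t)"
      by (rule integral_cong_AE) (use mx[OF A] mx[OF A'] I0 in \<open>auto simp: A'_def indicator_def\<close>)
    ultimately show ?thesis by simp
  qed
  show ?thesis
  proof (rule circ.density_zero[OF ix])
    fix A assume A: "A \<in> sets circ"
    then have "A \<in> sets lebesgue" by (simp add: sets_circ sets_restrict_space_iff)
    from meas[OF this] show "set_lebesgue_integral circ A x = 0"
      by (simp add: set_lebesgue_integral_def mult.commute)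
  qed
qed

text \<open>Test against a continuous \<open>V\<close>. By self-adjointness the pairing of
  \<open>V\<close> with the Poisson integral of \<open>u\<close> is that of \<open>u\<close> with
  the Poisson integral of \<open>V\<close>, which converges to \<open>V\<close>. So the limit
  function and \<open>u\<close> have the same pairing with every such \<open>V\<close>.\<close>

lemma poisson_limit_bounded:
  assumes m: "u \<in> borel_measurable circ" and u0: "\<And>t. 0 \<le> u t" and uM: "\<And>t. u t \<le> M"
  shows "AE t in circ. poisson_limit u t = u t"
proof -
  have u: "integrable circ u" by (rule integrable_circ_bounded[OF m, of M]) (use u0 uM in auto)
  have M: "0 \<le> M" using u0[of 0] uM[of 0] by linarith
  let ?P = "\<lambda>u r s. LINT t|circ. poisson (polar r s) t * u t"
  have z: "cmod (polar (rseq n) s) < 1" for n s using rseq by (simp add: norm_mult)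
  have Pb: "0 \<le> ?P u (rseq n) s" "?P u (rseq n) s \<le> M" for n s
  proof -
    show "0 \<le> ?P u (rseq n) s" by (rule poisson_integral_nonneg[OF u0 z])
    have "\<bar>?P u (rseq n) s\<bar> \<le> M"
      by (rule poisson_integral_bounded[OF u _ z]) (use u0 uM in auto)
    then show "?P u (rseq n) s \<le> M" by linarith
  qed
  have lim: "AE s in circ. (\<lambda>n. ?P u (rseq n) s) \<longlonglongrightarrow> poisson_limit u s"
    by (rule poisson_limit_seq[OF u u0])
  have pb: "AE s in circ. 0 \<le> poisson_limit u s \<and> poisson_limit u s \<le> M"
    using lim by eventually_elim (auto intro: LIMSEQ_le_const LIMSEQ_le_const2 Pb)
  have pm: "poisson_limit u \<in> borel_measurable circ" by (rule poisson_limit_tendsto(2)[OF u u0])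
  have orth: "(LINT t|circ. (poisson_limit u t - u t) * v (cis t)) = 0" if v: "continuous_on UNIV v" for v :: "complex \<Rightarrow> real"
  proof -
    have vs: "continuous_on (sphere 0 1) v" using v continuous_on_subset by blast
    have "bounded (v ` sphere 0 1)" by (intro compact_imp_bounded compact_continuous_image vs) simp
    then obtain K where K: "0 < K" "\<And>w. w \<in> sphere 0 1 \<Longrightarrow> \<bar>v w\<bar> \<le> K" unfolding bounded_pos by auto
    have Kc: "\<bar>v (cis t)\<bar> \<le> K" for t by (rule K(2)) simp
    define V where "V = (\<lambda>t. v (cis t))"
    have V: "continuous_on {0..2*pi} V" unfolding V_def
      by (rule continuous_on_compose2[OF v]) (auto intro!: continuous_intros)
    have Vi: "integrable circ V" by (rule continuous_circ(1)[OF V])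
    have VK: "\<bar>V t\<bar> \<le> K" for t unfolding V_def by (rule Kc)
    have "(\<lambda>n. LINT s|circ. V s * ?P u (rseq n) s) \<longlonglongrightarrow> (LINT s|circ. V s * poisson_limit u s)"
    proof (rule integral_dominated_convergence[where w = "\<lambda>_. K * M"])
      show "AE s in circ. (\<lambda>n. V s * ?P u (rseq n) s) \<longlonglongrightarrow> V s * poisson_limit u s"
        using lim by eventually_elim (intro tendsto_intros)
      show "AE s in circ. norm (V s * ?P u (rseq n) s) \<le> K * M" for n
      proof (rule AE_I2)
        fix s
        have "\<bar>V s\<bar> * \<bar>?P u (rseq n) s\<bar> \<le> K * M" using VK[of s] Pb[of n s] K by (intro mult_mono) auto
        then show "norm (V s * ?P u (rseq n) s) \<le> K * M" by (simp add: abs_mult)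
      qed
      show "(\<lambda>s. V s * ?P u (rseq n) s) \<in> borel_measurable circ" for n
        using Vi poisson_integral_mean(1)[OF u rseq(4,2), of n] by auto
    qed (use Vi pm in auto)
    moreover have "(LINT s|circ. V s * ?P u (rseq n) s) = (LINT s|circ. u s * ?P V (rseq n) s)" for n
      by (rule poisson_self_adjoint[OF Vi u rseq(4,2)])
    moreover have "(\<lambda>n. LINT s|circ. u s * ?P V (rseq n) s) \<longlonglongrightarrow> (LINT s|circ. u s * V s)"
    proof (rule integral_dominated_convergence[where w = "\<lambda>_. M * K"])
      have Vlim: "(\<lambda>n. ?P V (rseq n) s) \<longlonglongrightarrow> V s" for s
        unfolding tendsto_iff
      proof safe
        fix e :: real assume e: "0 < e"
        obtain r0 where r0: "r0 < 1" "\<And>r \<theta>. r \<in> {r0..<1} \<Longrightarrow> \<bar>?P V r \<theta> - V \<theta>\<bar> \<le> e/2"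
          using poisson_uniform[OF vs, of "e/2"] e unfolding V_def by auto
        have "eventually (\<lambda>n. r0 < rseq n) sequentially" using rseq_LIMSEQ r0 by (intro order_tendstoD)
        then show "eventually (\<lambda>n. dist (?P V (rseq n) s) (V s) < e) sequentially"
        proof eventually_elim
          case (elim n)
          have "\<bar>?P V (rseq n) s - V s\<bar> \<le> e/2" using elim rseq(2)[of n] by (intro r0(2)) auto
          then show ?case using e by (simp add: dist_norm)
        qed
      qed
      then show "AE s in circ. (\<lambda>n. u s * ?P V (rseq n) s) \<longlonglongrightarrow> u s * V s"
        by (intro AE_I2 tendsto_intros)
      have PV: "\<bar>?P V (rseq n) s\<bar> \<le> K" for n s by (rule poisson_integral_bounded[OF Vi VK z])
      show "AE s in circ. norm (u s * ?P V (rseq n) s) \<le> M * K" for n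
      proof (rule AE_I2)
        fix s
        have "\<bar>u s\<bar> * \<bar>?P V (rseq n) s\<bar> \<le> M * K" using PV[of n s] u0[of s] uM[of s] M by (intro mult_mono) auto
        then show "norm (u s * ?P V (rseq n) s) \<le> M * K" by (simp add: abs_mult)
      qed
      show "(\<lambda>s. u s * ?P V (rseq n) s) \<in> borel_measurable circ" for n
        using u poisson_integral_mean(1)[OF Vi rseq(4,2), of n] by auto
    qed (use u Vi in auto)
    ultimately have "(LINT s|circ. V s * poisson_limit u s) = (LINT s|circ. u s * V s)"
      using LIMSEQ_unique by (simp only:) blast
    moreover have "integrable circ (\<lambda>s. V s * poisson_limit u s)"
      by (rule integrable_circ_mult_bounded[OF Vi pm, of M]) (use pb in auto)
    moreover have "integrable circ (\<lambda>s. u s * V s)"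
      by (rule integrable_circ_mult_bounded[OF u, of V K]) (use Vi VK in auto)
    ultimately have "(LINT s|circ. V s * poisson_limit u s - u s * V s) = 0" by simp
    then show ?thesis by (simp add: V_def algebra_simps)
  qed
  have "AE t in circ. poisson_limit u t - u t = 0"
  proof (rule circ_eq_0_if_orthogonal[OF _ _ M orth])
    show "(\<lambda>t. poisson_limit u t - u t) \<in> borel_measurable circ" using pm m by simp
    show "AE t in circ. \<bar>poisson_limit u t - u t\<bar> \<le> M" using pb
    proof eventually_elim
      case (elim t) then show ?case using u0[of t] uM[of t] by auto
    qed
  qed
  then show ?thesis by eventually_elim simp
qed

text \<open>Truncating u gives one inequality, Fatou's lemma the other.\<close>

lemma poisson_limit_nonneg:
  assumes u: "integrable circ u" and u0: "\<And>t. 0 \<le> u t"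
  shows "AE t in circ. poisson_limit u t = u t"
proof -
  let ?P = "\<lambda>u r s. LINT t|circ. poisson (polar r s) t * u t"
  have z: "cmod (polar (rseq n) s) < 1" for n s using rseq by (simp add: norm_mult)
  have um [measurable]: "u \<in> borel_measurable circ" using u by auto
  have pm [measurable]: "poisson_limit u \<in> borel_measurable circ" by (rule poisson_limit_tendsto(2)[OF u u0])
  have lim: "AE s in circ. (\<lambda>n. ?P u (rseq n) s) \<longlonglongrightarrow> poisson_limit u s"
    by (rule poisson_limit_seq[OF u u0])
  have "AE t in circ. min (u t) (real k) \<le> poisson_limit u t" for k
  proof -
    let ?v = "\<lambda>t. min (u t) (real k)"
    have v0: "0 \<le> ?v t" for t using u0 by simp
    have vm: "?v \<in> borel_measurable circ" by measurable
    have v: "integrable circ ?v" by (rule integrable_circ_bounded[OF vm, of "real k"]) (use u0 in auto)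
    have "AE s in circ. (\<lambda>n. ?P ?v (rseq n) s) \<longlonglongrightarrow> poisson_limit ?v s"
      by (rule poisson_limit_seq[OF v v0])
    moreover have "AE t in circ. poisson_limit ?v t = ?v t" by (rule poisson_limit_bounded[OF vm v0, of k]) simp
    ultimately show ?thesis using lim
    proof eventually_elim
      case (elim s)
      have le: "?P ?v (rseq n) s \<le> ?P u (rseq n) s" for n
        by (intro integral_mono integrable_poisson_mult[OF _ z] mult_left_mono less_imp_le[OF poisson_bounds(1)[OF z]] u v) simp
      have "poisson_limit ?v s \<le> poisson_limit u s" by (rule LIMSEQ_le[OF elim(1,3)]) (use le in auto)
      then show ?case using elim(2) by simp
    qed
  qed
  then have "AE t in circ. \<forall>k. min (u t) (real k) \<le> poisson_limit u t" by (simp add: AE_all_countable)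
  then have ge: "AE t in circ. u t \<le> poisson_limit u t"
  proof eventually_elim
    case (elim t)
    obtain k where "u t \<le> real k" using real_arch_simple by blast
    then show ?case using elim[rule_format, of k] by simp
  qed
  have "(\<integral>\<^sup>+t. ennreal (poisson_limit u t) \<partial>circ) = (\<integral>\<^sup>+t. liminf (\<lambda>n. ennreal (?P u (rseq n) t)) \<partial>circ)"
  proof (rule nn_integral_cong_AE)
    show "AE t in circ. ennreal (poisson_limit u t) = liminf (\<lambda>n. ennreal (?P u (rseq n) t))"
      using lim
    proof eventually_elim
      case (elim t)
      then have "(\<lambda>n. ennreal (?P u (rseq n) t)) \<longlonglongrightarrow> ennreal (poisson_limit u t)" by (rule tendsto_ennrealI)
      then show ?case by (intro lim_imp_Liminf[symmetric]) auto
    qed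
  qed
  also have "\<dots> \<le> liminf (\<lambda>n. \<integral>\<^sup>+t. ennreal (?P u (rseq n) t) \<partial>circ)"
    by (rule nn_integral_liminf) (use poisson_integral_mean(1)[OF u rseq(4,2)] in auto)
  also have "(\<lambda>n. \<integral>\<^sup>+t. ennreal (?P u (rseq n) t) \<partial>circ) = (\<lambda>n. ennreal (LINT t|circ. u t))"
  proof
    fix n
    have "(\<integral>\<^sup>+t. ennreal (?P u (rseq n) t) \<partial>circ) = ennreal (LINT t|circ. ?P u (rseq n) t)"
      by (rule nn_integral_eq_integral[OF poisson_integral_mean(1)[OF u rseq(4,2)]])
        (intro AE_I2 poisson_integral_nonneg[OF u0 z])
    then show "(\<integral>\<^sup>+t. ennreal (?P u (rseq n) t) \<partial>circ) = ennreal (LINT t|circ. u t)"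
      unfolding poisson_integral_mean(2)[OF u rseq(4,2)] .
  qed
  also have "liminf (\<lambda>n::nat. ennreal (LINT t|circ. u t)) = ennreal (LINT t|circ. u t)" by (rule Liminf_const) simp
  finally have le: "(\<integral>\<^sup>+t. ennreal (poisson_limit u t) \<partial>circ) \<le> ennreal (LINT t|circ. u t)" .
  have p0: "AE t in circ. 0 \<le> poisson_limit u t" using ge by eventually_elim (use u0 order_trans in blast)
  have pi: "integrable circ (poisson_limit u)"
    by (rule integrableI_nonneg[OF pm p0]) (use le in \<open>simp add: le_less_trans\<close>)
  have "ennreal (LINT t|circ. poisson_limit u t) \<le> ennreal (LINT t|circ. u t)"
    using le nn_integral_eq_integral[OF pi p0] by simp
  then have "(LINT t|circ. poisson_limit u t) \<le> (LINT t|circ. u t)"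
    by (subst (asm) ennreal_le_iff) (use u0 in auto)
  then have "(LINT t|circ. poisson_limit u t - u t) \<le> 0" using u pi by simp
  moreover have "0 \<le> (LINT t|circ. poisson_limit u t - u t)"
    by (rule integral_nonneg_AE) (use ge in auto)
  ultimately have "(LINT t|circ. poisson_limit u t - u t) = 0" by simp
  then have "AE t in circ. poisson_limit u t - u t = 0"
    by (subst (asm) integral_nonneg_eq_0_iff_AE) (use u pi ge in auto)
  then show ?thesis by eventually_elim simp
qed

lemma poisson_radial_limit:
  assumes u: "integrable circ u"
  shows "AE s in circ. ((\<lambda>r. poisson_int u (polar r s)) \<longlongrightarrow> u s) (at_left 1)"
proof -
  let ?P = "\<lambda>u r s. LINT t|circ. poisson (polar r s) t * u t"
  let ?p = "\<lambda>t. max 0 (u t)" and ?m = "\<lambda>t. max 0 (- u t)"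
  have i: "integrable circ ?p" "integrable circ ?m" using u by auto
  have 0: "0 \<le> ?p t" "0 \<le> ?m t" for t by auto
  show ?thesis
    using poisson_limit_tendsto(1)[OF i(1) 0(1)] poisson_limit_tendsto(1)[OF i(2) 0(2)] poisson_limit_nonneg[OF i(1) 0(1)] poisson_limit_nonneg[OF i(2) 0(2)]
  proof eventually_elim
    case (elim s)
    have *: "((\<lambda>r. ?P ?p r s - ?P ?m r s) \<longlongrightarrow> poisson_limit ?p s - poisson_limit ?m s) (at_left 1)"
      by (intro tendsto_diff elim)
    have us: "poisson_limit ?p s - poisson_limit ?m s = u s" unfolding elim by auto
    show ?case
      unfolding us[symmetric]
    proof (rule tendsto_at_left_1_cong[OF *])
      fix r :: real assume "0 < r" "r < 1"
      then have z: "cmod (polar r s) < 1" by (simp add: norm_mult)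
      have "?P ?p r s - ?P ?m r s = (LINT t|circ. poisson (polar r s) t * ?p t - poisson (polar r s) t * ?m t)"
        by (rule Bochner_Integration.integral_diff[symmetric]; rule integrable_poisson_mult[OF _ z]) (rule i)+
      also have "\<dots> = ?P u r s"
        by (rule arg_cong[where f = "integral\<^sup>L circ"]) (auto simp: fun_eq_iff max_def)
      finally show "?P ?p r s - ?P ?m r s = ?P u r s" .
    qed
  qed
qed

section \<open>Cauchy integrals of positive functions\<close>

lemma bounded_mean_value:
  assumes b: "b holomorphic_on ball 0 1" and B: "\<forall>z\<in>ball 0 1. cmod (b z) \<le> B"
  shows "integrable circ (bdry b)" "(LINT t|circ. bdry b t) = b 0"
proof -
  show "integrable circ (bdry b)" by (rule integrable_circ_bounded[OF measurable_bdry[OF b] bounded_rlim(2)[OF b B]])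
  have "(\<lambda>n. LINT t|circ. b (polar (rseq n) t)) \<longlonglongrightarrow> (LINT t|circ. bdry b t)"
  proof (rule integral_dominated_convergence[where w = "\<lambda>_. B"])
    show "AE t in circ. (\<lambda>n. b (polar (rseq n) t)) \<longlonglongrightarrow> bdry b t"
      using bounded_rlim(1)[OF b B] by eventually_elim (rule rlim_seq)
    show "AE t in circ. norm (b (polar (rseq n) t)) \<le> B" for n
      using B mult_cis_in_ball[OF rseq(4,2)] by (intro AE_I2) blast
  qed (use measurable_bdry[OF b] measurable_dilate[OF b rseq(4,2)] in auto)
  then show "(LINT t|circ. bdry b t) = b 0"
    unfolding mean_value_dilate[OF b rseq(4,2), symmetric] by (simp add: LIMSEQ_const_iff)
qed

lemma rlim_cong_eventually:
  assumes "(g \<longlongrightarrow> l) (at_left 1)" "\<And>r. 0 < r \<Longrightarrow> r < 1 \<Longrightarrow> g r = G (polar r t)"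
  shows "bdry G t = l" "has_rlim G t"
  using rlimI[OF tendsto_at_left_1_cong[OF assms]] by auto

text \<open>The real part of \<open>1 + e w\<close> is at least 1, and in the expansion of its
  squared modulus the cross term \<open>2 e Re w\<close> is nonnegative.\<close>

lemma one_plus_Re_nonneg:
  assumes "0 \<le> Re w" "0 < e"
  shows "1 \<le> cmod (1 + of_real e * w)" "e * cmod w \<le> cmod (1 + of_real e * w)" "1 + of_real e * w \<noteq> 0"
    "cmod (1 + of_real e * w) \<le> 1 + e * cmod w"
proof -
  have "1 \<le> Re (1 + of_real e * w)" using assms by simp
  then show 1: "1 \<le> cmod (1 + of_real e * w)" using complex_Re_le_cmod order_trans by blast
  then show "1 + of_real e * w \<noteq> 0" by auto
  have "(e * cmod w)\<^sup>2 \<le> (cmod (1 + of_real e * w))\<^sup>2"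
    unfolding power_mult_distrib cmod_power2 using assms by (simp add: power2_eq_square algebra_simps)
  then show "e * cmod w \<le> cmod (1 + of_real e * w)" by (rule power2_le_imp_le) simp
  show "cmod (1 + of_real e * w) \<le> 1 + e * cmod w"
    using norm_triangle_ineq[of 1 "of_real e * w"] assms by (simp add: norm_mult)
qed

locale positive_cauchy =
  fixes u :: "real \<Rightarrow> real"
  assumes u: "integrable circ u" and u0: "\<And>t. 0 \<le> u t"
begin

definition "m = (LINT t|circ. u t)"
definition "F = riesz_disc (\<lambda>t. complex_of_real (u t))"
text \<open>The damping factor: bounded by 1, zero-free, small enough that \<open>F\<close> times it
  is bounded by \<open>1 / e\<close>, and tending to 1 pointwise as \<open>e\<close> tends to
  0.\<close>

definition "\<beta> e z = 1 / (1 + of_real e * F z)"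

lemma m_nonneg: "0 \<le> m" unfolding m_def using u0 by simp

lemma F_holomorphic: "F holomorphic_on ball 0 1"
  unfolding F_def using u by (intro riesz_disc_holomorphic) simp

lemma F_0: "F 0 = of_real m"
  unfolding F_def m_def using u by (subst riesz_disc_eq) auto

lemma Re_F: "cmod z < 1 \<Longrightarrow> Re (F z) = (m + poisson_int u z) / 2"
  unfolding F_def m_def by (rule Re_riesz_disc[OF u])

lemma Re_F_nonneg: "cmod z < 1 \<Longrightarrow> 0 \<le> Re (F z)"
  using Re_F[of z] m_nonneg poisson_integral_nonneg[of u z, OF u0] by simp

lemma \<beta>_holomorphic: "0 < e \<Longrightarrow> \<beta> e holomorphic_on ball 0 1"
  unfolding \<beta>_def[abs_def] using one_plus_Re_nonneg(3)[OF Re_F_nonneg]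
  by (intro holomorphic_intros F_holomorphic) auto

lemma \<beta>_bounded: "0 < e \<Longrightarrow> \<forall>z\<in>ball 0 1. cmod (\<beta> e z) \<le> 1"
  unfolding \<beta>_def using one_plus_Re_nonneg(1)[OF Re_F_nonneg]
  by (auto simp: norm_divide divide_le_eq_1)

lemma \<beta>_nonzero: "0 < e \<Longrightarrow> cmod z < 1 \<Longrightarrow> \<beta> e z \<noteq> 0"
  unfolding \<beta>_def using one_plus_Re_nonneg(3)[OF Re_F_nonneg] by auto

text \<open>\<open>F\<close> is recovered from the bounded function \<open>\<beta> 1\<close> as
  \<open>1 / \<beta> 1 - 1\<close>, and the limits of \<open>\<beta> 1\<close> are nonzero almost
  everywhere by \<open>log_subharmonic\<close>. The real part is then read off from the Poisson
  integral.\<close>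

lemma F_rlim: "AE t in circ. has_rlim F t \<and> Re (bdry F t) = (m + u t) / 2"
proof -
  have nz: "AE t in circ. bdry (\<beta> 1) t \<noteq> 0"
    by (rule log_subharmonic(1)[OF \<beta>_holomorphic \<beta>_bounded, of 1 0]) (use \<beta>_nonzero[of 1 0] in auto)
  show ?thesis
    using nz bounded_rlim(1)[OF \<beta>_holomorphic[of 1] \<beta>_bounded[of 1], simplified] poisson_radial_limit[OF u]
  proof eventually_elim
    case (elim t)
    have "((\<lambda>r. 1 / \<beta> 1 (polar r t) - 1) \<longlongrightarrow> 1 / bdry (\<beta> 1) t - 1) (at_left 1)"
      using elim unfolding has_rlim_def by (intro tendsto_intros) auto
    moreover have "1 / \<beta> 1 (polar r t) - 1 = F (polar r t)" for r
      unfolding \<beta>_def by simp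
    ultimately have "((\<lambda>r. F (polar r t)) \<longlongrightarrow> 1 / bdry (\<beta> 1) t - 1) (at_left 1)" by simp
    then have F: "has_rlim F t" using rlimI by blast
    then have 1: "((\<lambda>r. Re (F (polar r t))) \<longlongrightarrow> Re (bdry F t)) (at_left 1)"
      unfolding has_rlim_def by (rule tendsto_Re)
    have 2: "((\<lambda>r. (m + poisson_int u (polar r t)) / 2) \<longlongrightarrow> (m + u t) / 2) (at_left 1)"
      by (intro tendsto_intros elim) simp
    have "((\<lambda>r. Re (F (polar r t))) \<longlongrightarrow> (m + u t) / 2) (at_left 1)"
      by (rule tendsto_at_left_1_cong[OF 2]) (auto simp: Re_F norm_mult)
    from tendsto_unique[OF _ 1 this] F show ?case by simp
  qed
qed

lemma \<beta>_rlim: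
  assumes e: "0 < e" and F: "has_rlim F t" "Re (bdry F t) = (m + u t) / 2"
  shows "has_rlim (\<beta> e) t" "bdry (\<beta> e) t = 1 / (1 + of_real e * bdry F t)"
proof -
  have "0 \<le> Re (bdry F t)" using F(2) m_nonneg u0[of t] by simp
  then have "1 + of_real e * bdry F t \<noteq> 0" using one_plus_Re_nonneg(3) e by blast
  then have "((\<lambda>r. 1 / (1 + of_real e * F (polar r t))) \<longlongrightarrow> 1 / (1 + of_real e * bdry F t)) (at_left 1)"
    using F(1) unfolding has_rlim_def by (intro tendsto_intros)
  from rlim_cong_eventually[OF this, of "\<beta> e"]
  show "has_rlim (\<beta> e) t" "bdry (\<beta> e) t = 1 / (1 + of_real e * bdry F t)" by (auto simp: \<beta>_def)
qed

text \<open>Kolmogorov's weak-type estimate, in the sharp \<open>o(1/\<lambda>)\<close> form that holds for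
  absolutely continuous measures.\<close>

definition "kolmogorov e t = e * (cmod (bdry F t))\<^sup>2 / (cmod (1 + of_real e * bdry F t))\<^sup>2"

text \<open>Splits the nonintegrable-looking quantity into two tractable terms: the first is built
  from the boundary values of a bounded analytic function, whose mean is its value at 0; the second
  is dominated by the integrable \<open>Re w\<close>.\<close>

lemma kolmogorov_eq:
  assumes e: "0 < e" and w: "0 \<le> Re w"
  shows "e * (cmod w)\<^sup>2 / (cmod (1 + of_real e * w))\<^sup>2
    = (1 - Re (1 / (1 + of_real e * w))) / e - Re w * (cmod (1 / (1 + of_real e * w)))\<^sup>2"
proof -
  define N where "N = (cmod (1 + of_real e * w))\<^sup>2"
  have N: "0 < N" unfolding N_def using one_plus_Re_nonneg(3)[OF w e] by simp
  have Neq: "N = 1 + 2 * e * Re w + e\<^sup>2 * (cmod w)\<^sup>2"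
    unfolding N_def cmod_power2 by (simp add: power2_eq_square algebra_simps)
  have R: "Re (1 / (1 + of_real e * w)) = (1 + e * Re w) / N"
    unfolding N_def by (simp add: Re_divide cmod_power2)
  have C: "(cmod (1 / (1 + of_real e * w)))\<^sup>2 = 1 / N"
    unfolding N_def by (simp add: norm_divide power_divide)
  have "(1 - (1 + e * Re w) / N) / e - Re w * (1 / N) = (N - (1 + e * Re w) - e * Re w) / (e * N)"
    using e N by (simp add: field_simps)
  also have "\<dots> = (e * (e * (cmod w)\<^sup>2)) / (e * N)" unfolding Neq by (simp add: power2_eq_square algebra_simps)
  also have "\<dots> = e * (cmod w)\<^sup>2 / N" using e by simp
  finally show ?thesis unfolding R C N_def[symmetric] by simp
qed

text \<open>The mean of the first term of \<open>kolmogorov_eq\<close> is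
  \<open>m / (1 + e m)\<close>, which tends to \<open>m\<close>. The second tends to the mean of
  \<open>(m + u) / 2\<close>, again \<open>m\<close>, so the limits cancel.\<close>

lemma kolmogorov_tendsto:
  assumes e: "\<And>n. 0 < e n" "e \<longlonglongrightarrow> 0"
  shows "integrable circ (kolmogorov (e n))" "(\<lambda>n. LINT t|circ. kolmogorov (e n) t) \<longlonglongrightarrow> 0"
proof -
  define a where "a = (\<lambda>t. (m + u t) / 2)"
  have a0: "0 \<le> a t" for t using m_nonneg u0[of t] by (simp add: a_def)
  have ai: "integrable circ a" unfolding a_def using u by auto
  have aI: "(LINT t|circ. a t) = m" unfolding a_def using u by (simp add: m_def)
  have Fm: "bdry F \<in> borel_measurable circ" by (rule measurable_bdry[OF F_holomorphic])
  have bm: "bdry (\<beta> (e n)) \<in> borel_measurable circ" for n by (rule measurable_bdry[OF \<beta>_holomorphic[OF e(1)]])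
  have km: "kolmogorov (e n) \<in> borel_measurable circ" for n unfolding kolmogorov_def[abs_def] using Fm by measurable
  have eq: "AE t in circ. kolmogorov (e n) t = (1 - Re (bdry (\<beta> (e n)) t)) / e n - a t * (cmod (bdry (\<beta> (e n)) t))\<^sup>2" for n
    using F_rlim
  proof eventually_elim
    case (elim t)
    then have "bdry (\<beta> (e n)) t = 1 / (1 + of_real (e n) * bdry F t)" using \<beta>_rlim(2)[OF e(1)] by blast
    moreover have "Re (bdry F t) = a t" using elim by (simp add: a_def)
    ultimately show ?case using kolmogorov_eq[OF e(1), of "bdry F t" n] a0[of t] unfolding kolmogorov_def by simp
  qed
  note bdd = \<beta>_holomorphic[OF e(1)] \<beta>_bounded[OF e(1)]
  have ab: "AE t in circ. norm (a t * (cmod (bdry (\<beta> (e n)) t))\<^sup>2) \<le> a t" for n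
    using bounded_rlim(2)[OF bdd, of n]
  proof eventually_elim
    case (elim t)
    then have "(cmod (bdry (\<beta> (e n)) t))\<^sup>2 \<le> 1" by (simp add: abs_square_le_1)
    then show ?case using a0[of t] by (simp add: mult_left_le)
  qed
  have abi: "integrable circ (\<lambda>t. a t * (cmod (bdry (\<beta> (e n)) t))\<^sup>2)" for n
    by (rule Bochner_Integration.integrable_bound[OF ai]) (use bm ai ab[of n] a0 in auto)
  have ri: "integrable circ (\<lambda>t. (1 - Re (bdry (\<beta> (e n)) t)) / e n)" for n
    using bounded_mean_value(1)[OF bdd] by auto
  show ki: "integrable circ (kolmogorov (e n))" for n
    using Bochner_Integration.integrable_diff[OF ri abi] eq[of n] km[of n]
    by (subst integrable_cong_AE[OF _ _ eq]) auto
  have I: "(LINT t|circ. kolmogorov (e n) t) = m / (1 + e n * m) - (LINT t|circ. a t * (cmod (bdry (\<beta> (e n)) t))\<^sup>2)" for n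
  proof -
    have "(LINT t|circ. kolmogorov (e n) t) = (LINT t|circ. (1 - Re (bdry (\<beta> (e n)) t)) / e n - a t * (cmod (bdry (\<beta> (e n)) t))\<^sup>2)"
      by (rule integral_cong_AE[OF km _ eq]) (use ri[of n] abi[of n] in auto)
    also have "\<dots> = (LINT t|circ. (1 - Re (bdry (\<beta> (e n)) t)) / e n) - (LINT t|circ. a t * (cmod (bdry (\<beta> (e n)) t))\<^sup>2)"
      by (rule Bochner_Integration.integral_diff[OF ri abi])
    also have "(LINT t|circ. (1 - Re (bdry (\<beta> (e n)) t)) / e n) = (1 - Re (\<beta> (e n) 0)) / e n"
      using bounded_mean_value[OF bdd, of n] by simp
    also have "\<beta> (e n) 0 = of_real (1 / (1 + e n * m))" by (simp add: \<beta>_def F_0)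
    also have "(1 - Re (of_real (1 / (1 + e n * m)))) / e n = m / (1 + e n * m)"
    proof -
      have "1 + e n * m > 0" using e(1)[of n] m_nonneg by (intro add_pos_nonneg) auto
      then have "1 - Re (of_real (1 / (1 + e n * m))) = e n * (m / (1 + e n * m))" by (simp add: field_simps)
      then show ?thesis using e(1)[of n] by simp
    qed
    finally show ?thesis .
  qed
  have "(\<lambda>n. LINT t|circ. a t * (cmod (bdry (\<beta> (e n)) t))\<^sup>2) \<longlonglongrightarrow> (LINT t|circ. a t)"
  proof (rule integral_dominated_convergence[where w = a, OF _ _ _ _ ab])
    show "AE t in circ. (\<lambda>n. a t * (cmod (bdry (\<beta> (e n)) t))\<^sup>2) \<longlonglongrightarrow> a t"
      using F_rlim
    proof eventually_elim
      case (elim t)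
      then have b: "bdry (\<beta> (e n)) t = 1 / (1 + of_real (e n) * bdry F t)" for n using \<beta>_rlim(2)[OF e(1)] by blast
      have "(\<lambda>n. a t * (cmod (1 / (1 + of_real (e n) * bdry F t)))\<^sup>2) \<longlonglongrightarrow> a t * (cmod (1 / (1 + of_real 0 * bdry F t)))\<^sup>2"
        by (intro tendsto_intros e) simp
      then show ?case unfolding b by simp
    qed
  qed (use ai abi in auto)
  moreover have "(\<lambda>n. m / (1 + e n * m)) \<longlonglongrightarrow> m / (1 + 0 * m)" by (intro tendsto_intros e) simp
  ultimately have "(\<lambda>n. m / (1 + e n * m) - (LINT t|circ. a t * (cmod (bdry (\<beta> (e n)) t))\<^sup>2)) \<longlonglongrightarrow> m / (1 + 0 * m) - m"
    unfolding aI by (rule tendsto_diff[rotated])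
  then show "(\<lambda>n. LINT t|circ. kolmogorov (e n) t) \<longlonglongrightarrow> 0" unfolding I by simp
qed

end

section \<open>Damping the Riesz projection\<close>

lemma outer_fun_iff:
  "outer_fun \<Phi> \<longleftrightarrow> (\<exists>c w. cmod c = 1 \<and> integrable circ w \<and> (\<forall>z\<in>ball 0 1. \<Phi> z = c * exp (herglotz w z)))"
proof -
  have "complex_of_real (1 / (2*pi)) * (LINT t:{0..2*pi}|lebesgue. (cis t + z) / (cis t - z) * complex_of_real (w t)) = herglotz w z"
    if w: "integrable circ w" and z: "z \<in> ball 0 1" for w z
  proof -
    have z': "cmod z < 1" using z by simp
    have i: "integrable circ (\<lambda>t. complex_of_real (w t))" using w by simp
    have e: "(cis t + z) / (cis t - z) * complex_of_real (w t) = 2 * (complex_of_real (w t) / (1 - z * cnj (cis t))) - complex_of_real (w t)" for t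
      unfolding cauchy_kernel(2)[OF z'] by (simp add: algebra_simps)
    have "complex_of_real (1 / (2*pi)) * (LINT t:{0..2*pi}|lebesgue. (cis t + z) / (cis t - z) * complex_of_real (w t))
        = (LINT t|circ. (cis t + z) / (cis t - z) * complex_of_real (w t))"
      unfolding integral_circ scaleR_conv_of_real ..
    also have "\<dots> = (LINT t|circ. 2 * (complex_of_real (w t) / (1 - z * cnj (cis t)))) - (LINT t|circ. complex_of_real (w t))"
      unfolding e
      by (rule Bochner_Integration.integral_diff)
        (use i integrable_cauchy_kernel[OF i z'] in \<open>auto simp del: times_divide_eq_right\<close>)
    also have "\<dots> = herglotz w z" unfolding herglotz_def riesz_disc_eq[OF i z'] by (simp del: times_divide_eq_right)
    finally show ?thesis .
  qed
  then show ?thesis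
    unfolding outer_fun_def integrable_circ_iff[symmetric] by (intro ex_cong1 conj_cong ball_cong refl) simp_all
qed

lemma inner_fun_bdry:
  assumes "inner_fun I"
  shows "I holomorphic_on ball 0 1" "\<forall>z\<in>ball 0 1. cmod (I z) \<le> 1"
    "AE t in circ. has_rlim I t \<and> cmod (bdry I t) = 1"
proof -
  show "I holomorphic_on ball 0 1" "\<forall>z\<in>ball 0 1. cmod (I z) \<le> 1" using assms by (auto simp: inner_fun_def)
  have "AE t in circ. \<exists>u. cmod u = 1 \<and> ((\<lambda>r. I (polar r t)) \<longlongrightarrow> u) (at_left 1)"
    using assms unfolding inner_fun_def AE_circ_iff by blast
  then show "AE t in circ. has_rlim I t \<and> cmod (bdry I t) = 1"
    by eventually_elim (use rlimI in blast)
qed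

locale cauchy_transform =
  fixes \<psi> :: "real \<Rightarrow> complex"
  assumes \<psi>: "integrable circ \<psi>"
begin

definition "f = riesz_disc \<psi>"
text \<open>For \<open>j = 0, 1, 2, 3\<close> these are the positive part of the real part, the
  positive part of the imaginary part, and the corresponding negative parts.\<close>

definition part :: "nat \<Rightarrow> real \<Rightarrow> real" where
  "part j t = max 0 (Re (cnj (\<i> ^ j) * \<psi> t))"

lemma part_integrable: "integrable circ (part j)"
  unfolding part_def[abs_def] using \<psi> by (intro integrable_max integrable_Re integrable_mult_right) auto

sublocale P: positive_cauchy "part j" for j
  by standard (auto simp: part_integrable part_def)

lemma decompose: "\<psi> t = (\<Sum>j<4. \<i> ^ j * complex_of_real (part j t))"
  by (simp add: part_def numeral_eq_Suc complex_eq_iff max_def)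

lemma f_holomorphic: "f holomorphic_on ball 0 1"
  unfolding f_def by (rule riesz_disc_holomorphic[OF \<psi>])

lemma f_decompose:
  assumes z: "cmod z < 1"
  shows "f z = (\<Sum>j<4. \<i> ^ j * P.F j z)"
proof -
  have i: "integrable circ (\<lambda>t. complex_of_real (part j t))" for j using part_integrable by simp
  have "f z = (LINT t|circ. (\<Sum>j<4. \<i> ^ j * (complex_of_real (part j t) / (1 - z * cnj (cis t)))))"
    unfolding f_def riesz_disc_eq[OF \<psi> z] by (subst decompose) (simp add: sum_divide_distrib)
  also have "\<dots> = (\<Sum>j<4. \<i> ^ j * P.F j z)"
    unfolding P.F_def riesz_disc_eq[OF i z]
    by (subst Bochner_Integration.integral_sum)
      (use integrable_cauchy_kernel[OF i z] in \<open>auto simp del: times_divide_eq_right\<close>)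
  finally show ?thesis .
qed

definition "damp e z = (\<Prod>j<4. P.\<beta> j e z)"

lemma damp_holomorphic: "0 < e \<Longrightarrow> damp e holomorphic_on ball 0 1"
  unfolding damp_def[abs_def] by (intro holomorphic_intros P.\<beta>_holomorphic)

lemma damp_bounded: "0 < e \<Longrightarrow> \<forall>z\<in>ball 0 1. cmod (damp e z) \<le> 1"
  unfolding damp_def using P.\<beta>_bounded by (auto simp: prod_norm[symmetric] intro!: prod_le_1)

lemma damp_nonzero: "0 < e \<Longrightarrow> cmod z < 1 \<Longrightarrow> damp e z \<noteq> 0"
  unfolding damp_def using P.\<beta>_nonzero by simp

lemma f_damp_holomorphic: "0 < e \<Longrightarrow> (\<lambda>z. f z * damp e z) holomorphic_on ball 0 1"
  by (intro holomorphic_intros f_holomorphic damp_holomorphic)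

text \<open>Each \<open>P.F j\<close> is bounded by \<open>1 / e\<close> after multiplication by its
  own factor, and the other factors have modulus at most 1. Four summands make
  \<open>4 / e\<close>.\<close>

lemma f_damp_bounded:
  assumes e: "0 < e"
  shows "\<forall>z\<in>ball 0 1. cmod (f z * damp e z) \<le> 4 / e"
proof
  fix z :: complex assume "z \<in> ball 0 1"
  then have z: "cmod z < 1" by simp
  have "cmod (P.F j z) * cmod (damp e z) \<le> 1 / e" if j: "j < 4" for j
  proof -
    note w = one_plus_Re_nonneg[OF P.Re_F_nonneg[OF z, of j] e]
    have "cmod (damp e z) = cmod (P.\<beta> j e z) * (\<Prod>i\<in>{..<4} - {j}. cmod (P.\<beta> i e z))"
      unfolding damp_def prod_norm[symmetric] using j by (subst prod.remove[of _ j]) auto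
    also have "\<dots> \<le> cmod (P.\<beta> j e z) * 1"
      using P.\<beta>_bounded[OF e] z by (intro mult_left_mono prod_le_1) auto
    finally have "cmod (P.F j z) * cmod (damp e z) \<le> cmod (P.F j z) * cmod (P.\<beta> j e z)" by (simp add: mult_left_mono)
    also have "\<dots> = cmod (P.F j z) / cmod (1 + of_real e * P.F j z)" by (simp add: P.\<beta>_def norm_divide)
    also have "\<dots> \<le> 1 / e" using w e by (simp add: field_simps)
    finally show ?thesis .
  qed
  then have "(\<Sum>j<4. cmod (P.F j z) * cmod (damp e z)) \<le> (\<Sum>j<(4::nat). 1 / e)" by (intro sum_mono) simp
  moreover have "cmod (f z * damp e z) \<le> (\<Sum>j<4. cmod (P.F j z) * cmod (damp e z))"
    unfolding f_decompose[OF z] norm_mult sum_distrib_right[symmetric]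
    by (intro mult_right_mono order_trans[OF norm_sum]) (auto simp: norm_mult norm_power)
  ultimately show "cmod (f z * damp e z) \<le> 4 / e" by simp
qed

text \<open>A set of full measure, independent of \<open>e\<close>, on which every boundary identity
  for \<open>f\<close> and for all \<open>damp e\<close> holds pointwise.\<close>

definition "good t \<longleftrightarrow> (\<forall>j. has_rlim (P.F j) t \<and> Re (bdry (P.F j) t) = (P.m j + part j t) / 2)"

lemma AE_good: "AE t in circ. good t"
  unfolding good_def AE_all_countable using P.F_rlim by blast

lemma good_Re_nonneg: "good t \<Longrightarrow> 0 \<le> Re (bdry (P.F j) t)"
proof -
  assume "good t"
  then have "Re (bdry (P.F j) t) = (P.m j + part j t) / 2" unfolding good_def by blast
  then show ?thesis using P.m_nonneg[of j] P.u0[of j t] by simp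
qed

lemma f_rlim:
  assumes "good t"
  shows "has_rlim f t" "bdry f t = (\<Sum>j<4. \<i> ^ j * bdry (P.F j) t)"
proof -
  have "((\<lambda>r. \<Sum>j<4. \<i> ^ j * P.F j (polar r t)) \<longlongrightarrow> (\<Sum>j<4. \<i> ^ j * bdry (P.F j) t)) (at_left 1)"
    using assms unfolding good_def has_rlim_def by (intro tendsto_intros) auto
  from rlim_cong_eventually[OF this, of f]
  show "has_rlim f t" "bdry f t = (\<Sum>j<4. \<i> ^ j * bdry (P.F j) t)"
    by (auto simp: f_decompose norm_mult)
qed

lemma damp_rlim:
  assumes e: "0 < e" and g: "good t"
  shows "has_rlim (damp e) t" "bdry (damp e) t = (\<Prod>j<4. 1 / (1 + of_real e * bdry (P.F j) t))"
proof -
  have "has_rlim (P.\<beta> j e) t" "bdry (P.\<beta> j e) t = 1 / (1 + of_real e * bdry (P.F j) t)" for j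
    using P.\<beta>_rlim[OF e, of j t] g unfolding good_def by blast+
  then have "((\<lambda>r. \<Prod>j<4. P.\<beta> j e (polar r t)) \<longlongrightarrow> (\<Prod>j<4. 1 / (1 + of_real e * bdry (P.F j) t))) (at_left 1)"
    unfolding has_rlim_def by (intro tendsto_prod) metis
  from rlim_cong_eventually[OF this, of "damp e"]
  show "has_rlim (damp e) t" "bdry (damp e) t = (\<Prod>j<4. 1 / (1 + of_real e * bdry (P.F j) t))"
    by (auto simp: damp_def)
qed

lemma damp_rlim_bounds:
  assumes e: "0 < e" and g: "good t"
  shows "cmod (bdry (damp e) t) \<le> 1"
proof -
  have "cmod (1 / (1 + of_real e * bdry (P.F j) t)) \<le> 1" for j
    using one_plus_Re_nonneg(1)[OF good_Re_nonneg[OF g, of j] e] by (simp add: norm_divide divide_le_eq_1)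
  then show ?thesis unfolding damp_rlim(2)[OF e g] prod_norm[symmetric] by (intro prod_le_1) auto
qed

lemma rlim_mult:
  assumes "has_rlim F t" "has_rlim G t"
  shows "has_rlim (\<lambda>z. F z * G z) t" "bdry (\<lambda>z. F z * G z) t = bdry F t * bdry G t"
proof -
  have "((\<lambda>r. F (polar r t) * G (polar r t)) \<longlongrightarrow> bdry F t * bdry G t) (at_left 1)"
    using assms unfolding has_rlim_def by (rule tendsto_mult)
  from rlimI[OF this] show "has_rlim (\<lambda>z. F z * G z) t" "bdry (\<lambda>z. F z * G z) t = bdry F t * bdry G t" by auto
qed

text \<open>Let \<open>x\<close> be the largest \<open>cmod (W j)\<close>, attained at
  \<open>m\<close>; then \<open>f\<close> is at most \<open>4 * x\<close>. If
  \<open>e * x \<le> 1\<close>, the damping factor is close to 1, hence nearly real; if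
  \<open>e * x > 1\<close>, it is small outright. In both regimes the product is comparable with the
  Kolmogorov term of index \<open>m\<close>.\<close>

lemma f_damp_imaginary_bound:
  assumes e: "0 < e" and g: "good t"
  shows "cmod (bdry f t) * cmod (bdry (damp e) t - cnj (bdry (damp e) t)) \<le> 128 * (\<Sum>j<4. P.kolmogorov j e t)"
proof -
  let ?d = "bdry (damp e) t - cnj (bdry (damp e) t)"
  define W where "W j = bdry (P.F j) t" for j
  define \<kappa> where "\<kappa> = (\<lambda>j. 1 / (1 + of_real e * W j))"
  note w = one_plus_Re_nonneg[OF good_Re_nonneg[OF g] e, folded W_def]
  have \<kappa>1: "cmod (\<kappa> j) \<le> 1" for j using w(1)[of j] by (simp add: \<kappa>_def norm_divide divide_le_eq_1)
  have dk: "bdry (damp e) t = (\<Prod>j<4. \<kappa> j)" unfolding damp_rlim(2)[OF e g] \<kappa>_def W_def ..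
  have kolmogorov: "P.kolmogorov j e t = e * (cmod (W j))\<^sup>2 / (cmod (1 + of_real e * W j))\<^sup>2" for j unfolding P.kolmogorov_def W_def ..
  have kol0: "0 \<le> P.kolmogorov j e t" for j unfolding kolmogorov using e by simp
  have "\<exists>m\<in>{..<4::nat}. \<forall>j\<in>{..<4}. cmod (W j) \<le> cmod (W m)"
  proof -
    let ?S = "(\<lambda>j. cmod (W j)) ` {..<4::nat}"
    have "Max ?S \<in> ?S" by (rule Max_in) (auto simp: lessThan_empty_iff)
    then obtain m where "m \<in> {..<4::nat}" "Max ?S = cmod (W m)" by blast
    moreover have "cmod (W j) \<le> Max ?S" if "j \<in> {..<4}" for j by (rule Max_ge) (use that in auto)
    ultimately show ?thesis by metis
  qed
  then obtain m where m: "m < 4" "\<And>j. j < 4 \<Longrightarrow> cmod (W j) \<le> cmod (W m)" by auto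
  define x where "x = cmod (W m)"
  define N where "N = cmod (1 + of_real e * W m)"
  have N: "1 \<le> N" "e * x \<le> N" "N \<le> 1 + e * x" using w(1,2,4)[of m] by (auto simp: N_def x_def)
  have x0: "0 \<le> x" by (simp add: x_def)
  have fx: "cmod (bdry f t) \<le> 4 * x"
  proof -
    have "cmod (bdry f t) \<le> (\<Sum>j<(4::nat). x)"
      unfolding f_rlim(2)[OF g] by (rule sum_norm_le) (use m in \<open>auto simp: norm_mult norm_power x_def W_def\<close>)
    then show ?thesis by simp
  qed
  \<comment> \<open>Subtracting a real number does not change the imaginary part. It is used with
    \<open>c = 1\<close> in the first regime and \<open>c = 0\<close> in the second.\<close>
  have D: "cmod ?d \<le> 2 * cmod (bdry (damp e) t - c)" if "cnj c = c" for c
  proof -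
    have "bdry (damp e) t - cnj (bdry (damp e) t) = (bdry (damp e) t - c) - cnj (bdry (damp e) t - c)" using that by simp
    also have "cmod \<dots> \<le> cmod (bdry (damp e) t - c) + cmod (cnj (bdry (damp e) t - c))" by (rule norm_triangle_ineq4)
    also have "\<dots> = 2 * cmod (bdry (damp e) t - c)" unfolding complex_mod_cnj by simp
    finally show ?thesis .
  qed
  have "cmod (bdry f t) * cmod ?d \<le> 128 * P.kolmogorov m e t"
  proof (cases "e * x \<le> 1")
    case True
    have "cmod (bdry (damp e) t - 1) \<le> (\<Sum>j<4. cmod (\<kappa> j - 1))"
      unfolding dk using norm_prod_diff[of "{..<4}" \<kappa> "\<lambda>_. 1"] \<kappa>1 by simp
    also have "\<dots> \<le> (\<Sum>j<(4::nat). e * x)"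
    proof (rule sum_mono)
      fix j assume "j \<in> {..<(4::nat)}"
      then have j: "cmod (W j) \<le> x" using m by (simp add: x_def)
      have "\<kappa> j - 1 = - (of_real e * W j) * \<kappa> j" unfolding \<kappa>_def using w(3)[of j] by (simp add: field_simps)
      then have "cmod (\<kappa> j - 1) = e * cmod (W j) * cmod (\<kappa> j)" using e by (simp add: norm_mult)
      also have "\<dots> \<le> e * x * 1" using e j \<kappa>1[of j] x0 by (intro mult_mono) auto
      finally show "cmod (\<kappa> j - 1) \<le> e * x" by simp
    qed
    finally have "cmod ?d \<le> 8 * (e * x)" using D[of 1] by simp
    then have "cmod (bdry f t) * cmod ?d \<le> (4 * x) * (8 * (e * x))"
      using fx x0 by (intro mult_mono) auto
    \<comment> \<open>In this regime \<open>N \<le> 1 + e * x \<le> 2\<close>, and replacing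
      \<open>2\<^sup>2\<close> by \<open>N\<^sup>2\<close> turns the 32 into 128.\<close>
    also have "\<dots> = 128 * (e * x\<^sup>2 / 2\<^sup>2)" by (simp add: power2_eq_square)
    also have "\<dots> \<le> 128 * (e * x\<^sup>2 / N\<^sup>2)"
      using N True e by (intro mult_left_mono divide_left_mono power_mono) auto
    finally show ?thesis unfolding kolmogorov N_def x_def .
  next
    case False
    have "cmod (bdry (damp e) t) = cmod (\<kappa> m) * (\<Prod>i\<in>{..<4} - {m}. cmod (\<kappa> i))"
      unfolding dk prod_norm[symmetric] using m by (subst prod.remove[of _ m]) auto
    also have "\<dots> \<le> cmod (\<kappa> m) * 1" using \<kappa>1 by (intro mult_left_mono prod_le_1) auto
    also have "\<dots> = 1 / N" by (simp add: \<kappa>_def N_def norm_divide)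
    finally have "cmod ?d \<le> 2 * (1 / N)" using D[of 0] by simp
    then have "cmod (bdry f t) * cmod ?d \<le> (4 * x) * (2 * (1 / N))"
      using fx x0 by (intro mult_mono) auto
    also have "\<dots> = 8 * x * N / N\<^sup>2" using N by (simp add: power2_eq_square)
    \<comment> \<open>Here \<open>1 < e * x\<close>, so
      \<open>N \<le> 1 + e * x \<le> 2 * (e * x)\<close>.\<close>
    also have "\<dots> \<le> 8 * x * (2 * (e * x)) / N\<^sup>2"
      using N False x0 by (intro divide_right_mono mult_left_mono) auto
    also have "\<dots> = 16 * (e * x\<^sup>2 / N\<^sup>2)" by (simp add: power2_eq_square)
    also have "\<dots> \<le> 128 * (e * x\<^sup>2 / N\<^sup>2)" using e by (intro mult_right_mono) auto
    finally show ?thesis unfolding kolmogorov N_def x_def .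
  qed
  also have "\<dots> \<le> 128 * (\<Sum>j<4. P.kolmogorov j e t)"
    using m kol0 by (intro mult_left_mono member_le_sum) auto
  finally show ?thesis .
qed

text \<open>This needs only that \<open>log\<bar>damp e\<bar>\<close> lies below the Poisson integral of its boundary values.\<close>

lemma exp_herglotz_damp_bounded:
  assumes w: "integrable circ w" and wf: "AE t in circ. exp (w t) = cmod (bdry f t)" and e: "0 < e" and z: "cmod z < 1"
  shows "cmod (exp (herglotz w z) * damp e z) \<le> 4 / e"
proof -
  note L = log_subharmonic[OF damp_holomorphic[OF e] damp_bounded[OF e], of 0, OF _ damp_nonzero[OF e]]
  have li: "integrable circ (\<lambda>t. ln (cmod (bdry (damp e) t)))" by (rule L(2)) auto
  have "ln (cmod (exp (herglotz w z) * damp e z)) = Re (herglotz w z) + ln (cmod (damp e z))"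
    using damp_nonzero[OF e z] by (simp add: norm_mult ln_mult)
  also have "\<dots> \<le> poisson_int w z + (LINT t|circ. poisson z t * ln (cmod (bdry (damp e) t)))"
    unfolding Re_herglotz[OF w z] by (intro add_left_mono L(3) damp_nonzero e z) auto
  also have "\<dots> = (LINT t|circ. poisson z t * w t + poisson z t * ln (cmod (bdry (damp e) t)))"
    by (rule Bochner_Integration.integral_add[symmetric]; rule integrable_poisson_mult[OF _ z]) (rule w li)+
  also have "\<dots> \<le> (LINT t|circ. poisson z t * ln (4 / e))"
  proof (rule integral_mono_AE)
    have nz: "AE t in circ. bdry (damp e) t \<noteq> 0" by (rule L(1)) auto
    show "AE t in circ. poisson z t * w t + poisson z t * ln (cmod (bdry (damp e) t)) \<le> poisson z t * ln (4 / e)"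
      using AE_good wf bounded_rlim(2)[OF f_damp_holomorphic[OF e] f_damp_bounded[OF e]] nz
    proof eventually_elim
      case (elim t)
      \<comment> \<open>\<open>exp (w t)\<close> is the modulus of \<open>f\<close> on the circle,
        so this is the bound of \<open>f_damp_bounded\<close> passed to boundary values.\<close>
      have le: "exp (w t) * cmod (bdry (damp e) t) \<le> 4 / e"
        using elim rlim_mult(2)[OF f_rlim(1) damp_rlim(1)[OF e], of t] by (simp add: norm_mult)
      have c: "0 < cmod (bdry (damp e) t)" using elim by simp
      have "ln (exp (w t) * cmod (bdry (damp e) t)) \<le> ln (4 / e)" using c le by (intro ln_mono) auto
      then have "w t + ln (cmod (bdry (damp e) t)) \<le> ln (4 / e)" using c by (simp add: ln_mult)
      then show ?case using mult_left_mono[OF _ less_imp_le[OF poisson_bounds(1)[OF z, of t]]] unfolding distrib_left[symmetric] by blast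
    qed
    show "integrable circ (\<lambda>t. poisson z t * w t + poisson z t * ln (cmod (bdry (damp e) t)))"
      by (rule Bochner_Integration.integrable_add; rule integrable_poisson_mult[OF _ z]) (rule w li)+
    show "integrable circ (\<lambda>t. poisson z t * ln (4 / e))" by (rule integrable_poisson_mult[OF _ z]) simp
  qed
  also have "\<dots> = ln (4 / e)" using integral_poisson[OF z] by simp
  finally show ?thesis using damp_nonzero[OF e z] e by (subst (asm) ln_le_cancel_iff) auto
qed

end

section \<open>The value of the outer factor at the origin\<close>

lemma borel_measurable_cnj [measurable (raw), simp, intro]:
  "g \<in> borel_measurable M \<Longrightarrow> (\<lambda>x. cnj (g x)) \<in> borel_measurable M"
  by (rule borel_measurable_continuous_on) (intro continuous_intros)

lemma bdry_eqI:
  assumes "has_rlim F t" "has_rlim G t" "\<And>z. cmod z < 1 \<Longrightarrow> F z = G z"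
  shows "bdry F t = bdry G t"
proof -
  have "((\<lambda>r. F (polar r t)) \<longlongrightarrow> bdry F t) (at_left 1)" using assms(1) by (simp add: has_rlim_def)
  from rlim_cong_eventually(1)[OF this, of G] show ?thesis by (simp add: assms(3) norm_mult)
qed

text \<open>Squared radii appear on one side of \<open>riesz_pairing\<close> when the other side
  runs along \<open>rseq\<close>.\<close>

lemma rseq_pow2_at_left: "filterlim (\<lambda>n. (rseq n)\<^sup>2) (at_left 1) sequentially"
proof (rule tendsto_imp_filterlim_at_left)
  show "(\<lambda>n. (rseq n)\<^sup>2) \<longlonglongrightarrow> 1" using tendsto_power[OF rseq_LIMSEQ, of 2] by simp
  show "\<forall>\<^sub>F n in sequentially. (rseq n)\<^sup>2 < 1"
    using rseq by (intro always_eventually allI) (simp add: abs_square_less_1)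
qed

lemma rlim_pow2: "has_rlim F t \<Longrightarrow> (\<lambda>n. F (polar ((rseq n)\<^sup>2) t)) \<longlonglongrightarrow> bdry F t"
  unfolding has_rlim_def by (rule filterlim_compose[OF _ rseq_pow2_at_left])

lemma herglotz_0: "integrable circ w \<Longrightarrow> herglotz w 0 = complex_of_real (LINT t|circ. w t)"
  unfolding herglotz_def by (subst riesz_disc_eq) auto

lemma integrable_poisson_le:
  assumes "integrable circ u" "integrable circ v" "AE t in circ. u t \<le> v t" "cmod z < 1"
  shows "poisson_int u z \<le> poisson_int v z"
proof (rule integral_mono_AE)
  show "AE t in circ. poisson z t * u t \<le> poisson z t * v t"
    using assms(3) by eventually_elim (rule mult_left_mono[OF _ less_imp_le[OF poisson_bounds(1)[OF assms(4)]]])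
qed (rule integrable_poisson_mult[OF _ assms(4)], fact)+

context cauchy_transform
begin

text \<open>Inside the disc \<open>cmod f\<close> is \<open>cmod I\<close> times \<open>exp\<close>
  of the Poisson integral of \<open>w\<close>; compare radial limits. Thus every factorisation has
  the same \<open>w\<close> almost everywhere, and its outer factor is determined up to a unimodular
  constant.\<close>

lemma factor_boundary_modulus:
  assumes Ib: "AE t in circ. has_rlim I t \<and> cmod (bdry I t) = 1" and c: "cmod c = 1" and w: "integrable circ w"
    and fac: "\<And>z. cmod z < 1 \<Longrightarrow> f z = I z * (c * exp (herglotz w z))"
  shows "AE t in circ. exp (w t) = cmod (bdry f t)"
  using AE_good Ib poisson_radial_limit[OF w]
proof eventually_elim
  case (elim t)
  have 1: "((\<lambda>r. cmod (f (polar r t))) \<longlongrightarrow> cmod (bdry f t)) (at_left 1)"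
    using f_rlim(1)[OF elim(1)] unfolding has_rlim_def by (rule tendsto_norm)
  have 2: "((\<lambda>r. cmod (I (polar r t)) * exp (poisson_int w (polar r t))) \<longlongrightarrow> cmod (bdry I t) * exp (w t)) (at_left 1)"
    using elim unfolding has_rlim_def by (intro tendsto_intros) auto
  have "((\<lambda>r. cmod (f (polar r t))) \<longlongrightarrow> cmod (bdry I t) * exp (w t)) (at_left 1)"
  proof (rule tendsto_at_left_1_cong[OF 2])
    fix r :: real assume "0 < r" "r < 1"
    then have z: "cmod (polar r t) < 1" by (simp add: norm_mult)
    show "cmod (I (polar r t)) * exp (poisson_int w (polar r t)) = cmod (f (polar r t))"
      unfolding fac[OF z] norm_mult c norm_exp_eq_Re Re_herglotz[OF w z] by simp
  qed
  from tendsto_unique[OF _ this 1] elim show ?case by simp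
qed

text \<open>The test function \<open>h = I * damp e\<close> is bounded by 1 and
  \<open>f * cnj h\<close> by \<open>4 / e\<close>. Both sides of \<open>riesz_pairing\<close>
  therefore converge by domination, with majorants \<open>cmod \<psi>\<close> and a
  constant.\<close>

lemma damped_pairing:
  assumes I: "I holomorphic_on ball 0 1" "\<forall>z\<in>ball 0 1. cmod (I z) \<le> 1"
    and Ib: "AE t in circ. has_rlim I t \<and> cmod (bdry I t) = 1" and e: "0 < e"
  shows "(LINT t|circ. \<psi> t * cnj (bdry I t * bdry (damp e) t)) = (LINT t|circ. bdry f t * cnj (bdry I t * bdry (damp e) t))"
proof -
  define h where "h = (\<lambda>z. I z * damp e z)"
  have h: "h holomorphic_on ball 0 1" unfolding h_def by (intro holomorphic_intros I damp_holomorphic e)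
  have hb: "cmod (h z) \<le> 1" if "z \<in> ball 0 1" for z
    unfolding h_def norm_mult using I(2) damp_bounded[OF e] that by (intro mult_le_one) auto
  have hf: "cmod (f z * cnj (h z)) \<le> 4 / e" if "z \<in> ball 0 1" for z
  proof -
    have "cmod (f z * cnj (h z)) = cmod (I z) * cmod (f z * damp e z)" by (simp add: h_def norm_mult)
    also have "\<dots> \<le> 1 * (4 / e)" using I(2) f_damp_bounded[OF e] that by (intro mult_mono) auto
    finally show ?thesis by simp
  qed
  have hr: "AE t in circ. has_rlim h t \<and> bdry h t = bdry I t * bdry (damp e) t"
    using AE_good Ib unfolding h_def by eventually_elim (use rlim_mult damp_rlim(1)[OF e] in blast)
  have hm: "bdry h \<in> borel_measurable circ" by (rule measurable_bdry[OF h])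
  have fm: "bdry f \<in> borel_measurable circ" by (rule measurable_bdry[OF f_holomorphic])
  have sq: "0 \<le> (rseq n)\<^sup>2" "(rseq n)\<^sup>2 < 1" for n using rseq by (auto simp: abs_square_less_1)
  have L: "(\<lambda>n. LINT t|circ. \<psi> t * cnj (h (polar ((rseq n)\<^sup>2) t))) \<longlonglongrightarrow> (LINT t|circ. \<psi> t * cnj (bdry h t))"
  proof (rule integral_dominated_convergence[where w = "\<lambda>t. cmod (\<psi> t)"])
    show "AE t in circ. (\<lambda>n. \<psi> t * cnj (h (polar ((rseq n)\<^sup>2) t))) \<longlonglongrightarrow> \<psi> t * cnj (bdry h t)"
      using hr by eventually_elim (intro tendsto_intros rlim_pow2, blast)
    show "AE t in circ. norm (\<psi> t * cnj (h (polar ((rseq n)\<^sup>2) t))) \<le> cmod (\<psi> t)" for n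
      using hb[OF mult_cis_in_ball[OF sq]] by (intro AE_I2) (simp add: norm_mult mult_left_le)
    show "(\<lambda>t. \<psi> t * cnj (h (polar ((rseq n)\<^sup>2) t))) \<in> borel_measurable circ" for n
      using \<psi> measurable_dilate[OF h sq, of n] by auto
  qed (use \<psi> hm in auto)
  have R: "(\<lambda>n. LINT t|circ. f (polar (rseq n) t) * cnj (h (polar (rseq n) t))) \<longlonglongrightarrow> (LINT t|circ. bdry f t * cnj (bdry h t))"
  proof (rule integral_dominated_convergence[where w = "\<lambda>t. 4 / e"])
    show "AE t in circ. (\<lambda>n. f (polar (rseq n) t) * cnj (h (polar (rseq n) t))) \<longlonglongrightarrow> bdry f t * cnj (bdry h t)"
      using hr AE_good by eventually_elim (intro tendsto_intros rlim_seq f_rlim(1), blast+)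
    show "AE t in circ. norm (f (polar (rseq n) t) * cnj (h (polar (rseq n) t))) \<le> 4 / e" for n
      using hf[OF mult_cis_in_ball[OF rseq(4,2)]] by (intro AE_I2)
    show "(\<lambda>t. f (polar (rseq n) t) * cnj (h (polar (rseq n) t))) \<in> borel_measurable circ" for n
      using measurable_dilate[OF f_holomorphic rseq(4,2), of n] measurable_dilate[OF h rseq(4,2), of n]
      by (intro borel_measurable_times borel_measurable_cnj)
  qed (use fm hm in auto)
  have "(LINT t|circ. \<psi> t * cnj (h (polar ((rseq n)\<^sup>2) t))) = (LINT t|circ. f (polar (rseq n) t) * cnj (h (polar (rseq n) t)))" for n
    unfolding f_def by (rule riesz_pairing[OF \<psi> h rseq(4,2)])
  then have eq: "(LINT t|circ. \<psi> t * cnj (bdry h t)) = (LINT t|circ. bdry f t * cnj (bdry h t))"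
    using LIMSEQ_unique[OF L] R by simp
  have c: "(LINT t|circ. x t * cnj (bdry h t)) = (LINT t|circ. x t * cnj (bdry I t * bdry (damp e) t))"
    if "x \<in> borel_measurable circ" for x
    by (rule integral_cong_AE)
      (use that hm hr measurable_bdry[OF I(1)] measurable_bdry[OF damp_holomorphic[OF e]] in auto)
  show ?thesis using eq c[OF fm] c[of \<psi>] \<psi> by simp
qed

lemma damp_tendsto:
  fixes W :: "nat \<Rightarrow> complex"
  assumes "e \<longlonglongrightarrow> 0" shows "(\<lambda>n. \<Prod>j<4. 1 / (1 + of_real (e n) * W j)) \<longlonglongrightarrow> (1::complex)"
proof -
  have "(\<lambda>n. \<Prod>j<(4::nat). 1 / (1 + of_real (e n) * W j)) \<longlonglongrightarrow> (\<Prod>j<(4::nat). 1 / (1 + of_real 0 * W j))"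
    by (intro tendsto_intros assms) simp
  then show ?thesis by simp
qed

text \<open>For \<open>f\<close> in \<open>H\<^sup>1\<close> this is the mean value property of the outer factor. In general
  \<open>bdry f\<close> is not integrable, and one tests against \<open>I * damp e\<close> instead of \<open>I\<close>; the error
  made by replacing \<open>cnj (damp e)\<close> by \<open>damp e\<close> is controlled by Kolmogorov's estimate.\<close>

lemma outer_factor_at_0:
  assumes I: "I holomorphic_on ball 0 1" "\<forall>z\<in>ball 0 1. cmod (I z) \<le> 1"
    and Ib: "AE t in circ. has_rlim I t \<and> cmod (bdry I t) = 1" and c: "cmod c = 1" and w: "integrable circ w"
    and fac: "\<And>z. cmod z < 1 \<Longrightarrow> f z = I z * (c * exp (herglotz w z))"
  shows "c * exp (herglotz w 0) = (LINT t|circ. \<psi> t * cnj (bdry I t))"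
proof -
  define e where "e = (\<lambda>n::nat. inverse (real (Suc n)))"
  have e: "0 < e n" "e \<longlonglongrightarrow> 0" for n
    using LIMSEQ_inverse_real_of_nat by (auto simp: e_def)
  have wf: "AE t in circ. exp (w t) = cmod (bdry f t)" by (rule factor_boundary_modulus[OF Ib c w fac])
  \<comment> \<open>The damped outer factor, bounded by \<open>exp_herglotz_damp_bounded\<close>, so
    that its boundary mean is its value at 0.\<close>
  define b where "b = (\<lambda>n z. c * exp (herglotz w z) * damp (e n) z)"
  have bh: "b n holomorphic_on ball 0 1" for n
    unfolding b_def by (intro holomorphic_intros herglotz_holomorphic w damp_holomorphic e)
  have bb: "\<forall>z\<in>ball 0 1. cmod (b n z) \<le> 4 / e n" for n
    unfolding b_def using exp_herglotz_damp_bounded[OF w wf e(1)] c by (simp add: norm_mult)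
  \<comment> \<open>Since \<open>cnj (bdry I)\<close> inverts \<open>bdry I\<close>,
    \<open>?x n\<close> is the boundary function of \<open>b n\<close>. The integrand
    \<open>?y n\<close> is the one from \<open>damped_pairing\<close>, and the two differ only by
    conjugation of the damping factor.\<close>
  let ?x = "\<lambda>n t. bdry f t * cnj (bdry I t) * bdry (damp (e n)) t"
  let ?y = "\<lambda>n t. bdry f t * cnj (bdry I t * bdry (damp (e n)) t)"
  let ?p = "\<lambda>n t. \<psi> t * cnj (bdry I t * bdry (damp (e n)) t)"
  let ?K = "\<lambda>n t. 128 * (\<Sum>j<4. P.kolmogorov j (e n) t)"
  let ?S = "\<lambda>n. \<Sum>j<4. LINT t|circ. P.kolmogorov j (e n) t"
  have Im: "bdry I \<in> borel_measurable circ" by (rule measurable_bdry[OF I(1)])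
  have fm: "bdry f \<in> borel_measurable circ" by (rule measurable_bdry[OF f_holomorphic])
  have dm: "bdry (damp (e n)) \<in> borel_measurable circ" for n by (rule measurable_bdry[OF damp_holomorphic[OF e(1)]])
  have bv: "AE t in circ. bdry (b n) t = ?x n t" for n
    using AE_good Ib bounded_rlim(1)[OF bh bb, of n]
  proof eventually_elim
    case (elim t)
    have "bdry (\<lambda>z. I z * b n z) t = bdry (\<lambda>z. f z * damp (e n) z) t"
      by (rule bdry_eqI) (use elim rlim_mult(1) f_rlim(1) damp_rlim(1)[OF e(1)] in \<open>auto simp: fac b_def\<close>)
    then have "bdry I t * bdry (b n) t = bdry f t * bdry (damp (e n)) t"
      using elim rlim_mult(2)[of I t "b n"] rlim_mult(2)[OF f_rlim(1) damp_rlim(1)[OF e(1)], of t n] by simp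
    then have a: "cnj (bdry I t) * (bdry I t * bdry (b n) t) = cnj (bdry I t) * (bdry f t * bdry (damp (e n)) t)" by simp
    have u: "cnj (bdry I t) * bdry I t = 1"
      using elim complex_norm_square[of "bdry I t"] by (simp add: mult.commute)
    have "bdry (b n) t = cnj (bdry I t) * (bdry I t * bdry (b n) t)"
      unfolding mult.assoc[symmetric] u by simp
    also have "\<dots> = ?x n t" unfolding a by (simp only: ac_simps)
    finally show ?case .
  qed
  have b0: "(LINT t|circ. ?x n t) = c * exp (herglotz w 0) * damp (e n) 0" for n
  proof -
    have "(LINT t|circ. ?x n t) = (LINT t|circ. bdry (b n) t)"
      by (rule integral_cong_AE) (use bv[of n] measurable_bdry[OF bh] Im fm dm in auto)
    also have "\<dots> = b n 0" by (rule bounded_mean_value(2)[OF bh bb])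
    finally show ?thesis by (simp add: b_def)
  qed
  have i1: "integrable circ (\<lambda>t. ?x n t)" for n
    using bounded_mean_value(1)[OF bh bb, of n] bv[of n]
    by (subst integrable_cong_AE[where g = "bdry (b n)"]) (use measurable_bdry[OF bh] Im fm dm in auto)
  have i2: "integrable circ (\<lambda>t. ?y n t)" for n
  proof (rule Bochner_Integration.integrable_bound[OF i1[of n]])
    show "AE t in circ. norm (?y n t) \<le> norm (?x n t)"
      by (intro AE_I2) (simp add: norm_mult mult.assoc)
  qed (use Im fm dm in auto)
  \<comment> \<open>Two limits of \<open>D\<close> are compared: 0 by Kolmogorov's estimate, and the
    undamped difference by dominated convergence.\<close>
  define D where "D = (\<lambda>n. (LINT t|circ. ?p n t) - c * exp (herglotz w 0) * damp (e n) 0)"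
  have Dn: "cmod (D n) \<le> 128 * ?S n" for n
  proof -
    have ki: "integrable circ (P.kolmogorov j (e n))" for j by (rule P.kolmogorov_tendsto(1)[OF e])
    have bound: "AE t in circ. norm (?y n t - ?x n t)
        \<le> ?K n t"
      using AE_good Ib
    proof eventually_elim
      case (elim t)
      have "?y n t - ?x n t
          = - (bdry f t * cnj (bdry I t) * (bdry (damp (e n)) t - cnj (bdry (damp (e n)) t)))"
        by (simp add: algebra_simps)
      also have "norm \<dots> = cmod (bdry f t) * cmod (bdry (damp (e n)) t - cnj (bdry (damp (e n)) t))"
        unfolding norm_minus_cancel norm_mult complex_mod_cnj conjunct2[OF elim(2)] by simp
      also have "\<dots> \<le> ?K n t" by (rule f_damp_imaginary_bound[OF e(1) elim(1)])
      finally show ?case .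
    qed
    have D_eq: "D n = (LINT t|circ. ?y n t - ?x n t)"
      unfolding D_def damped_pairing[OF I Ib e(1)] b0[symmetric]
      by (rule Bochner_Integration.integral_diff[symmetric, OF i2 i1])
    have "cmod (D n) \<le> (LINT t|circ. norm (?y n t - ?x n t))"
      unfolding D_eq by (rule integral_norm_bound)
    also have "\<dots> \<le> (LINT t|circ. ?K n t)"
      by (rule integral_mono_AE[OF integrable_norm[OF Bochner_Integration.integrable_diff[OF i2 i1]] _ bound])
        (use ki in auto)
    also have "\<dots> = 128 * ?S n" using ki by simp
    finally show ?thesis .
  qed
  have "(\<lambda>n. 128 * ?S n) \<longlonglongrightarrow> 128 * (\<Sum>j<(4::nat). 0)"
    by (intro tendsto_intros P.kolmogorov_tendsto(2)[OF e])
  then have bound_tendsto: "(\<lambda>n. 128 * ?S n) \<longlonglongrightarrow> 0" by simp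
  have "eventually (\<lambda>n. cmod (D n) \<le> 128 * ?S n) sequentially"
    using Dn by (intro always_eventually allI)
  then have "D \<longlonglongrightarrow> 0" using bound_tendsto by (rule Lim_null_comparison)
  moreover have "D \<longlonglongrightarrow> (LINT t|circ. \<psi> t * cnj (bdry I t)) - c * exp (herglotz w 0) * 1"
    unfolding D_def
  proof (rule tendsto_diff[OF _ tendsto_mult[OF tendsto_const]])
    have "damp (e n) 0 = (\<Prod>j<4. 1 / (1 + of_real (e n) * P.F j 0))" for n by (simp add: damp_def P.\<beta>_def)
    then show "(\<lambda>n. damp (e n) 0) \<longlonglongrightarrow> 1" using damp_tendsto[OF e(2), of "\<lambda>j. P.F j 0"] by simp
    show "(\<lambda>n. LINT t|circ. ?p n t) \<longlonglongrightarrow> (LINT t|circ. \<psi> t * cnj (bdry I t))"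
    proof (rule integral_dominated_convergence[where w = "\<lambda>t. cmod (\<psi> t)"])
      show "AE t in circ. (\<lambda>n. ?p n t) \<longlonglongrightarrow> \<psi> t * cnj (bdry I t)"
        using AE_good
      proof eventually_elim
        case (elim t)
        have "(\<lambda>n. ?p n t) \<longlonglongrightarrow> \<psi> t * cnj (bdry I t * 1)"
          unfolding damp_rlim(2)[OF e(1) elim] by (intro tendsto_intros damp_tendsto e)
        then show ?case by simp
      qed
      show "AE t in circ. norm (?p n t) \<le> cmod (\<psi> t)" for n
        using AE_good Ib by eventually_elim (use damp_rlim_bounds[OF e(1)] in \<open>auto simp: norm_mult mult_left_le\<close>)
    qed (use \<psi> Im dm in auto)
  qed
  ultimately have "0 = (LINT t|circ. \<psi> t * cnj (bdry I t)) - c * exp (herglotz w 0) * 1" by (rule LIMSEQ_unique)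
  then show ?thesis by simp
qed

section \<open>The canonical factorisation of the Riesz projection\<close>

definition "logf t = ln (cmod (bdry f t))"

text \<open>\<open>f\<close> may be unbounded, but \<open>f * damp 1\<close> and
  \<open>damp 1\<close> are bounded and nonzero at \<open>z1\<close>. On the circle the logarithm of
  \<open>cmod f\<close> is the difference of theirs.\<close>

lemma log_boundary_integrable:
  assumes z1: "cmod z1 < 1" "f z1 \<noteq> 0"
  shows "integrable circ logf" "AE t in circ. bdry f t \<noteq> 0"
proof -
  have e: "(0::real) < 1" by simp
  have nz: "f z1 * damp 1 z1 \<noteq> 0" using z1 damp_nonzero[of 1] by simp
  note B = log_subharmonic[OF f_damp_holomorphic[OF e] f_damp_bounded[OF e] z1(1) nz]
  note K = log_subharmonic[OF damp_holomorphic[OF e] damp_bounded[OF e] z1(1) damp_nonzero[OF e z1(1)]]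
  have m: "AE t in circ. bdry (\<lambda>z. f z * damp 1 z) t = bdry f t * bdry (damp 1) t"
    using AE_good by eventually_elim (use rlim_mult(2) f_rlim(1) damp_rlim(1)[OF e] in blast)
  show nz: "AE t in circ. bdry f t \<noteq> 0" using B(1) m by eventually_elim auto
  have "AE t in circ. logf t = ln (cmod (bdry (\<lambda>z. f z * damp 1 z) t)) - ln (cmod (bdry (damp 1) t))"
    using nz m K(1) by eventually_elim (simp add: logf_def norm_mult ln_mult)
  then show "integrable circ logf"
    using Bochner_Integration.integrable_diff[OF B(2) K(2)] measurable_bdry[OF f_holomorphic]
    by (subst integrable_cong_AE) (auto simp: logf_def[abs_def])
qed

text \<open>The bounded function \<open>f * damp e\<close> obeys the inequality with its own
  boundary logarithm, which lies below \<open>logf\<close> because the boundary modulus of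
  \<open>damp e\<close> is at most 1. As \<open>e\<close> tends to 0, the damping disappears on the
  left.\<close>

lemma f_le_exp_poisson:
  assumes z: "cmod z < 1"
  shows "cmod (f z) \<le> exp (poisson_int logf z)"
proof (cases "f z = 0")
  case False
  note li = log_boundary_integrable[OF z False]
  define e where "e = (\<lambda>n::nat. inverse (real (Suc n)))"
  have e: "0 < e n" "e \<longlonglongrightarrow> 0" for n
    using LIMSEQ_inverse_real_of_nat by (auto simp: e_def)
  let ?b = "\<lambda>n z. f z * damp (e n) z"
  have "ln (cmod (?b n z)) \<le> poisson_int logf z" for n
  proof -
    have nz: "?b n z \<noteq> 0" using False damp_nonzero[OF e(1) z] by simp
    note B = log_subharmonic[OF f_damp_holomorphic[OF e(1)] f_damp_bounded[OF e(1)] z nz]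
    have "ln (cmod (?b n z)) \<le> (LINT t|circ. poisson z t * ln (cmod (bdry (?b n) t)))"
      by (rule B(3)[OF z nz])
    also have "\<dots> \<le> poisson_int logf z"
    proof (rule integrable_poisson_le[OF B(2) li(1) _ z])
      show "AE t in circ. ln (cmod (bdry (?b n) t)) \<le> logf t"
        using AE_good B(1)
      proof eventually_elim
        case (elim t)
        have "bdry (?b n) t = bdry f t * bdry (damp (e n)) t"
          by (rule rlim_mult(2)[OF f_rlim(1)[OF elim(1)] damp_rlim(1)[OF e(1) elim(1)]])
        then have "cmod (bdry (?b n) t) \<le> cmod (bdry f t)"
          using damp_rlim_bounds[OF e(1) elim(1), of n] by (simp add: norm_mult mult_left_le)
        then show ?case unfolding logf_def using elim(2) by (intro ln_mono) auto
      qed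
    qed
    finally show ?thesis .
  qed
  moreover have "(\<lambda>n. ln (cmod (?b n z))) \<longlonglongrightarrow> ln (cmod (f z * 1))"
  proof (intro tendsto_intros)
    show "(\<lambda>n. damp (e n) z) \<longlonglongrightarrow> 1"
      unfolding damp_def P.\<beta>_def by (rule damp_tendsto[OF e(2)])
  qed (use False in simp)
  ultimately have "ln (cmod (f z)) \<le> poisson_int logf z"
    by (intro LIMSEQ_le_const2[of "\<lambda>n. ln (cmod (?b n z))"]) auto
  then have "exp (ln (cmod (f z))) \<le> exp (poisson_int logf z)" by (rule exp_le_cancel_iff[THEN iffD2])
  then show ?thesis using False by simp
qed simp

text \<open>Dividing by the outer function with boundary modulus \<open>cmod (bdry f)\<close> leaves
  a function bounded by 1, by \<open>f_le_exp_poisson\<close>, whose radial limits have modulus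
  1.\<close>

lemma inner_outer_factorization:
  assumes z1: "cmod z1 < 1" "f z1 \<noteq> 0"
  shows "inner_fun (\<lambda>z. f z / exp (herglotz logf z))"
proof -
  note li = log_boundary_integrable[OF z1]
  define I where "I = (\<lambda>z. f z / exp (herglotz logf z))"
  have I: "I holomorphic_on ball 0 1" unfolding I_def
    by (intro holomorphic_intros f_holomorphic herglotz_holomorphic li) auto
  have Ib: "\<forall>z\<in>ball 0 1. cmod (I z) \<le> 1"
    using f_le_exp_poisson by (auto simp: I_def norm_divide Re_herglotz[OF li(1)] divide_le_eq_1)
  have "AE t in circ. \<exists>u. cmod u = 1 \<and> ((\<lambda>r. I (polar r t)) \<longlongrightarrow> u) (at_left 1)"
    using bounded_rlim(1)[OF I Ib] AE_good li(2) poisson_radial_limit[OF li(1)]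
  proof eventually_elim
    case (elim t)
    have 1: "((\<lambda>r. cmod (I (polar r t))) \<longlongrightarrow> cmod (bdry I t)) (at_left 1)"
      using elim(1) unfolding has_rlim_def by (rule tendsto_norm)
    have 2: "((\<lambda>r. cmod (f (polar r t)) / exp (poisson_int logf (polar r t))) \<longlongrightarrow> cmod (bdry f t) / exp (logf t)) (at_left 1)"
      using elim(4) f_rlim(1)[OF elim(2)] unfolding has_rlim_def by (intro tendsto_intros) auto
    have "((\<lambda>r. cmod (I (polar r t))) \<longlongrightarrow> cmod (bdry f t) / exp (logf t)) (at_left 1)"
      by (rule tendsto_at_left_1_cong[OF 2]) (auto simp: I_def norm_divide Re_herglotz[OF li(1)] norm_mult)
    then have "cmod (bdry I t) = cmod (bdry f t) / exp (logf t)" using tendsto_unique[OF _ 1] by simp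
    also have "\<dots> = 1" using elim(3) by (simp add: logf_def)
    finally show ?case using elim(1) unfolding has_rlim_def by blast
  qed
  then show ?thesis
    unfolding inner_fun_def I_def[symmetric] using I Ib unfolding AE_circ_iff by blast
qed

end

section \<open>The geometric mean and its comparison with the norm\<close>

lemma circle_geom_mean_eq:
  assumes w: "integrable circ w" and g: "AE t in circ. g t \<noteq> 0 \<and> ln (cmod (g t)) = w t"
  shows "circle_geom_mean g = ereal (exp (LINT t|circ. w t))"
proof -
  let ?A = "{0..2*pi}"
  have g': "AE t in lebesgue. t \<in> ?A \<longrightarrow> g t \<noteq> 0 \<and> ln (cmod (g t)) = w t"
    using g unfolding AE_circ_iff .
  have si: "set_integrable lebesgue ?A w" using w by (simp add: integrable_circ_iff)
  let ?p = "\<lambda>t. max 0 (indicator ?A t *\<^sub>R w t)" and ?m = "\<lambda>t. max 0 (- (indicator ?A t *\<^sub>R w t))"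
  have i: "integrable lebesgue ?p" "integrable lebesgue ?m"
    using si unfolding set_integrable_def by auto
  have "log_pos_int g = (\<integral>\<^sup>+t. ennreal (?p t) \<partial>lebesgue)"
    unfolding log_pos_int_def
    by (rule nn_integral_cong_AE) (use g' in \<open>eventually_elim, auto simp: indicator_def\<close>)
  also have "\<dots> = ennreal (LINT t|lebesgue. ?p t)"
    by (rule nn_integral_eq_integral[OF i(1)]) simp
  finally have P: "log_pos_int g = ennreal (LINT t|lebesgue. ?p t)" .
  have "log_neg_int g = (\<integral>\<^sup>+t. ennreal (?m t) \<partial>lebesgue)"
    unfolding log_neg_int_def
    by (rule nn_integral_cong_AE) (use g' in \<open>eventually_elim, auto simp: indicator_def\<close>)
  also have "\<dots> = ennreal (LINT t|lebesgue. ?m t)"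
    by (rule nn_integral_eq_integral[OF i(2)]) simp
  finally have N: "log_neg_int g = ennreal (LINT t|lebesgue. ?m t)" .
  have "(LINT t|lebesgue. ?p t) - (LINT t|lebesgue. ?m t)
      = (LINT t|lebesgue. ?p t - ?m t)"
    by (rule Bochner_Integration.integral_diff[symmetric, OF i])
  also have "\<dots> = (LINT t|lebesgue. indicator ?A t *\<^sub>R w t)"
    by (rule arg_cong[where f = "integral\<^sup>L lebesgue"]) (auto simp: fun_eq_iff max_def)
  also have "\<dots> = 2 * pi * (LINT t|circ. w t)"
    unfolding integral_circ set_lebesgue_integral_def by simp
  finally have d: "(LINT t|lebesgue. ?p t) - (LINT t|lebesgue. ?m t) = 2 * pi * (LINT t|circ. w t)" .
  have "enn2real (log_pos_int g) - enn2real (log_neg_int g) = 2 * pi * (LINT t|circ. w t)"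
    unfolding P N d[symmetric] by (simp add: integral_nonneg)
  then show ?thesis unfolding circle_geom_mean_def P N by simp
qed

text \<open>The degenerate case, in which the logarithm is minus infinity everywhere. It occurs for
  nontrivial \<psi> as well, for instance when \<psi> is the conjugate of
  \<open>cis\<close>.\<close>

lemma circle_geom_mean_0: "circle_geom_mean (\<lambda>_. 0) = 0"
proof -
  have "log_neg_int (\<lambda>_. 0) = (\<integral>\<^sup>+ t. \<infinity> * indicator {0..2*pi} t \<partial>lebesgue)"
    unfolding log_neg_int_def by (simp add: mult.commute)
  also have "\<dots> = \<infinity> * emeasure lebesgue {0..2*pi}" by (rule nn_integral_cmult_indicator) simp
  also have "\<dots> = \<infinity>" by (simp add: ennreal_top_mult)
  finally have "log_neg_int (\<lambda>_. 0) = \<infinity>" .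
  moreover have "log_pos_int (\<lambda>_. 0) = 0" by (simp add: log_pos_int_def)
  ultimately show ?thesis by (simp add: circle_geom_mean_def)
qed

lemma circle_L1_norm_eq: "circle_L1_norm f = (LINT t|circ. cmod (f t))"
  by (simp add: circle_L1_norm_def integral_circ)

lemma not_AE_circ_False: "\<not> (AE t in circ. False)"
proof
  assume "AE t in circ. False"
  then have "(LINT t|circ. 1) = (LINT t|circ. (0::real))"
    by (intro integral_cong_AE) auto
  then show False by simp
qed

theorem theorem1:
  fixes \<psi> :: "real \<Rightarrow> complex"
  assumes "set_integrable lebesgue {0..2*pi} \<psi>"
  shows "circle_geom_mean (riesz_boundary \<psi>) \<le> ereal (circle_L1_norm \<psi>) \<and>
         (\<not> (AE \<theta> in lebesgue. \<theta> \<in> {0..2*pi} \<longrightarrow> \<psi> \<theta> = 0) \<longrightarrow>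
         (circle_geom_mean (riesz_boundary \<psi>) = ereal (circle_L1_norm \<psi>) \<longleftrightarrow>
          (\<exists>I \<Phi>. inner_fun I \<and> outer_fun \<Phi> \<and> (\<forall>z\<in>ball 0 1. riesz_disc \<psi> z = I z * \<Phi> z) \<and>
             (AE \<theta> in lebesgue. \<theta> \<in> {0..2*pi} \<longrightarrow>
                Im (cnj (radial_limit I \<theta>) * \<psi> \<theta>) = 0 \<and> Re (cnj (radial_limit I \<theta>) * \<psi> \<theta>) \<ge> 0))))"
proof -
  interpret cauchy_transform \<psi>
    by standard (use assms in \<open>simp add: integrable_circ_iff\<close>)
  let ?N = "LINT t|circ. cmod (\<psi> t)"
  let ?pos = "\<lambda>I. AE t in circ. Im (cnj (radial_limit I t) * \<psi> t) = 0 \<and> Re (cnj (radial_limit I t) * \<psi> t) \<ge> 0"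
  let ?eq = "\<exists>I \<Phi>. inner_fun I \<and> outer_fun \<Phi> \<and> (\<forall>z\<in>ball 0 1. f z = I z * \<Phi> z) \<and> ?pos I"
  have N0: "0 \<le> ?N" by simp
  have "circle_geom_mean (riesz_boundary \<psi>) \<le> ereal ?N \<and>
      (\<not> (AE t in circ. \<psi> t = 0) \<longrightarrow> (circle_geom_mean (riesz_boundary \<psi>) = ereal ?N \<longleftrightarrow> ?eq))"
  proof (cases "\<exists>z1. cmod z1 < 1 \<and> f z1 \<noteq> 0")
    case False
    have "riesz_boundary \<psi> t = 0" for t
    proof -
      have "((\<lambda>r. 0) \<longlongrightarrow> (0::complex)) (at_left (1::real))" by simp
      from rlim_cong_eventually[OF this, of f t] have "bdry f t = 0" "has_rlim f t" using False by (auto simp: norm_mult)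
      then show ?thesis unfolding riesz_boundary_def f_def[symmetric] using rlim_radial_limit by simp
    qed
    then have G: "circle_geom_mean (riesz_boundary \<psi>) = 0" using circle_geom_mean_0 by presburger
    \<comment> \<open>With a zero projection both sides of the equivalence are false. An outer
      factor has no zeros, so the inner factor would vanish identically, against its boundary
      modulus 1; and the norm of a nontrivial \<psi> is positive.\<close>
    have "\<not> ?eq"
    proof
      assume ?eq
      then obtain I \<Phi> where I: "inner_fun I" and \<Phi>: "outer_fun \<Phi>" and fac: "\<forall>z\<in>ball 0 1. f z = I z * \<Phi> z" by blast
      have "\<Phi> z \<noteq> 0" if "z \<in> ball 0 1" for z using \<Phi> that unfolding outer_fun_iff by force
      then have I0: "I z = 0" if "cmod z < 1" for z using fac False that by force
      have "AE t in circ. False"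
        using inner_fun_bdry(3)[OF I]
      proof eventually_elim
        case (elim t)
        have "((\<lambda>r. 0) \<longlongrightarrow> (0::complex)) (at_left (1::real))" by simp
        from rlim_cong_eventually(1)[OF this, of I t] have "bdry I t = 0" using I0 by (auto simp: norm_mult)
        then show ?case using elim by simp
      qed
      then show False using not_AE_circ_False by blast
    qed
    moreover have "?N \<noteq> 0" if "\<not> (AE t in circ. \<psi> t = 0)"
    proof
      assume "?N = 0"
      then have "AE t in circ. cmod (\<psi> t) = 0"
        by (subst (asm) integral_nonneg_eq_0_iff_AE) (use \<psi> in auto)
      then show False using that by simp
    qed
    ultimately show ?thesis unfolding G using N0 by auto
  next
    case True
    then obtain z1 where z1: "cmod z1 < 1" "f z1 \<noteq> 0" by blast
    note li = log_boundary_integrable[OF z1]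
    let ?G = "exp (LINT t|circ. logf t)"
    have G: "circle_geom_mean (riesz_boundary \<psi>) = ereal ?G"
    proof (rule circle_geom_mean_eq[OF li(1)])
      show "AE t in circ. riesz_boundary \<psi> t \<noteq> 0 \<and> ln (cmod (riesz_boundary \<psi> t)) = logf t"
        using AE_good li(2)
      proof eventually_elim
        case (elim t)
        have "riesz_boundary \<psi> t = bdry f t"
          unfolding riesz_boundary_def f_def[symmetric] by (rule rlim_radial_limit[OF f_rlim(1)[OF elim(1)]])
        then show ?case using elim(2) by (simp add: logf_def)
      qed
    qed
    \<comment> \<open>The inner factor normalised so that the outer factor is positive at 0. With
      this choice the mean of \<open>X\<close> is the geometric mean itself, without a unimodular
      constant.\<close>
    define J where "J = (\<lambda>z. f z / exp (herglotz logf z))"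
    have J: "inner_fun J" unfolding J_def by (rule inner_outer_factorization[OF z1])
    note Jb = inner_fun_bdry[OF J]
    have Jm: "bdry J \<in> borel_measurable circ" by (rule measurable_bdry[OF Jb(1)])
    have "1 * exp (herglotz logf 0) = (LINT t|circ. \<psi> t * cnj (bdry J t))"
      by (rule outer_factor_at_0[OF Jb _ li(1)]) (auto simp: J_def)
    then have GJ: "complex_of_real ?G = (LINT t|circ. \<psi> t * cnj (bdry J t))"
      unfolding herglotz_0[OF li(1)] by (simp add: exp_of_real)
    define X where "X t = \<psi> t * cnj (bdry J t)" for t
    have ij: "integrable circ X"
      unfolding X_def by (rule integrable_circ_mult_bounded[OF \<psi>, of _ 1]) (use Jm Jb(3) in auto)
    have nj: "AE t in circ. cmod (X t) = cmod (\<psi> t)"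
      using Jb(3) by eventually_elim (simp add: X_def norm_mult)
    have GR: "?G = (LINT t|circ. Re (X t))"
      using arg_cong[OF GJ, of Re] ij unfolding X_def[symmetric] by simp
    have ReN: "AE t in circ. Re (X t) \<le> cmod (\<psi> t)"
      using nj by eventually_elim (metis complex_Re_le_cmod)
    have "?G \<le> ?N" unfolding GR
      by (rule integral_mono_AE[OF _ _ ReN]) (use ij \<psi> in auto)
    moreover have "?eq" if eq: "?G = ?N"
    proof (intro exI conjI)
      show "inner_fun J" by (rule J)
      show "outer_fun (\<lambda>z. 1 * exp (herglotz logf z))" unfolding outer_fun_iff
        by (intro exI[of _ 1] exI[of _ logf] conjI li(1)) auto
      show "\<forall>z\<in>ball 0 1. f z = J z * (1 * exp (herglotz logf z))" by (simp add: J_def)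
      \<comment> \<open>A nonnegative function with mean 0 vanishes almost everywhere;
        \<open>X\<close> then equals its own modulus.\<close>
      have "(LINT t|circ. cmod (\<psi> t) - Re (X t)) = 0"
        using eq \<psi> ij unfolding GR by simp
      then have "AE t in circ. cmod (\<psi> t) - Re (X t) = 0"
        by (subst (asm) integral_nonneg_eq_0_iff_AE) (use \<psi> ij ReN in auto)
      then show "?pos J" using nj Jb(3)
      proof eventually_elim
        case (elim t)
        define x where "x = X t"
        have x: "cmod x = Re x" using elim unfolding x_def by linarith
        have "(Im x)\<^sup>2 = 0" using cmod_power2[of x] unfolding x by simp
        then have "Im x = 0 \<and> 0 \<le> Re x" using x norm_ge_zero[of x] by (metis zero_eq_power2)
        moreover have "radial_limit J t = bdry J t" using elim rlim_radial_limit by blast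
        ultimately show ?case by (simp add: x_def X_def mult.commute)
      qed
    qed
    \<comment> \<open>The given factorisation may differ from the normalised one by a unimodular
      \<open>c\<close>. Taking moduli in \<open>outer_factor_at_0\<close> removes it, and
      \<open>w\<close> agrees with \<open>logf\<close> almost everywhere.\<close>
    moreover have "?G = ?N" if eq: "?eq"
    proof -
      obtain I \<Phi> where I: "inner_fun I" and \<Phi>: "outer_fun \<Phi>" and fac: "\<forall>z\<in>ball 0 1. f z = I z * \<Phi> z" and pos: "?pos I"
        using eq by blast
      obtain c w where c: "cmod c = 1" and w: "integrable circ w" and \<Phi>w: "\<forall>z\<in>ball 0 1. \<Phi> z = c * exp (herglotz w z)"
        using \<Phi> unfolding outer_fun_iff by blast
      note Ib = inner_fun_bdry[OF I]
      have fac': "f z = I z * (c * exp (herglotz w z))" if "cmod z < 1" for z using fac \<Phi>w that by simp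
      have "AE t in circ. exp (w t) = cmod (bdry f t)"
        by (rule factor_boundary_modulus[OF Ib(3) c w fac'])
      then have "AE t in circ. w t = logf t"
        by eventually_elim (metis logf_def ln_exp)
      then have wG: "(LINT t|circ. w t) = (LINT t|circ. logf t)"
        by (intro integral_cong_AE) (use w li(1) in auto)
      have "(LINT t|circ. \<psi> t * cnj (bdry I t)) = (LINT t|circ. complex_of_real (cmod (\<psi> t)))"
      proof (rule integral_cong_AE)
        show "AE t in circ. \<psi> t * cnj (bdry I t) = complex_of_real (cmod (\<psi> t))"
          using pos Ib(3)
        proof eventually_elim
          case (elim t)
          define x where "x = \<psi> t * cnj (bdry I t)"
          have "radial_limit I t = bdry I t" using elim rlim_radial_limit by blast
          then have x: "Im x = 0" "0 \<le> Re x" using elim by (auto simp: x_def mult.commute)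
          have "cmod x = cmod (\<psi> t)" using elim by (simp add: x_def norm_mult)
          then show ?case using x unfolding x_def[symmetric] by (simp add: complex_eq_iff cmod_eq_Re)
        qed
      qed (use \<psi> measurable_bdry[OF Ib(1)] in auto)
      then have "c * exp (herglotz w 0) = complex_of_real ?N"
        using outer_factor_at_0[OF Ib c w fac'] by simp
      then have "cmod (c * exp (herglotz w 0)) = ?N" using N0 by simp
      then show ?thesis unfolding norm_mult c herglotz_0[OF w] wG by simp
    qed
    ultimately show ?thesis unfolding G by auto
  qed
  then show ?thesis
    unfolding circle_L1_norm_eq f_def AE_circ_iff .
qed

end
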